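(* Let $\mathcal{M}$ and $\mathcal{M}'$ be braided monoidal categories and let $(F,\phi_0,\phi_2):\mathcal{M}\to\mathcal{M}'$ be a braided monoidal functor. Then $F$ induces a functor $\mathrm{Bialg}F:\mathrm{Bialg}_{\mathcal{M}}\to\mathrm{Bialg}_{\mathcal{M}'}$ which acts as $F$ on morphisms and which is defined on objects by $$\mathrm{Bialg}F(B,m_B,u_B,\Delta_B,\varepsilon_B):=(FB,m_{FB},u_{FB},\Delta_{FB},\varepsilon_{FB}),$$ where $m_{FB}:=Fm_B\circ\phi_2(B,B):FB\otimes FB\to FB$, $u_{FB}:=Fu_B\circ\phi_0:\mathbf{1}'\to FB$, $\Delta_{FB}:=\phi_2^{-1}(B,B)\circ F\Delta_B:FB\to FB\otimes FB$, $\varepsilon_{FB}:=\phi_0^{-1}\circ F\varepsilon_B:FB\to\mathbf{1}'$, and the following equalities of functors hold: $$J'\circ F=\mathrm{Br}F\circ J,\qquad J'_{\mathrm{Bialg}}\circ\mathrm{Bialg}F=\mathrm{BrBialg}F\circ J_{\mathrm{Bialg}},\qquad \mho'\circ\mathrm{Bialg}F=\mathrm{Alg}F\circ\mho.$$ 1) $\mathrm{Bialg}F$ is an equivalence (respectively a category isomorphism, respectively conservative) whenever $F$ is. 2) Let moreover $\mathcal{M}$ and $\mathcal{M}'$ be preadditive with equalizers, with tensor functors that are additive and preserve equalizers (so that $P$ and $P'$ are defined). If $F$ preserves equalizers, then $$P'\circ\mathrm{Bialg}F=F\circ P\qquad\text{and}\qquad \xi'(\mathrm{Bialg}F)=F\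xi.$$
   Context: Associativity constraints are suppressed; $l_X:\mathbf 1\otimes X\to X$, $r_X:X\otimes\mathbf 1\to X$; an object also denotes its identity morphism. The tensor functors are $M\otimes(-)$ and $(-)\otimes M$ for all objects $M$. The braidings of $\mathcal M,\mathcal M'$ are $c_{U,V}:U\otimes V\to V\otimes U$ and $c'$. A monoidal functor is a strong monoidal one, with isomorphisms $\phi_2(U,V):FU\otimes FV\to F(U\otimes V)$ and $\phi_0:\mathbf 1'\to F\mathbf 1$; it is braided if $F(c_{U,V})\circ\phi_2(U,V)=\phi_2(V,U)\circ c'_{FU,FV}$. A functor is conservative if it reflects isomorphisms. $\Delta_{\mathbf 1}=l_{\mathbf 1}^{-1}=r_{\mathbf 1}^{-1}$, $m_{\mathbf 1}=l_{\mathbf 1}=r_{\mathbf 1}$. $\mathrm{Bialg}_{\mathcal M}$ is the category of quintuples $(B,m,u,\Delta,\varepsilon)$ with $(B,m,u)$ an algebra and $(B,\Delta,\varepsilon)$ a coalgebra in $\mathcal M$ such that $\Delta,\varepsilon$ are algebra morphisms, $B\otimes B$ being an algebra via $(m\otimes m)(B\otimes c_{B,B}\otimes B)$ and $(u\otimes u)l_{\mathbf 1}^{-1}$; morphisms are algebra and coalgebra morphisms. $\mho:\mathrm{Bialg}_{\mathcal M}\to\mathrm{Alg}_{\mathcal M}$ is the forgetful functor to the category of algebras in $\mathcal M$. A braided object is a pair $(V,c)$ with $c:V\otimes V\to V\otimes V$ invertible and $(c\otimes V)(V\otimes c)(c\otimes V)=(V\otimes c)(c\otimes V)(V\otimes c)$;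 a morphism $(V,c_V)\to(W,c_W)$ is $f:V\to W$ with $c_W(f\otimes f)=(f\otimes f)c_V$; category $\mathrm{Br}_{\mathcal M}$. A braided bialgebra is $(B,m,u,\Delta,\varepsilon,c)$ with $(B,m,u)$ an algebra, $(B,\Delta,\varepsilon)$ a coalgebra, $(B,c)$ a braided object, such that $c(m\otimes B)=(B\otimes m)(c\otimes B)(B\otimes c)$, $c(B\otimes m)=(m\otimes B)(B\otimes c)(c\otimes B)$, $c(u\otimes B)l_B^{-1}=(B\otimes u)r_B^{-1}$, $c(B\otimes u)r_B^{-1}=(u\otimes B)l_B^{-1}$, $(\Delta\otimes B)c=(B\otimes c)(c\otimes B)(B\otimes\Delta)$, $(B\otimes\Delta)c=(c\otimes B)(B\otimes c)(\Delta\otimes B)$, $l_B(\varepsilon\otimes B)c=r_B(B\otimes\varepsilon)$, $r_B(B\otimes\varepsilon)c=l_B(\varepsilon\otimes B)$, $\Delta m=(m\otimes m)(B\otimes c\otimes B)(\Delta\otimes\Delta)$, $\Delta u=(u\otimes u)\Delta_{\mathbf 1}$, $\varepsilon m=m_{\mathbf 1}(\varepsilon\otimes\varepsilon)$, $\varepsilon u=\mathrm{Id}_{\mathbf 1}$; morphisms are algebra and coalgebra morphisms that are morphisms of braided objects; category $\mathrm{BrBialg}_{\mathcal M}$. $J:\mathcal M\to\mathrm{Br}_{\mathcal M}$, $JV=(V,c_{V,V})$, and $J_{\mathrm{Bialg}}:\mathrm{Bialg}_{\mathcal M}\to\mathrm{BrBialg}_{\mathcal M}$, $(B,m_B,u_B,\Delta_B,\varepsilon_B)\mapsto(B,m_B,u_B,\Delta_B,\varepsilon_B,c_{B,B})$,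 act as the identity on morphisms. The functors $\mathrm{Br}F(V,c_V)=(FV,c_{FV})$, $\mathrm{Alg}F(A,m_A,u_A)=(FA,m_{FA},u_{FA})$, $\mathrm{BrBialg}F(B,m_B,u_B,\Delta_B,\varepsilon_B,c_B)=(FB,m_{FB},u_{FB},\Delta_{FB},\varepsilon_{FB},c_{FB})$ act as $F$ on morphisms, where $c_{FV}=\phi_2^{-1}(V,V)\circ Fc_V\circ\phi_2(V,V)$ and the other structure maps are given by the formulas in the claim. Under the assumptions on $\mathcal M,\mathcal M'$ in part 2), it is always implicitly assumed that specific equalizers can be chosen: for $\mathbb B=(B,m_B,u_B,\Delta_B,\varepsilon_B)\in\mathrm{Bialg}_{\mathcal M}$, $\xi\mathbb B:P(\mathbb B)\to B$ denotes the chosen equalizer in $\mathcal M$ of $\Delta_B$ and $(B\otimes u_B)r_B^{-1}+(u_B\otimes B)l_B^{-1}$; for $f:\mathbb B\to\mathbb B'$, $P(f)$ is the unique morphism with $\xi\mathbb B'\circ P(f)=f\circ\xi\mathbb B$; this gives the functor $P:\mathrm{Bialg}_{\mathcal M}\to\mathcal M$ and a natural transformation $\xi$ from $P$ to the forgetful functor $\mathrm{Bialg}_{\mathcal M}\to\mathcal M$. Primes denote the analogues for $\mathcal M'$.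
   Formalization: In 2), F is also assumed additive; the equalities hold for a suitable choice of ξ' given ξ, provided F(ξB) depends only on BialgF(B) (a necessary condition); for arbitrary chosen equalizers they hold up to a canonical natural isomorphism compatible with ξ' and Fξ. *)

theory Defs
  imports "HOL-Algebra.Group"
begin

text \<open>
  Arrows know their domain and codomain, so hom-sets are disjoint. Values of the record
  fields outside the sets \<open>Obj\<close> and \<open>Arr\<close> are irrelevant.
\<close>

record ('o, 'a) cat =
  Obj :: "'o set"
  Arr :: "'a set"
  Dom :: "'a \<Rightarrow> 'o"
  Cod :: "'a \<Rightarrow> 'o"
  ident :: "'o \<Rightarrow> 'a"
  comp :: "'a \<Rightarrow> 'a \<Rightarrow> 'a"  (infixr "\<cdot>\<index>" 55)

definition Hom :: "('o, 'a, 'z) cat_scheme \<Rightarrow> 'o \<Rightarrow> 'o \<Rightarrow> 'a set" where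
  "Hom C X Y = {f \<in> Arr C. Dom C f = X \<and> Cod C f = Y}"

locale category =
  fixes C :: "('o, 'a, 'z) cat_scheme" (structure)
  assumes Dom_Obj: "f \<in> Arr C \<Longrightarrow> Dom C f \<in> Obj C"
    and Cod_Obj: "f \<in> Arr C \<Longrightarrow> Cod C f \<in> Obj C"
    and ident_Hom: "X \<in> Obj C \<Longrightarrow> ident C X \<in> Hom C X X"
    and comp_Hom: "\<lbrakk>f \<in> Hom C X Y; g \<in> Hom C Y Z\<rbrakk> \<Longrightarrow> g \<cdot> f \<in> Hom C X Z"
    and ident_left: "f \<in> Hom C X Y \<Longrightarrow> ident C Y \<cdot> f = f"
    and ident_right: "f \<in> Hom C X Y \<Longrightarrow> f \<cdot> ident C X = f"
    and comp_assoc: "\<lbrakk>f \<in> Hom C W X; g \<in> Hom C X Y; h \<in> Hom C Y Z\<rbrakk>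
          \<Longrightarrow> (h \<cdot> g) \<cdot> f = h \<cdot> (g \<cdot> f)"

definition inverse_arrows :: "('o, 'a, 'z) cat_scheme \<Rightarrow> 'a \<Rightarrow> 'a \<Rightarrow> bool" where
  "inverse_arrows C f g \<longleftrightarrow> f \<in> Arr C \<and> g \<in> Hom C (Cod C f) (Dom C f) \<and>
     g \<cdot>\<^bsub>C\<^esub> f = ident C (Dom C f) \<and> f \<cdot>\<^bsub>C\<^esub> g = ident C (Cod C f)"

definition is_iso :: "('o, 'a, 'z) cat_scheme \<Rightarrow> 'a \<Rightarrow> bool" where
  "is_iso C f \<longleftrightarrow> (\<exists>g. inverse_arrows C f g)"

definition inv_arr :: "('o, 'a, 'z) cat_scheme \<Rightarrow> 'a \<Rightarrow> 'a" where
  "inv_arr C f = (THE g. inverse_arrows C f g)"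

definition is_equalizer :: "('o, 'a, 'z) cat_scheme \<Rightarrow> 'a \<Rightarrow> 'a \<Rightarrow> 'a \<Rightarrow> bool" where
  "is_equalizer C f g e \<longleftrightarrow>
     f \<in> Arr C \<and> g \<in> Hom C (Dom C f) (Cod C f) \<and>
     e \<in> Arr C \<and> Cod C e = Dom C f \<and> f \<cdot>\<^bsub>C\<^esub> e = g \<cdot>\<^bsub>C\<^esub> e \<and>
     (\<forall>h \<in> Arr C. Cod C h = Dom C f \<and> f \<cdot>\<^bsub>C\<^esub> h = g \<cdot>\<^bsub>C\<^esub> h \<longrightarrow>
        (\<exists>!k. k \<in> Hom C (Dom C h) (Dom C e) \<and> e \<cdot>\<^bsub>C\<^esub> k = h))"

definition has_equalizers :: "('o, 'a, 'z) cat_scheme \<Rightarrow> bool" where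
  "has_equalizers C \<longleftrightarrow>
     (\<forall>X \<in> Obj C. \<forall>Y \<in> Obj C. \<forall>f \<in> Hom C X Y. \<forall>g \<in> Hom C X Y. \<exists>e. is_equalizer C f g e)"

record ('o, 'a, 'p, 'b) fctr =
  omap :: "'o \<Rightarrow> 'p"
  amap :: "'a \<Rightarrow> 'b"

locale cfunctor = C: category C + D: category D
  for C :: "('o, 'a, 'y) cat_scheme" and D :: "('p, 'b, 'z) cat_scheme" +
  fixes F :: "('o, 'a, 'p, 'b) fctr"
  assumes omap_Obj: "X \<in> Obj C \<Longrightarrow> omap F X \<in> Obj D"
    and amap_Hom: "f \<in> Hom C X Y \<Longrightarrow> amap F f \<in> Hom D (omap F X) (omap F Y)"
    and amap_ident: "X \<in> Obj C \<Longrightarrow> amap F (ident C X) = ident D (omap F X)"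
    and amap_comp: "\<lbrakk>f \<in> Hom C X Y; g \<in> Hom C Y Z\<rbrakk>
          \<Longrightarrow> amap F (g \<cdot>\<^bsub>C\<^esub> f) = amap F g \<cdot>\<^bsub>D\<^esub> amap F f"

definition id_fctr :: "('o, 'a, 'o, 'a) fctr" where
  "id_fctr = \<lparr>omap = (\<lambda>X. X), amap = (\<lambda>f. f)\<rparr>"

definition comp_fctr ::
    "('p, 'b, 'q, 'c) fctr \<Rightarrow> ('o, 'a, 'p, 'b) fctr \<Rightarrow> ('o, 'a, 'q, 'c) fctr"
    (infixl "\<circ>\<^sub>F" 55) where
  "G \<circ>\<^sub>F F = \<lparr>omap = omap G \<circ> omap F, amap = amap G \<circ> amap F\<rparr>"

text \<open>
  Functors are raw pairs of maps without a recorded source and target, so equality as functors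
  from \<open>C\<close> to \<open>D\<close> is agreement on \<open>Obj C\<close> and \<open>Arr C\<close>, together with functoriality.
\<close>

definition functor_eq :: "('o, 'a, 'y) cat_scheme \<Rightarrow> ('p, 'b, 'z) cat_scheme \<Rightarrow>
    ('o, 'a, 'p, 'b) fctr \<Rightarrow> ('o, 'a, 'p, 'b) fctr \<Rightarrow> bool" where
  "functor_eq C D F G \<longleftrightarrow> cfunctor C D F \<and> cfunctor C D G \<and>
     (\<forall>X \<in> Obj C. omap F X = omap G X) \<and> (\<forall>f \<in> Arr C. amap F f = amap G f)"

locale natural_transformation = F: cfunctor C D F + G: cfunctor C D G
  for C :: "('o, 'a, 'y) cat_scheme" and D :: "('p, 'b, 'z) cat_scheme"
    and F :: "('o, 'a, 'p, 'b) fctr" and G :: "('o, 'a, 'p, 'b) fctr" +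
  fixes \<tau> :: "'o \<Rightarrow> 'b"
  assumes component_Hom: "X \<in> Obj C \<Longrightarrow> \<tau> X \<in> Hom D (omap F X) (omap G X)"
    and naturality: "f \<in> Hom C X Y \<Longrightarrow> \<tau> Y \<cdot>\<^bsub>D\<^esub> amap F f = amap G f \<cdot>\<^bsub>D\<^esub> \<tau> X"

definition nat_eq :: "('o, 'a, 'y) cat_scheme \<Rightarrow> ('p, 'b, 'z) cat_scheme \<Rightarrow>
    ('o, 'a, 'p, 'b) fctr \<Rightarrow> ('o, 'a, 'p, 'b) fctr \<Rightarrow> ('o \<Rightarrow> 'b) \<Rightarrow> ('o \<Rightarrow> 'b) \<Rightarrow> bool" where
  "nat_eq C D F G \<sigma> \<tau> \<longleftrightarrow> natural_transformation C D F G \<sigma> \<and>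
     natural_transformation C D F G \<tau> \<and> (\<forall>X \<in> Obj C. \<sigma> X = \<tau> X)"

definition natural_iso :: "('o, 'a, 'y) cat_scheme \<Rightarrow> ('p, 'b, 'z) cat_scheme \<Rightarrow>
    ('o, 'a, 'p, 'b) fctr \<Rightarrow> ('o, 'a, 'p, 'b) fctr \<Rightarrow> ('o \<Rightarrow> 'b) \<Rightarrow> bool" where
  "natural_iso C D F G \<tau> \<longleftrightarrow> natural_transformation C D F G \<tau> \<and> (\<forall>X \<in> Obj C. is_iso D (\<tau> X))"

definition equivalence_functor :: "('o, 'a, 'y) cat_scheme \<Rightarrow> ('p, 'b, 'z) cat_scheme \<Rightarrow>
    ('o, 'a, 'p, 'b) fctr \<Rightarrow> bool" where
  "equivalence_functor C D F \<longleftrightarrow> cfunctor C D F \<and>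
     (\<exists>G \<eta> \<epsilon>. cfunctor D C G \<and> natural_iso C C id_fctr (G \<circ>\<^sub>F F) \<eta> \<and>
              natural_iso D D (F \<circ>\<^sub>F G) id_fctr \<epsilon>)"

definition isomorphism_functor :: "('o, 'a, 'y) cat_scheme \<Rightarrow> ('p, 'b, 'z) cat_scheme \<Rightarrow>
    ('o, 'a, 'p, 'b) fctr \<Rightarrow> bool" where
  "isomorphism_functor C D F \<longleftrightarrow> cfunctor C D F \<and>
     (\<exists>G. cfunctor D C G \<and> functor_eq C C (G \<circ>\<^sub>F F) id_fctr \<and> functor_eq D D (F \<circ>\<^sub>F G) id_fctr)"

definition conservative_functor :: "('o, 'a, 'y) cat_scheme \<Rightarrow> ('p, 'b, 'z) cat_scheme \<Rightarrow>
    ('o, 'a, 'p, 'b) fctr \<Rightarrow> bool" where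
  "conservative_functor C D F \<longleftrightarrow> cfunctor C D F \<and>
     (\<forall>f \<in> Arr C. is_iso D (amap F f) \<longrightarrow> is_iso C f)"

definition preserves_equalizers :: "('o, 'a, 'y) cat_scheme \<Rightarrow> ('p, 'b, 'z) cat_scheme \<Rightarrow>
    ('o, 'a, 'p, 'b) fctr \<Rightarrow> bool" where
  "preserves_equalizers C D F \<longleftrightarrow>
     (\<forall>f g e. is_equalizer C f g e \<longrightarrow> is_equalizer D (amap F f) (amap F g) (amap F e))"

locale preadditive_category = category C
  for C :: "('o, 'a, 'z) cat_scheme" (structure) +
  fixes add :: "'a \<Rightarrow> 'a \<Rightarrow> 'a"
  assumes Hom_comm_group: "\<lbrakk>X \<in> Obj C; Y \<in> Obj C\<rbrakk>
          \<Longrightarrow> \<exists>z. comm_group \<lparr>carrier = Hom C X Y, monoid.mult = add, one = z\<rparr>"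
    and comp_add_left: "\<lbrakk>f \<in> Hom C X Y; g \<in> Hom C Y Z; g' \<in> Hom C Y Z\<rbrakk>
          \<Longrightarrow> add g g' \<cdot> f = add (g \<cdot> f) (g' \<cdot> f)"
    and comp_add_right: "\<lbrakk>f \<in> Hom C X Y; f' \<in> Hom C X Y; g \<in> Hom C Y Z\<rbrakk>
          \<Longrightarrow> g \<cdot> add f f' = add (g \<cdot> f) (g \<cdot> f')"

definition additive_functor :: "('o, 'a, 'y) cat_scheme \<Rightarrow> ('a \<Rightarrow> 'a \<Rightarrow> 'a) \<Rightarrow>
    ('p, 'b, 'z) cat_scheme \<Rightarrow> ('b \<Rightarrow> 'b \<Rightarrow> 'b) \<Rightarrow> ('o, 'a, 'p, 'b) fctr \<Rightarrow> bool" where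
  "additive_functor C add D add' F \<longleftrightarrow>
     (\<forall>X Y. \<forall>f \<in> Hom C X Y. \<forall>g \<in> Hom C X Y. amap F (add f g) = add' (amap F f) (amap F g))"

record ('o, 'a) moncat = "('o, 'a) cat" +
  tensor_ob :: "'o \<Rightarrow> 'o \<Rightarrow> 'o"  (infixr "\<otimes>\<^sub>o\<index>" 70)
  tensor_ar :: "'a \<Rightarrow> 'a \<Rightarrow> 'a"  (infixr "\<otimes>\<^sub>a\<index>" 70)
  unit_ob :: "'o"  ("\<I>\<index>")
  ass :: "'o \<Rightarrow> 'o \<Rightarrow> 'o \<Rightarrow> 'a"
  lun :: "'o \<Rightarrow> 'a"
  run :: "'o \<Rightarrow> 'a"

record ('o, 'a) bmcat = "('o, 'a) moncat" +
  braid :: "'o \<Rightarrow> 'o \<Rightarrow> 'a"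

text \<open>Objects as identity morphisms inside tensor products.\<close>

abbreviation lwhisker :: "('o, 'a, 'z) moncat_scheme \<Rightarrow> 'o \<Rightarrow> 'a \<Rightarrow> 'a"
    ("(_ \<rhd>\<index> _)" [71, 71] 70) where
  "X \<rhd>\<^bsub>M\<^esub> f \<equiv> ident M X \<otimes>\<^sub>a\<^bsub>M\<^esub> f"

abbreviation rwhisker :: "('o, 'a, 'z) moncat_scheme \<Rightarrow> 'a \<Rightarrow> 'o \<Rightarrow> 'a"
    ("(_ \<lhd>\<index> _)" [71, 71] 70) where
  "f \<lhd>\<^bsub>M\<^esub> X \<equiv> f \<otimes>\<^sub>a\<^bsub>M\<^esub> ident M X"

locale monoidal_category = category M
  for M :: "('o, 'a, 'z) moncat_scheme" (structure) +
  assumes tensor_Obj: "\<lbrakk>X \<in> Obj M; Y \<in> Obj M\<rbrakk> \<Longrightarrow> X \<otimes>\<^sub>o Y \<in> Obj M"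
    and tensor_Hom: "\<lbrakk>f \<in> Hom M X X'; g \<in> Hom M Y Y'\<rbrakk>
          \<Longrightarrow> f \<otimes>\<^sub>a g \<in> Hom M (X \<otimes>\<^sub>o Y) (X' \<otimes>\<^sub>o Y')"
    and tensor_ident: "\<lbrakk>X \<in> Obj M; Y \<in> Obj M\<rbrakk>
          \<Longrightarrow> ident M X \<otimes>\<^sub>a ident M Y = ident M (X \<otimes>\<^sub>o Y)"
    and tensor_comp: "\<lbrakk>f \<in> Hom M X X'; f' \<in> Hom M X' X''; g \<in> Hom M Y Y'; g' \<in> Hom M Y' Y''\<rbrakk>
          \<Longrightarrow> (f' \<cdot> f) \<otimes>\<^sub>a (g' \<cdot> g) = (f' \<otimes>\<^sub>a g') \<cdot> (f \<otimes>\<^sub>a g)"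
    and unit_Obj: "\<I> \<in> Obj M"
    and ass_Hom: "\<lbrakk>X \<in> Obj M; Y \<in> Obj M; Z \<in> Obj M\<rbrakk>
          \<Longrightarrow> ass M X Y Z \<in> Hom M ((X \<otimes>\<^sub>o Y) \<otimes>\<^sub>o Z) (X \<otimes>\<^sub>o (Y \<otimes>\<^sub>o Z))"
    and ass_iso: "\<lbrakk>X \<in> Obj M; Y \<in> Obj M; Z \<in> Obj M\<rbrakk> \<Longrightarrow> is_iso M (ass M X Y Z)"
    and ass_natural: "\<lbrakk>f \<in> Hom M X X'; g \<in> Hom M Y Y'; h \<in> Hom M Z Z'\<rbrakk>
          \<Longrightarrow> ass M X' Y' Z' \<cdot> ((f \<otimes>\<^sub>a g) \<otimes>\<^sub>a h) = (f \<otimes>\<^sub>a (g \<otimes>\<^sub>a h)) \<cdot> ass M X Y Z"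
    and lun_Hom: "X \<in> Obj M \<Longrightarrow> lun M X \<in> Hom M (\<I> \<otimes>\<^sub>o X) X"
    and lun_iso: "X \<in> Obj M \<Longrightarrow> is_iso M (lun M X)"
    and lun_natural: "f \<in> Hom M X Y \<Longrightarrow> lun M Y \<cdot> (\<I> \<rhd> f) = f \<cdot> lun M X"
    and run_Hom: "X \<in> Obj M \<Longrightarrow> run M X \<in> Hom M (X \<otimes>\<^sub>o \<I>) X"
    and run_iso: "X \<in> Obj M \<Longrightarrow> is_iso M (run M X)"
    and run_natural: "f \<in> Hom M X Y \<Longrightarrow> run M Y \<cdot> (f \<lhd> \<I>) = f \<cdot> run M X"
    and pentagon: "\<lbrakk>W \<in> Obj M; X \<in> Obj M; Y \<in> Obj M; Z \<in> Obj M\<rbrakk>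
          \<Longrightarrow> (W \<rhd> ass M X Y Z) \<cdot> ass M W (X \<otimes>\<^sub>o Y) Z \<cdot> (ass M W X Y \<lhd> Z)
            = ass M W X (Y \<otimes>\<^sub>o Z) \<cdot> ass M (W \<otimes>\<^sub>o X) Y Z"
    and triangle: "\<lbrakk>X \<in> Obj M; Y \<in> Obj M\<rbrakk>
          \<Longrightarrow> (X \<rhd> lun M Y) \<cdot> ass M X \<I> Y = run M X \<lhd> Y"

locale braided_monoidal_category = monoidal_category M
  for M :: "('o, 'a, 'z) bmcat_scheme" (structure) +
  assumes braid_Hom: "\<lbrakk>X \<in> Obj M; Y \<in> Obj M\<rbrakk>
          \<Longrightarrow> braid M X Y \<in> Hom M (X \<otimes>\<^sub>o Y) (Y \<otimes>\<^sub>o X)"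
    and braid_iso: "\<lbrakk>X \<in> Obj M; Y \<in> Obj M\<rbrakk> \<Longrightarrow> is_iso M (braid M X Y)"
    and braid_natural: "\<lbrakk>f \<in> Hom M X X'; g \<in> Hom M Y Y'\<rbrakk>
          \<Longrightarrow> braid M X' Y' \<cdot> (f \<otimes>\<^sub>a g) = (g \<otimes>\<^sub>a f) \<cdot> braid M X Y"
    and hexagon1: "\<lbrakk>X \<in> Obj M; Y \<in> Obj M; Z \<in> Obj M\<rbrakk>
          \<Longrightarrow> ass M Y Z X \<cdot> braid M X (Y \<otimes>\<^sub>o Z) \<cdot> ass M X Y Z
            = (Y \<rhd> braid M X Z) \<cdot> ass M Y X Z \<cdot> (braid M X Y \<lhd> Z)"
    and hexagon2: "\<lbrakk>X \<in> Obj M; Y \<in> Obj M; Z \<in> Obj M\<rbrakk>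
          \<Longrightarrow> inv_arr M (ass M Z X Y) \<cdot> braid M (X \<otimes>\<^sub>o Y) Z \<cdot> inv_arr M (ass M X Y Z)
            = (braid M X Z \<lhd> Y) \<cdot> inv_arr M (ass M X Z Y) \<cdot> (X \<rhd> braid M Y Z)"

locale monoidal_functor =
  M: monoidal_category M + M': monoidal_category M' + cfunctor M M' F
  for M :: "('o, 'a, 'y) moncat_scheme" and M' :: "('p, 'b, 'z) moncat_scheme"
    and F :: "('o, 'a, 'p, 'b) fctr" +
  fixes \<phi>0 :: "'b" and \<phi>2 :: "'o \<Rightarrow> 'o \<Rightarrow> 'b"
  assumes phi0_Hom: "\<phi>0 \<in> Hom M' \<I>\<^bsub>M'\<^esub> (omap F \<I>\<^bsub>M\<^esub>)"
    and phi0_iso: "is_iso M' \<phi>0"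
    and phi2_Hom: "\<lbrakk>U \<in> Obj M; V \<in> Obj M\<rbrakk>
          \<Longrightarrow> \<phi>2 U V \<in> Hom M' (omap F U \<otimes>\<^sub>o\<^bsub>M'\<^esub> omap F V) (omap F (U \<otimes>\<^sub>o\<^bsub>M\<^esub> V))"
    and phi2_iso: "\<lbrakk>U \<in> Obj M; V \<in> Obj M\<rbrakk> \<Longrightarrow> is_iso M' (\<phi>2 U V)"
    and phi2_natural: "\<lbrakk>f \<in> Hom M U U'; g \<in> Hom M V V'\<rbrakk>
          \<Longrightarrow> \<phi>2 U' V' \<cdot>\<^bsub>M'\<^esub> (amap F f \<otimes>\<^sub>a\<^bsub>M'\<^esub> amap F g) = amap F (f \<otimes>\<^sub>a\<^bsub>M\<^esub> g) \<cdot>\<^bsub>M'\<^esub> \<phi>2 U V"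
    and phi2_ass: "\<lbrakk>U \<in> Obj M; V \<in> Obj M; W \<in> Obj M\<rbrakk>
          \<Longrightarrow> amap F (ass M U V W) \<cdot>\<^bsub>M'\<^esub> \<phi>2 (U \<otimes>\<^sub>o\<^bsub>M\<^esub> V) W \<cdot>\<^bsub>M'\<^esub> (\<phi>2 U V \<lhd>\<^bsub>M'\<^esub> omap F W)
            = \<phi>2 U (V \<otimes>\<^sub>o\<^bsub>M\<^esub> W) \<cdot>\<^bsub>M'\<^esub> (omap F U \<rhd>\<^bsub>M'\<^esub> \<phi>2 V W)
                \<cdot>\<^bsub>M'\<^esub> ass M' (omap F U) (omap F V) (omap F W)"
    and phi_lun: "U \<in> Obj M
          \<Longrightarrow> amap F (lun M U) \<cdot>\<^bsub>M'\<^esub> \<phi>2 \<I>\<^bsub>M\<^esub> U \<cdot>\<^bsub>M'\<^esub> (\<phi>0 \<lhd>\<^bsub>M'\<^esub> omap F U) = lun M' (omap F U)"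
    and phi_run: "U \<in> Obj M
          \<Longrightarrow> amap F (run M U) \<cdot>\<^bsub>M'\<^esub> \<phi>2 U \<I>\<^bsub>M\<^esub> \<cdot>\<^bsub>M'\<^esub> (omap F U \<rhd>\<^bsub>M'\<^esub> \<phi>0) = run M' (omap F U)"

locale braided_monoidal_functor =
  M: braided_monoidal_category M + M': braided_monoidal_category M' +
  monoidal_functor M M' F \<phi>0 \<phi>2
  for M :: "('o, 'a, 'y) bmcat_scheme" and M' :: "('p, 'b, 'z) bmcat_scheme"
    and F :: "('o, 'a, 'p, 'b) fctr" and \<phi>0 :: "'b" and \<phi>2 :: "'o \<Rightarrow> 'o \<Rightarrow> 'b" +
  assumes phi2_braid: "\<lbrakk>U \<in> Obj M; V \<in> Obj M\<rbrakk>
          \<Longrightarrow> amap F (braid M U V) \<cdot>\<^bsub>M'\<^esub> \<phi>2 U V = \<phi>2 V U \<cdot>\<^bsub>M'\<^esub> braid M' (omap F U) (omap F V)"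

definition left_tensor :: "('o, 'a, 'z) moncat_scheme \<Rightarrow> 'o \<Rightarrow> ('o, 'a, 'o, 'a) fctr" where
  "left_tensor M X = \<lparr>omap = (\<lambda>Y. X \<otimes>\<^sub>o\<^bsub>M\<^esub> Y), amap = (\<lambda>f. X \<rhd>\<^bsub>M\<^esub> f)\<rparr>"

definition right_tensor :: "('o, 'a, 'z) moncat_scheme \<Rightarrow> 'o \<Rightarrow> ('o, 'a, 'o, 'a) fctr" where
  "right_tensor M X = \<lparr>omap = (\<lambda>Y. Y \<otimes>\<^sub>o\<^bsub>M\<^esub> X), amap = (\<lambda>f. f \<lhd>\<^bsub>M\<^esub> X)\<rparr>"

context
  fixes M :: "('o, 'a, 'z) moncat_scheme" (structure)
begin

definition algebra :: "'o \<Rightarrow> 'a \<Rightarrow> 'a \<Rightarrow> bool" where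
  "algebra A m u \<longleftrightarrow> A \<in> Obj M \<and> m \<in> Hom M (A \<otimes>\<^sub>o A) A \<and> u \<in> Hom M \<I> A \<and>
     m \<cdot> (m \<lhd> A) = m \<cdot> (A \<rhd> m) \<cdot> ass M A A A \<and>
     m \<cdot> (u \<lhd> A) = lun M A \<and> m \<cdot> (A \<rhd> u) = run M A"

definition coalgebra :: "'o \<Rightarrow> 'a \<Rightarrow> 'a \<Rightarrow> bool" where
  "coalgebra A d e \<longleftrightarrow> A \<in> Obj M \<and> d \<in> Hom M A (A \<otimes>\<^sub>o A) \<and> e \<in> Hom M A \<I> \<and>
     ass M A A A \<cdot> (d \<lhd> A) \<cdot> d = (A \<rhd> d) \<cdot> d \<and>
     lun M A \<cdot> (e \<lhd> A) \<cdot> d = ident M A \<and> run M A \<cdot> (A \<rhd> e) \<cdot> d = ident M A"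

definition alg_mor :: "'o \<times> 'a \<times> 'a \<Rightarrow> 'a \<Rightarrow> 'o \<times> 'a \<times> 'a \<Rightarrow> bool" where
  "alg_mor = (\<lambda>(A, m, u) f (A', m', u').
     f \<in> Hom M A A' \<and> f \<cdot> m = m' \<cdot> (f \<otimes>\<^sub>a f) \<and> f \<cdot> u = u')"

definition coalg_mor :: "'o \<times> 'a \<times> 'a \<Rightarrow> 'a \<Rightarrow> 'o \<times> 'a \<times> 'a \<Rightarrow> bool" where
  "coalg_mor = (\<lambda>(A, d, e) f (A', d', e').
     f \<in> Hom M A A' \<and> d' \<cdot> f = (f \<otimes>\<^sub>a f) \<cdot> d \<and> e' \<cdot> f = e)"

text \<open>
  \<open>middle B c\<close> is the endomorphism \<open>B \<otimes> c \<otimes> B\<close> of \<open>(B \<otimes> B) \<otimes> (B \<otimes> B)\<close>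
  for \<open>c : B \<otimes> B \<rightarrow> B \<otimes> B\<close>, with associativity constraints made explicit. In the same way
  \<open>braid12 B c\<close> and \<open>braid23 B c\<close> are \<open>c \<otimes> B\<close> and \<open>B \<otimes> c\<close> on \<open>(B \<otimes> B) \<otimes> B\<close>.
\<close>

definition middle :: "'o \<Rightarrow> 'a \<Rightarrow> 'a" where
  "middle B c = inv_arr M (ass M B B (B \<otimes>\<^sub>o B)) \<cdot> (B \<rhd> ass M B B B) \<cdot> (B \<rhd> (c \<lhd> B))
     \<cdot> (B \<rhd> inv_arr M (ass M B B B)) \<cdot> ass M B B (B \<otimes>\<^sub>o B)"

definition braid12 :: "'o \<Rightarrow> 'a \<Rightarrow> 'a" where
  "braid12 B c = c \<lhd> B"

definition braid23 :: "'o \<Rightarrow> 'a \<Rightarrow> 'a" where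
  "braid23 B c = inv_arr M (ass M B B B) \<cdot> (B \<rhd> c) \<cdot> ass M B B B"

definition braided_object :: "'o \<Rightarrow> 'a \<Rightarrow> bool" where
  "braided_object V c \<longleftrightarrow> V \<in> Obj M \<and> c \<in> Hom M (V \<otimes>\<^sub>o V) (V \<otimes>\<^sub>o V) \<and> is_iso M c \<and>
     braid12 V c \<cdot> braid23 V c \<cdot> braid12 V c = braid23 V c \<cdot> braid12 V c \<cdot> braid23 V c"

definition br_mor :: "'o \<times> 'a \<Rightarrow> 'a \<Rightarrow> 'o \<times> 'a \<Rightarrow> bool" where
  "br_mor = (\<lambda>(V, c) f (V', c').
     f \<in> Hom M V V' \<and> c' \<cdot> (f \<otimes>\<^sub>a f) = (f \<otimes>\<^sub>a f) \<cdot> c)"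

definition braided_bialgebra :: "'o \<Rightarrow> 'a \<Rightarrow> 'a \<Rightarrow> 'a \<Rightarrow> 'a \<Rightarrow> 'a \<Rightarrow> bool" where
  "braided_bialgebra B m u d e c \<longleftrightarrow>
     algebra B m u \<and> coalgebra B d e \<and> braided_object B c \<and>
     (let \<alpha> = ass M B B B; \<alpha>' = inv_arr M \<alpha>; l' = inv_arr M (lun M B); r' = inv_arr M (run M B) in
        c \<cdot> (m \<lhd> B) = (B \<rhd> m) \<cdot> \<alpha> \<cdot> (c \<lhd> B) \<cdot> \<alpha>' \<cdot> (B \<rhd> c) \<cdot> \<alpha> \<and>
        c \<cdot> (B \<rhd> m) = (m \<lhd> B) \<cdot> \<alpha>' \<cdot> (B \<rhd> c) \<cdot> \<alpha> \<cdot> (c \<lhd> B) \<cdot> \<alpha>' \<and>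
        c \<cdot> (u \<lhd> B) \<cdot> l' = (B \<rhd> u) \<cdot> r' \<and>
        c \<cdot> (B \<rhd> u) \<cdot> r' = (u \<lhd> B) \<cdot> l' \<and>
        (d \<lhd> B) \<cdot> c = \<alpha>' \<cdot> (B \<rhd> c) \<cdot> \<alpha> \<cdot> (c \<lhd> B) \<cdot> \<alpha>' \<cdot> (B \<rhd> d) \<and>
        (B \<rhd> d) \<cdot> c = \<alpha> \<cdot> (c \<lhd> B) \<cdot> \<alpha>' \<cdot> (B \<rhd> c) \<cdot> \<alpha> \<cdot> (d \<lhd> B)) \<and>
     lun M B \<cdot> (e \<lhd> B) \<cdot> c = run M B \<cdot> (B \<rhd> e) \<and>
     run M B \<cdot> (B \<rhd> e) \<cdot> c = lun M B \<cdot> (e \<lhd> B) \<and>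
     d \<cdot> m = (m \<otimes>\<^sub>a m) \<cdot> middle B c \<cdot> (d \<otimes>\<^sub>a d) \<and>
     d \<cdot> u = (u \<otimes>\<^sub>a u) \<cdot> inv_arr M (lun M \<I>) \<and>
     e \<cdot> m = lun M \<I> \<cdot> (e \<otimes>\<^sub>a e) \<and>
     e \<cdot> u = ident M \<I>"

definition unit_algebra :: "'o \<times> 'a \<times> 'a" where
  "unit_algebra = (\<I>, lun M \<I>, ident M \<I>)"

end

definition tensor_square_algebra ::
    "('o, 'a, 'z) bmcat_scheme \<Rightarrow> 'o \<times> 'a \<times> 'a \<Rightarrow> 'o \<times> 'a \<times> 'a" where
  "tensor_square_algebra M = (\<lambda>(B, m, u).
     (B \<otimes>\<^sub>o\<^bsub>M\<^esub> B,
      (m \<otimes>\<^sub>a\<^bsub>M\<^esub> m) \<cdot>\<^bsub>M\<^esub> middle M B (braid M B B),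
      (u \<otimes>\<^sub>a\<^bsub>M\<^esub> u) \<cdot>\<^bsub>M\<^esub> inv_arr M (lun M \<I>\<^bsub>M\<^esub>)))"

definition bialgebra :: "('o, 'a, 'z) bmcat_scheme \<Rightarrow> 'o \<Rightarrow> 'a \<Rightarrow> 'a \<Rightarrow> 'a \<Rightarrow> 'a \<Rightarrow> bool" where
  "bialgebra M B m u d e \<longleftrightarrow> algebra M B m u \<and> coalgebra M B d e \<and>
     alg_mor M (B, m, u) d (tensor_square_algebra M (B, m, u)) \<and>
     alg_mor M (B, m, u) e (unit_algebra M)"

text \<open>
  Category of structured objects \<open>S\<close> over \<open>C\<close>: the first component of a structured object is
  its underlying object, and \<open>H X f Y\<close> says that \<open>f\<close> is compatible with the structures of
  \<open>X\<close> and \<open>Y\<close>. A morphism carries its source and target.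
\<close>

definition structured_cat :: "('o, 'a, 'z) cat_scheme \<Rightarrow> ('o \<times> 's) set \<Rightarrow>
    ('o \<times> 's \<Rightarrow> 'a \<Rightarrow> 'o \<times> 's \<Rightarrow> bool) \<Rightarrow>
    ('o \<times> 's, ('o \<times> 's) \<times> 'a \<times> ('o \<times> 's)) cat" where
  "structured_cat C S H =
     \<lparr>Obj = S,
      Arr = {(X, f, Y). X \<in> S \<and> Y \<in> S \<and> f \<in> Hom C (fst X) (fst Y) \<and> H X f Y},
      Dom = (\<lambda>(X, f, Y). X),
      Cod = (\<lambda>(X, f, Y). Y),
      ident = (\<lambda>X. (X, ident C (fst X), X)),
      comp = (\<lambda>(Y', g, Z) (X, f, Y). (X, g \<cdot>\<^bsub>C\<^esub> f, Z))\<rparr>"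

type_synonym ('o, 'a) alg = "'o \<times> 'a \<times> 'a"
type_synonym ('o, 'a) bialg = "'o \<times> 'a \<times> 'a \<times> 'a \<times> 'a"
type_synonym ('o, 'a) brobj = "'o \<times> 'a"
type_synonym ('o, 'a) brbialg = "'o \<times> 'a \<times> 'a \<times> 'a \<times> 'a \<times> 'a"
type_synonym ('s, 'a) smor = "'s \<times> 'a \<times> 's"

definition Alg :: "('o, 'a, 'z) moncat_scheme \<Rightarrow>
    (('o, 'a) alg, (('o, 'a) alg, 'a) smor) cat" where
  "Alg M = structured_cat M {(A, m, u). algebra M A m u} (alg_mor M)"

definition Bialg :: "('o, 'a, 'z) bmcat_scheme \<Rightarrow>
    (('o, 'a) bialg, (('o, 'a) bialg, 'a) smor) cat" where
  "Bialg M = structured_cat M {(B, m, u, d, e). bialgebra M B m u d e}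
     (\<lambda>(B, m, u, d, e) f (B', m', u', d', e').
        alg_mor M (B, m, u) f (B', m', u') \<and> coalg_mor M (B, d, e) f (B', d', e'))"

definition Br :: "('o, 'a, 'z) moncat_scheme \<Rightarrow>
    (('o, 'a) brobj, (('o, 'a) brobj, 'a) smor) cat" where
  "Br M = structured_cat M {(V, c). braided_object M V c} (br_mor M)"

definition BrBialg :: "('o, 'a, 'z) moncat_scheme \<Rightarrow>
    (('o, 'a) brbialg, (('o, 'a) brbialg, 'a) smor) cat" where
  "BrBialg M = structured_cat M {(B, m, u, d, e, c). braided_bialgebra M B m u d e c}
     (\<lambda>(B, m, u, d, e, c) f (B', m', u', d', e', c').
        alg_mor M (B, m, u) f (B', m', u') \<and> coalg_mor M (B, d, e) f (B', d', e') \<and>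
        br_mor M (B, c) f (B', c'))"

definition acting :: "('s \<Rightarrow> 't) \<Rightarrow> ('a \<Rightarrow> 'b) \<Rightarrow> ('s, ('s, 'a) smor, 't, ('t, 'b) smor) fctr" where
  "acting T h = \<lparr>omap = T, amap = (\<lambda>(X, f, Y). (T X, h f, T Y))\<rparr>"

definition J :: "('o, 'a, 'z) bmcat_scheme \<Rightarrow>
    ('o, 'a, ('o, 'a) brobj, (('o, 'a) brobj, 'a) smor) fctr" where
  "J M = (let T = (\<lambda>V. (V, braid M V V)) in
     \<lparr>omap = T, amap = (\<lambda>f. (T (Dom M f), f, T (Cod M f)))\<rparr>)"

definition J_Bialg :: "('o, 'a, 'z) bmcat_scheme \<Rightarrow>
    (('o, 'a) bialg, (('o, 'a) bialg, 'a) smor, ('o, 'a) brbialg, (('o, 'a) brbialg, 'a) smor) fctr"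
    where
  "J_Bialg M = acting (\<lambda>(B, m, u, d, e). (B, m, u, d, e, braid M B B)) (\<lambda>f. f)"

definition forget_to_Alg ::
    "(('o, 'a) bialg, (('o, 'a) bialg, 'a) smor, ('o, 'a) alg, (('o, 'a) alg, 'a) smor) fctr" where
  "forget_to_Alg = acting (\<lambda>(B, m, u, d, e). (B, m, u)) (\<lambda>f. f)"

definition forget_Bialg :: "(('o, 'a) bialg, (('o, 'a) bialg, 'a) smor, 'o, 'a) fctr" where
  "forget_Bialg = \<lparr>omap = fst, amap = (\<lambda>(X, f, Y). f)\<rparr>"

context
  fixes M' :: "('p, 'b, 'z) moncat_scheme" (structure)
    and F :: "('o, 'a, 'p, 'b) fctr"
    and \<phi>0 :: "'b"
    and \<phi>2 :: "'o \<Rightarrow> 'o \<Rightarrow> 'b"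
begin

definition mult_F :: "'o \<Rightarrow> 'a \<Rightarrow> 'b" where
  "mult_F B m = amap F m \<cdot> \<phi>2 B B"

definition unit_F :: "'a \<Rightarrow> 'b" where
  "unit_F u = amap F u \<cdot> \<phi>0"

definition comult_F :: "'o \<Rightarrow> 'a \<Rightarrow> 'b" where
  "comult_F B d = inv_arr M' (\<phi>2 B B) \<cdot> amap F d"

definition counit_F :: "'a \<Rightarrow> 'b" where
  "counit_F e = inv_arr M' \<phi>0 \<cdot> amap F e"

definition braiding_F :: "'o \<Rightarrow> 'a \<Rightarrow> 'b" where
  "braiding_F V c = inv_arr M' (\<phi>2 V V) \<cdot> amap F c \<cdot> \<phi>2 V V"

definition AlgF ::
    "(('o, 'a) alg, (('o, 'a) alg, 'a) smor, ('p, 'b) alg, (('p, 'b) alg, 'b) smor) fctr" where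
  "AlgF = acting (\<lambda>(A, m, u). (omap F A, mult_F A m, unit_F u)) (amap F)"

definition BialgF ::
    "(('o, 'a) bialg, (('o, 'a) bialg, 'a) smor, ('p, 'b) bialg, (('p, 'b) bialg, 'b) smor) fctr"
    where
  "BialgF = acting
     (\<lambda>(B, m, u, d, e). (omap F B, mult_F B m, unit_F u, comult_F B d, counit_F e)) (amap F)"

definition BrF ::
    "(('o, 'a) brobj, (('o, 'a) brobj, 'a) smor, ('p, 'b) brobj, (('p, 'b) brobj, 'b) smor) fctr"
    where
  "BrF = acting (\<lambda>(V, c). (omap F V, braiding_F V c)) (amap F)"

definition BrBialgF ::
    "(('o, 'a) brbialg, (('o, 'a) brbialg, 'a) smor,
      ('p, 'b) brbialg, (('p, 'b) brbialg, 'b) smor) fctr" where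
  "BrBialgF = acting
     (\<lambda>(B, m, u, d, e, c).
        (omap F B, mult_F B m, unit_F u, comult_F B d, counit_F e, braiding_F B c)) (amap F)"

end

locale preadditive_with_equalizers =
  braided_monoidal_category M + preadditive_category M add
  for M :: "('o, 'a, 'z) bmcat_scheme" (structure) and add :: "'a \<Rightarrow> 'a \<Rightarrow> 'a" +
  assumes equalizers: "has_equalizers M"
    and left_tensor_additive: "X \<in> Obj M \<Longrightarrow> additive_functor M add M add (left_tensor M X)"
    and right_tensor_additive: "X \<in> Obj M \<Longrightarrow> additive_functor M add M add (right_tensor M X)"
    and left_tensor_equalizers: "X \<in> Obj M \<Longrightarrow> preserves_equalizers M M (left_tensor M X)"
    and right_tensor_equalizers: "X \<in> Obj M \<Longrightarrow> preserves_equalizers M M (right_tensor M X)"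

definition is_primitive_equalizer ::
    "('o, 'a, 'z) moncat_scheme \<Rightarrow> ('a \<Rightarrow> 'a \<Rightarrow> 'a) \<Rightarrow> ('o, 'a) bialg \<Rightarrow> 'a \<Rightarrow> bool" where
  "is_primitive_equalizer M add = (\<lambda>(B, m, u, d, e) x.
     is_equalizer M d
       (add ((B \<rhd>\<^bsub>M\<^esub> u) \<cdot>\<^bsub>M\<^esub> inv_arr M (run M B)) ((u \<lhd>\<^bsub>M\<^esub> B) \<cdot>\<^bsub>M\<^esub> inv_arr M (lun M B))) x)"

definition primitive_choice ::
    "('o, 'a, 'z) bmcat_scheme \<Rightarrow> ('a \<Rightarrow> 'a \<Rightarrow> 'a) \<Rightarrow> (('o, 'a) bialg \<Rightarrow> 'a) \<Rightarrow> bool" where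
  "primitive_choice M add \<xi> \<longleftrightarrow> (\<forall>B \<in> Obj (Bialg M). is_primitive_equalizer M add B (\<xi> B))"

definition prim :: "('o, 'a, 'z) cat_scheme \<Rightarrow> (('o, 'a) bialg \<Rightarrow> 'a) \<Rightarrow>
    (('o, 'a) bialg, (('o, 'a) bialg, 'a) smor, 'o, 'a) fctr" where
  "prim M \<xi> =
     \<lparr>omap = (\<lambda>B. Dom M (\<xi> B)),
      amap = (\<lambda>(B, f, B'). THE g. g \<in> Hom M (Dom M (\<xi> B)) (Dom M (\<xi> B')) \<and>
                \<xi> B' \<cdot>\<^bsub>M\<^esub> g = f \<cdot>\<^bsub>M\<^esub> \<xi> B)\<rparr>"

end

(*
  A frame (X, a) is an isomorphism a from an object X' of M' to F X. Frames are closed under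
  tensor products via phi_2 and contain the unit via phi_0, and an arrow f' of M' covers f in M
  if it corresponds to F f along the frames. The axioms of a braided monoidal functor say exactly
  that the constraints and the braiding of M' cover those of M. Covering is compatible with
  composition and tensor products, so it transports every equation between structure maps: from M
  to M' always, and back if F is faithful. Frames with a = id show that Bialg F is well defined;
  arbitrary frames transport a bialgebra of M' along a and lift it through F at once, which is
  essential surjectivity when F is an equivalence.

  For the primitives, composing with the isomorphism phi_2^{-1} turns the F-image of the pair
  defining P(B) into the pair defining P'(FB), so F xi is again an equalizer of that pair.
*)
theory Submission
  imports Defs
begin

section \<open>Monoidal and braided categories\<close>

text \<open>Three points lie behind the overview. \<open>J_Bialg\<close> takes values in braided
  bialgebras only because the braiding is compatible with the unit constraints. This is not among
  the axioms; it is derived from the hexagons by way of Kelly's consequences of pentagon and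
  triangle, which are therefore proved as well. Conservativity bypasses frames: the inverse of an
  arrow that preserves a bialgebra structure preserves it too, so a bialgebra morphism is invertible
  as soon as its underlying arrow is. For the primitives, an equality of functors need not hold for
  unrelated choices of equalizers, which agree only up to isomorphism. Arbitrary choices give a
  natural isomorphism compatible with \<open>\<xi>\<close> and \<open>\<xi>'\<close>; equality is
  reached when \<open>\<xi>'\<close> is chosen as the F-image of \<open>\<xi>\<close> on the
  bialgebras in the image of Bialg F. Since Bialg F may identify objects, this prescription makes
  sense just when the arrows F \<open>\<xi>\<close> agree on bialgebras with equal image. Additivity
  of F carries the sum in the defining pair to the corresponding sum in M'.\<close>

lemma mem_Hom_iff [simp]: "f \<in> Hom C X Y \<longleftrightarrow> f \<in> Arr C \<and> Dom C f = X \<and> Cod C f = Y"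
  by (simp add: Hom_def)

section \<open>Typing and cancellation rules in a category\<close>

context category
begin

lemma Obj_Dom [simp]: "f \<in> Arr C \<Longrightarrow> Dom C f \<in> Obj C"
  by (fact Dom_Obj)

lemma Obj_Cod [simp]: "f \<in> Arr C \<Longrightarrow> Cod C f \<in> Obj C"
  by (fact Cod_Obj)

lemma ident_typing [simp]:
  "X \<in> Obj C \<Longrightarrow> ident C X \<in> Arr C"
  "X \<in> Obj C \<Longrightarrow> Dom C (ident C X) = X"
  "X \<in> Obj C \<Longrightarrow> Cod C (ident C X) = X"
  using ident_Hom[of X] by simp_all

text \<open>Stated with \<open>Dom\<close> and \<open>Cod\<close> instead of \<open>Hom\<close>: in
  \<open>comp_Hom\<close> the middle object occurs only in the premises, where rewriting could not
  find it.\<close>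

lemma comp_typing [simp]:
  assumes "f \<in> Arr C" "g \<in> Arr C" "Cod C f = Dom C g"
  shows "g \<cdot> f \<in> Arr C" "Dom C (g \<cdot> f) = Dom C f" "Cod C (g \<cdot> f) = Cod C g"
  using comp_Hom[of f "Dom C f" "Dom C g" g "Cod C g"] assms by simp_all

lemma comp_ident_left [simp]: "\<lbrakk>f \<in> Arr C; Cod C f = Y\<rbrakk> \<Longrightarrow> ident C Y \<cdot> f = f"
  using ident_left[of f "Dom C f" Y] by simp

lemma comp_ident_right [simp]: "\<lbrakk>f \<in> Arr C; Dom C f = X\<rbrakk> \<Longrightarrow> f \<cdot> ident C X = f"
  using ident_right[of f X "Cod C f"] by simp

lemma comp_assoc_simp [simp]:
  "\<lbrakk>f \<in> Arr C; g \<in> Arr C; h \<in> Arr C; Cod C f = Dom C g; Cod C g = Dom C h\<rbrakk>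
    \<Longrightarrow> (h \<cdot> g) \<cdot> f = h \<cdot> (g \<cdot> f)"
  using comp_assoc[of f "Dom C f" "Dom C g" g "Dom C h" h "Cod C h"] by simp

lemma inverse_arrows_unique:
  assumes f: "inverse_arrows C f g" and f': "inverse_arrows C f g'"
  shows "g = g'"
  using assms comp_assoc_simp[of g' f g] by (simp add: inverse_arrows_def del: comp_assoc_simp)

lemma inv_arr_eqI: "inverse_arrows C f g \<Longrightarrow> inv_arr C f = g"
  unfolding inv_arr_def using inverse_arrows_unique by blast

lemma inverse_arrows_inv_arr: "is_iso C f \<Longrightarrow> inverse_arrows C f (inv_arr C f)"
  using inv_arr_eqI by (auto simp: is_iso_def)

lemma is_iso_Arr: "is_iso C f \<Longrightarrow> f \<in> Arr C"
  by (auto simp: is_iso_def inverse_arrows_def)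

lemma inv_arr_typing [simp]:
  assumes "is_iso C f"
  shows "inv_arr C f \<in> Arr C" "Dom C (inv_arr C f) = Cod C f" "Cod C (inv_arr C f) = Dom C f"
  using inverse_arrows_inv_arr[OF assms] by (simp_all add: inverse_arrows_def)

lemma inv_arr_comp [simp]: "is_iso C f \<Longrightarrow> inv_arr C f \<cdot> f = ident C (Dom C f)"
  using inverse_arrows_inv_arr by (simp add: inverse_arrows_def)

lemma comp_inv_arr [simp]: "is_iso C f \<Longrightarrow> f \<cdot> inv_arr C f = ident C (Cod C f)"
  using inverse_arrows_inv_arr by (simp add: inverse_arrows_def)

text \<open>Simplification nests composites to the right, so an inverse pair followed by further
  arrows is not a subterm. This version cancels the pair inside such a chain.\<close>

lemma inv_arr_comp_assoc [simp]:
  assumes "is_iso C f" "h \<in> Arr C" "Cod C h = Dom C f"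
  shows "inv_arr C f \<cdot> (f \<cdot> h) = h"
proof -
  have "inv_arr C f \<cdot> (f \<cdot> h) = (inv_arr C f \<cdot> f) \<cdot> h"
    using assms by (subst comp_assoc_simp) (simp_all add: is_iso_Arr)
  then show ?thesis using assms by simp
qed

lemma comp_inv_arr_assoc [simp]:
  assumes "is_iso C f" "h \<in> Arr C" "Cod C h = Cod C f"
  shows "f \<cdot> (inv_arr C f \<cdot> h) = h"
proof -
  have "f \<cdot> (inv_arr C f \<cdot> h) = (f \<cdot> inv_arr C f) \<cdot> h"
    using assms by (subst comp_assoc_simp) (simp_all add: is_iso_Arr)
  then show ?thesis using assms by simp
qed

lemma is_isoI:
  "\<lbrakk>f \<in> Hom C X Y; g \<in> Hom C Y X; g \<cdot> f = ident C X; f \<cdot> g = ident C Y\<rbrakk> \<Longrightarrow> is_iso C f"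
  by (auto simp: is_iso_def inverse_arrows_def)

lemma is_iso_ident [simp]: "X \<in> Obj C \<Longrightarrow> is_iso C (ident C X)"
  by (rule is_isoI[of _ X X "ident C X"]) simp_all

lemma is_iso_inv_arr [simp]: "is_iso C f \<Longrightarrow> is_iso C (inv_arr C f)"
  by (rule is_isoI[of _ "Cod C f" "Dom C f" f]) (simp_all add: is_iso_Arr)

lemma is_iso_comp [simp]:
  assumes "is_iso C f" "is_iso C g" "Cod C f = Dom C g"
  shows "is_iso C (g \<cdot> f)"
  by (rule is_isoI[of _ "Dom C f" "Cod C g" "inv_arr C f \<cdot> inv_arr C g"])
    (use assms in \<open>simp_all add: is_iso_Arr\<close>)

lemma iso_cancel_left:
  assumes "g \<cdot> f = g \<cdot> f'" "is_iso C g" "f \<in> Arr C" "f' \<in> Arr C"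
    "Cod C f = Dom C g" "Cod C f' = Dom C g"
  shows "f = f'"
  using assms inv_arr_comp_assoc by metis

lemma iso_cancel_right:
  assumes eq: "f \<cdot> g = f' \<cdot> g" and g: "is_iso C g" and f: "f \<in> Arr C" "Dom C f = Cod C g"
    and f': "f' \<in> Arr C" "Dom C f' = Cod C g"
  shows "f = f'"
proof -
  have "(f \<cdot> g) \<cdot> inv_arr C g = (f' \<cdot> g) \<cdot> inv_arr C g" by (simp only: eq)
  then show ?thesis using g f f' by (simp add: is_iso_Arr)
qed

end

section \<open>Coherence of the unit constraints with tensor products\<close>

context monoidal_category
begin

lemma tensor_Obj_simp [simp]: "\<lbrakk>X \<in> Obj M; Y \<in> Obj M\<rbrakk> \<Longrightarrow> X \<otimes>\<^sub>o Y \<in> Obj M"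
  by (fact tensor_Obj)

lemma unit_Obj_simp [simp]: "\<I> \<in> Obj M"
  by (fact unit_Obj)

lemma tensor_typing [simp]:
  assumes "f \<in> Arr M" "g \<in> Arr M"
  shows "f \<otimes>\<^sub>a g \<in> Arr M" "Dom M (f \<otimes>\<^sub>a g) = Dom M f \<otimes>\<^sub>o Dom M g"
    "Cod M (f \<otimes>\<^sub>a g) = Cod M f \<otimes>\<^sub>o Cod M g"
  using tensor_Hom[of f "Dom M f" "Cod M f" g "Dom M g" "Cod M g"] assms by simp_all

lemma tensor_ident_simp [simp]:
  "\<lbrakk>X \<in> Obj M; Y \<in> Obj M\<rbrakk> \<Longrightarrow> ident M X \<otimes>\<^sub>a ident M Y = ident M (X \<otimes>\<^sub>o Y)"
  by (fact tensor_ident)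

text \<open>Oriented against \<open>tensor_comp\<close>: rewriting collects composites inside the
  tensor factors, where identities and inverse pairs cancel.\<close>

lemma interchange:
  "\<lbrakk>f \<in> Arr M; f' \<in> Arr M; g \<in> Arr M; g' \<in> Arr M; Cod M f = Dom M f'; Cod M g = Dom M g'\<rbrakk>
    \<Longrightarrow> (f' \<otimes>\<^sub>a g') \<cdot> (f \<otimes>\<^sub>a g) = (f' \<cdot> f) \<otimes>\<^sub>a (g' \<cdot> g)"
  using tensor_comp[of f "Dom M f" "Cod M f" f' "Cod M f'" g "Dom M g" "Cod M g" g' "Cod M g'"]
  by simp

lemma interchange_assoc:
  assumes "f \<in> Arr M" "f' \<in> Arr M" "g \<in> Arr M" "g' \<in> Arr M" "h \<in> Arr M"
    "Cod M f = Dom M f'" "Cod M g = Dom M g'" "Cod M h = Dom M f \<otimes>\<^sub>o Dom M g"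
  shows "(f' \<otimes>\<^sub>a g') \<cdot> ((f \<otimes>\<^sub>a g) \<cdot> h) = ((f' \<cdot> f) \<otimes>\<^sub>a (g' \<cdot> g)) \<cdot> h"
  using assms by (simp flip: interchange)

lemma ass_typing [simp]:
  assumes "X \<in> Obj M" "Y \<in> Obj M" "Z \<in> Obj M"
  shows "ass M X Y Z \<in> Arr M" "Dom M (ass M X Y Z) = (X \<otimes>\<^sub>o Y) \<otimes>\<^sub>o Z"
    "Cod M (ass M X Y Z) = X \<otimes>\<^sub>o (Y \<otimes>\<^sub>o Z)" "is_iso M (ass M X Y Z)"
  using ass_Hom[OF assms] ass_iso[OF assms] by simp_all

lemma lun_typing [simp]:
  assumes "X \<in> Obj M"
  shows "lun M X \<in> Arr M" "Dom M (lun M X) = \<I> \<otimes>\<^sub>o X" "Cod M (lun M X) = X" "is_iso M (lun M X)"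
  using lun_Hom[OF assms] lun_iso[OF assms] by simp_all

lemma run_typing [simp]:
  assumes "X \<in> Obj M"
  shows "run M X \<in> Arr M" "Dom M (run M X) = X \<otimes>\<^sub>o \<I>" "Cod M (run M X) = X" "is_iso M (run M X)"
  using run_Hom[OF assms] run_iso[OF assms] by simp_all

lemma is_iso_tensor [simp]:
  assumes "is_iso M f" "is_iso M g"
  shows "is_iso M (f \<otimes>\<^sub>a g)"
  by (rule is_isoI[of _ "Dom M f \<otimes>\<^sub>o Dom M g" "Cod M f \<otimes>\<^sub>o Cod M g"
        "inv_arr M f \<otimes>\<^sub>a inv_arr M g"])
    (use assms in \<open>simp_all add: is_iso_Arr interchange\<close>)

lemma ass_natural_arr:
  "\<lbrakk>f \<in> Arr M; g \<in> Arr M; h \<in> Arr M\<rbrakk>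
    \<Longrightarrow> ass M (Cod M f) (Cod M g) (Cod M h) \<cdot> ((f \<otimes>\<^sub>a g) \<otimes>\<^sub>a h)
      = (f \<otimes>\<^sub>a (g \<otimes>\<^sub>a h)) \<cdot> ass M (Dom M f) (Dom M g) (Dom M h)"
  by (rule ass_natural) simp_all

lemma lun_natural_arr: "f \<in> Arr M \<Longrightarrow> lun M (Cod M f) \<cdot> (\<I> \<rhd> f) = f \<cdot> lun M (Dom M f)"
  by (rule lun_natural) simp

lemma run_natural_arr: "f \<in> Arr M \<Longrightarrow> run M (Cod M f) \<cdot> (f \<lhd> \<I>) = f \<cdot> run M (Dom M f)"
  by (rule run_natural) simp

text \<open>By naturality of the invertible \<open>lun\<close>, tensoring with the unit is
  isomorphic to the identity functor, hence faithful. Equations between constraints may therefore be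
  proved after whiskering with the unit, where pentagon and triangle become applicable.\<close>

lemma whisker_unit_left_cancel:
  assumes "\<I> \<rhd> f = \<I> \<rhd> g" "f \<in> Hom M X Y" "g \<in> Hom M X Y"
  shows "f = g"
proof (rule iso_cancel_right)
  show "f \<cdot> lun M X = g \<cdot> lun M X"
    using lun_natural_arr[of f] lun_natural_arr[of g] assms by simp
qed (use assms in auto)

lemma whisker_unit_right_cancel:
  assumes "f \<lhd> \<I> = g \<lhd> \<I>" "f \<in> Hom M X Y" "g \<in> Hom M X Y"
  shows "f = g"
proof (rule iso_cancel_right)
  show "f \<cdot> run M X = g \<cdot> run M X"
    using run_natural_arr[of f] run_natural_arr[of g] assms by simp
qed (use assms in auto)

text \<open>Kelly's consequence of the pentagon for \<open>\<I>\<close>, \<open>\<I>\<close>,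
  \<open>X\<close>, \<open>Y\<close>. After whiskering, precomposing with the isomorphism
  \<open>?p\<close> produces one side of that pentagon; the triangle then turns left unit
  constraints into \<open>run M \<I>\<close>, once at \<open>X \<otimes> Y\<close> and once at
  \<open>X\<close>, and naturality of the associator joins the two.\<close>

lemma lun_tensor:
  assumes [simp]: "X \<in> Obj M" "Y \<in> Obj M"
  shows "lun M (X \<otimes>\<^sub>o Y) \<cdot> ass M \<I> X Y = lun M X \<lhd> Y"
proof (rule whisker_unit_left_cancel)
  let ?p = "ass M \<I> (\<I> \<otimes>\<^sub>o X) Y \<cdot> (ass M \<I> \<I> X \<lhd> Y)"
  show "\<I> \<rhd> (lun M (X \<otimes>\<^sub>o Y) \<cdot> ass M \<I> X Y) = \<I> \<rhd> (lun M X \<lhd> Y)"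
  proof (rule iso_cancel_right)
    have "(\<I> \<rhd> (lun M (X \<otimes>\<^sub>o Y) \<cdot> ass M \<I> X Y)) \<cdot> ?p
        = (\<I> \<rhd> lun M (X \<otimes>\<^sub>o Y)) \<cdot> ((\<I> \<rhd> ass M \<I> X Y) \<cdot> ?p)"
      by (simp add: interchange interchange_assoc)
    also have "\<dots> = ((\<I> \<rhd> lun M (X \<otimes>\<^sub>o Y)) \<cdot> ass M \<I> \<I> (X \<otimes>\<^sub>o Y)) \<cdot> ass M (\<I> \<otimes>\<^sub>o \<I>) X Y"
      by (simp add: pentagon)
    also have "\<dots> = (run M \<I> \<otimes>\<^sub>a (X \<rhd> ident M Y)) \<cdot> ass M (\<I> \<otimes>\<^sub>o \<I>) X Y"
      by (simp add: triangle del: comp_assoc_simp)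
    also have "\<dots> = ass M \<I> X Y \<cdot> ((run M \<I> \<lhd> X) \<lhd> Y)"
      using ass_natural_arr[of "run M \<I>" "ident M X" "ident M Y"] by simp
    also have "\<dots> = ass M \<I> X Y \<cdot> (((\<I> \<rhd> lun M X) \<lhd> Y) \<cdot> (ass M \<I> \<I> X \<lhd> Y))"
      by (simp add: interchange triangle)
    also have "\<dots> = (ass M \<I> X Y \<cdot> ((\<I> \<rhd> lun M X) \<lhd> Y)) \<cdot> (ass M \<I> \<I> X \<lhd> Y)"
      by simp
    also have "\<dots> = (\<I> \<rhd> (lun M X \<lhd> Y)) \<cdot> ?p"
      using ass_natural_arr[of "ident M \<I>" "lun M X" "ident M Y"] by simp
    finally show "(\<I> \<rhd> (lun M (X \<otimes>\<^sub>o Y) \<cdot> ass M \<I> X Y)) \<cdot> ?p = (\<I> \<rhd> (lun M X \<lhd> Y)) \<cdot> ?p" .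
  qed simp_all
qed simp_all

text \<open>The mirror image of \<open>lun_tensor\<close>, from the pentagon for \<open>X\<close>,
  \<open>Y\<close>, \<open>\<I>\<close>, \<open>\<I>\<close>. Here an associator is put in front and
  cancelled on the left at the end.\<close>

lemma run_tensor:
  assumes [simp]: "X \<in> Obj M" "Y \<in> Obj M"
  shows "(X \<rhd> run M Y) \<cdot> ass M X Y \<I> = run M (X \<otimes>\<^sub>o Y)"
proof (rule whisker_unit_right_cancel)
  show "((X \<rhd> run M Y) \<cdot> ass M X Y \<I>) \<lhd> \<I> = run M (X \<otimes>\<^sub>o Y) \<lhd> \<I>"
  proof (rule iso_cancel_left)
    have "ass M X Y \<I> \<cdot> (((X \<rhd> run M Y) \<cdot> ass M X Y \<I>) \<lhd> \<I>)
        = (ass M X Y \<I> \<cdot> ((X \<rhd> run M Y) \<lhd> \<I>)) \<cdot> (ass M X Y \<I> \<lhd> \<I>)"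
      by (simp add: interchange)
    also have "\<dots> = (X \<rhd> (run M Y \<lhd> \<I>)) \<cdot> (ass M X (Y \<otimes>\<^sub>o \<I>) \<I> \<cdot> (ass M X Y \<I> \<lhd> \<I>))"
      using ass_natural_arr[of "ident M X" "run M Y" "ident M \<I>"] by simp
    also have "\<dots> = (X \<rhd> (Y \<rhd> lun M \<I>)) \<cdot>
        ((X \<rhd> ass M Y \<I> \<I>) \<cdot> ass M X (Y \<otimes>\<^sub>o \<I>) \<I> \<cdot> (ass M X Y \<I> \<lhd> \<I>))"
      by (simp add: interchange interchange_assoc triangle)
    also have "\<dots> = ((X \<rhd> (Y \<rhd> lun M \<I>)) \<cdot> ass M X Y (\<I> \<otimes>\<^sub>o \<I>)) \<cdot> ass M (X \<otimes>\<^sub>o Y) \<I> \<I>"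
      by (simp add: pentagon)
    also have "\<dots> = ass M X Y \<I> \<cdot> ((X \<otimes>\<^sub>o Y) \<rhd> lun M \<I>) \<cdot> ass M (X \<otimes>\<^sub>o Y) \<I> \<I>"
      using ass_natural_arr[of "ident M X" "ident M Y" "lun M \<I>"]
      by (simp flip: comp_assoc_simp)
    also have "\<dots> = ass M X Y \<I> \<cdot> (run M (X \<otimes>\<^sub>o Y) \<lhd> \<I>)"
      by (simp add: triangle)
    finally show "ass M X Y \<I> \<cdot> (((X \<rhd> run M Y) \<cdot> ass M X Y \<I>) \<lhd> \<I>)
        = ass M X Y \<I> \<cdot> (run M (X \<otimes>\<^sub>o Y) \<lhd> \<I>)" .
  qed simp_all
qed simp_all

end

section \<open>The braiding: units, Yang-Baxter equation, braided bialgebras\<close>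

context braided_monoidal_category
begin

lemma braid_typing [simp]:
  assumes "X \<in> Obj M" "Y \<in> Obj M"
  shows "braid M X Y \<in> Arr M" "Dom M (braid M X Y) = X \<otimes>\<^sub>o Y" "Cod M (braid M X Y) = Y \<otimes>\<^sub>o X"
    "is_iso M (braid M X Y)"
  using braid_Hom[OF assms] braid_iso[OF assms] by simp_all

lemma braid_natural_arr:
  "\<lbrakk>f \<in> Arr M; g \<in> Arr M\<rbrakk>
    \<Longrightarrow> braid M (Cod M f) (Cod M g) \<cdot> (f \<otimes>\<^sub>a g) = (g \<otimes>\<^sub>a f) \<cdot> braid M (Dom M f) (Dom M g)"
  by (rule braid_natural) simp_all

lemma braid_natural_assoc:
  assumes "f \<in> Arr M" "g \<in> Arr M" "h \<in> Arr M" "Cod M h = Dom M f \<otimes>\<^sub>o Dom M g"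
  shows "braid M (Cod M f) (Cod M g) \<cdot> ((f \<otimes>\<^sub>a g) \<cdot> h)
    = (g \<otimes>\<^sub>a f) \<cdot> (braid M (Dom M f) (Dom M g) \<cdot> h)"
  using assms braid_natural_arr[of f g] by (simp flip: comp_assoc_simp)

text \<open>The hexagon solved for the braiding with a tensor product. For three equal objects the
  right hand side is the expression that occurs in the axioms of a braided bialgebra.\<close>

lemma braid_tensor_right:
  assumes [simp]: "X \<in> Obj M" "Y \<in> Obj M" "Z \<in> Obj M"
  shows "braid M X (Y \<otimes>\<^sub>o Z) = inv_arr M (ass M Y Z X) \<cdot> (Y \<rhd> braid M X Z) \<cdot> ass M Y X Z
    \<cdot> (braid M X Y \<lhd> Z) \<cdot> inv_arr M (ass M X Y Z)"
proof -
  have "inv_arr M (ass M Y Z X) \<cdot>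
      (ass M Y Z X \<cdot> braid M X (Y \<otimes>\<^sub>o Z) \<cdot> ass M X Y Z) \<cdot> inv_arr M (ass M X Y Z)
      = inv_arr M (ass M Y Z X) \<cdot>
      ((Y \<rhd> braid M X Z) \<cdot> ass M Y X Z \<cdot> (braid M X Y \<lhd> Z)) \<cdot> inv_arr M (ass M X Y Z)"
    by (simp only: hexagon1 assms)
  then show ?thesis by simp
qed

lemma braid_tensor_left:
  assumes [simp]: "X \<in> Obj M" "Y \<in> Obj M" "Z \<in> Obj M"
  shows "braid M (X \<otimes>\<^sub>o Y) Z = ass M Z X Y \<cdot> (braid M X Z \<lhd> Y) \<cdot> inv_arr M (ass M X Z Y)
    \<cdot> (X \<rhd> braid M Y Z) \<cdot> ass M X Y Z"
proof -
  have "ass M Z X Y \<cdot>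
      (inv_arr M (ass M Z X Y) \<cdot> braid M (X \<otimes>\<^sub>o Y) Z \<cdot> inv_arr M (ass M X Y Z)) \<cdot> ass M X Y Z
      = ass M Z X Y \<cdot>
      ((braid M X Z \<lhd> Y) \<cdot> inv_arr M (ass M X Z Y) \<cdot> (X \<rhd> braid M Y Z)) \<cdot> ass M X Y Z"
    by (simp only: hexagon2 assms)
  then show ?thesis by simp
qed

text \<open>Comes from \<open>hexagon1\<close> at \<open>X\<close>, \<open>\<I>\<close>,
  \<open>\<I>\<close>: naturality of the braiding in \<open>lun M \<I>\<close> removes the braiding
  with \<open>\<I> \<otimes> \<I>\<close>, and \<open>lun_tensor\<close> and the triangle absorb the
  associators.\<close>

lemma lun_braid:
  assumes X [simp]: "X \<in> Obj M"
  shows "lun M X \<cdot> braid M X \<I> = run M X"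
proof (rule whisker_unit_right_cancel)
  show "(lun M X \<cdot> braid M X \<I>) \<lhd> \<I> = run M X \<lhd> \<I>"
  proof (rule iso_cancel_left)
    have "braid M X \<I> \<cdot> ((lun M X \<cdot> braid M X \<I>) \<lhd> \<I>)
        = braid M X \<I> \<cdot> (lun M X \<lhd> \<I>) \<cdot> (braid M X \<I> \<lhd> \<I>)"
      by (simp add: interchange)
    also have "\<dots> = braid M X \<I> \<cdot> lun M (X \<otimes>\<^sub>o \<I>) \<cdot> ass M \<I> X \<I> \<cdot> (braid M X \<I> \<lhd> \<I>)"
      by (simp flip: lun_tensor)
    \<comment> \<open>The braiding placed in front is moved past \<open>lun\<close> by naturality;
      it becomes the factor that completes the right hand side of the hexagon.\<close>
    also have "\<dots> = lun M (\<I> \<otimes>\<^sub>o X) \<cdot> (\<I> \<rhd> braid M X \<I>) \<cdot> ass M \<I> X \<I> \<cdot> (braid M X \<I> \<lhd> \<I>)"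
      using lun_natural_arr[of "braid M X \<I>"] by (simp flip: comp_assoc_simp)
    also have "\<dots> = lun M (\<I> \<otimes>\<^sub>o X) \<cdot> ass M \<I> \<I> X \<cdot> braid M X (\<I> \<otimes>\<^sub>o \<I>) \<cdot> ass M X \<I> \<I>"
      by (simp add: hexagon1)
    also have "\<dots> = (lun M \<I> \<lhd> X) \<cdot> braid M X (\<I> \<otimes>\<^sub>o \<I>) \<cdot> ass M X \<I> \<I>"
      by (simp flip: lun_tensor)
    also have "\<dots> = (braid M X \<I> \<cdot> (X \<rhd> lun M \<I>)) \<cdot> ass M X \<I> \<I>"
      using braid_natural_arr[of "ident M X" "lun M \<I>"] by simp
    also have "\<dots> = braid M X \<I> \<cdot> (run M X \<lhd> \<I>)"
      by (simp add: triangle)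
    finally show "braid M X \<I> \<cdot> ((lun M X \<cdot> braid M X \<I>) \<lhd> \<I>) = braid M X \<I> \<cdot> (run M X \<lhd> \<I>)" .
  qed simp_all
qed simp_all

text \<open>The same argument with \<open>hexagon2\<close> at \<open>\<I>\<close>,
  \<open>\<I>\<close>, \<open>X\<close> and with \<open>run_tensor\<close>. It is proved separately
  since the braiding need not be symmetric, so it is not obtained by inverting
  \<open>lun_braid\<close>.\<close>

lemma run_braid:
  assumes X [simp]: "X \<in> Obj M"
  shows "run M X \<cdot> braid M \<I> X = lun M X"
proof (rule whisker_unit_left_cancel)
  show "\<I> \<rhd> (run M X \<cdot> braid M \<I> X) = \<I> \<rhd> lun M X"
  proof (rule iso_cancel_left)
    have "braid M \<I> X \<cdot> (\<I> \<rhd> (run M X \<cdot> braid M \<I> X))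
        = (braid M \<I> X \<cdot> (\<I> \<rhd> run M X)) \<cdot> (\<I> \<rhd> braid M \<I> X)"
      by (simp add: interchange)
    also have "\<dots> = (braid M \<I> X \<cdot> (run M (\<I> \<otimes>\<^sub>o X) \<cdot> inv_arr M (ass M \<I> X \<I>))) \<cdot> (\<I> \<rhd> braid M \<I> X)"
      by (simp flip: run_tensor)
    also have "\<dots> = run M (X \<otimes>\<^sub>o \<I>) \<cdot>
        ((braid M \<I> X \<lhd> \<I>) \<cdot> inv_arr M (ass M \<I> X \<I>) \<cdot> (\<I> \<rhd> braid M \<I> X))"
      using run_natural_arr[of "braid M \<I> X"] by (simp flip: comp_assoc_simp)
    also have "\<dots> = run M (X \<otimes>\<^sub>o \<I>) \<cdot> inv_arr M (ass M X \<I> \<I>) \<cdot> braid M (\<I> \<otimes>\<^sub>o \<I>) X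
        \<cdot> inv_arr M (ass M \<I> \<I> X)"
      by (simp flip: hexagon2)
    also have "\<dots> = ((X \<rhd> run M \<I>) \<cdot> braid M (\<I> \<otimes>\<^sub>o \<I>) X) \<cdot> inv_arr M (ass M \<I> \<I> X)"
      by (simp flip: run_tensor)
    also have "\<dots> = braid M \<I> X \<cdot> (run M \<I> \<lhd> X) \<cdot> inv_arr M (ass M \<I> \<I> X)"
      using braid_natural_assoc[of "run M \<I>" "ident M X" "inv_arr M (ass M \<I> \<I> X)"] by simp
    also have "\<dots> = braid M \<I> X \<cdot> (\<I> \<rhd> lun M X)"
      by (simp flip: triangle)
    finally show "braid M \<I> X \<cdot> (\<I> \<rhd> (run M X \<cdot> braid M \<I> X)) = braid M \<I> X \<cdot> (\<I> \<rhd> lun M X)" .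
  qed simp_all
qed simp_all

text \<open>The Yang-Baxter equation is naturality of the braiding of V with
  \<open>V \<otimes> V\<close>, applied to the arrow \<open>braid M V V\<close> in the second
  argument; the hexagon supplies the remaining factors on both sides.\<close>

lemma braided_object_braid:
  assumes [simp]: "V \<in> Obj M"
  shows "braided_object M V (braid M V V)"
proof -
  let ?c = "braid M V V" and ?c2 = "braid M V (V \<otimes>\<^sub>o V)"
  have c2: "?c2 = braid23 M V ?c \<cdot> braid12 M V ?c \<cdot> inv_arr M (ass M V V V)"
    by (simp add: braid_tensor_right braid12_def braid23_def)
  have "braid12 M V ?c \<cdot> braid23 M V ?c \<cdot> braid12 M V ?c = ((?c \<lhd> V) \<cdot> ?c2) \<cdot> ass M V V V"
    by (simp add: c2 braid12_def braid23_def)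
  also have "\<dots> = ?c2 \<cdot> (V \<rhd> ?c) \<cdot> ass M V V V"
    using braid_natural_assoc[of "ident M V" ?c "ass M V V V"] by simp
  also have "\<dots> = braid23 M V ?c \<cdot> braid12 M V ?c \<cdot> braid23 M V ?c"
    by (simp add: c2 braid12_def braid23_def)
  finally show ?thesis by (simp add: braided_object_def)
qed

lemma br_mor_braid:
  "f \<in> Hom M V W \<Longrightarrow> br_mor M (V, braid M V V) f (W, braid M W W)"
  using braid_natural_arr[of f f] by (auto simp: br_mor_def)

text \<open>Every axiom that relates c to one structure map is naturality of the braiding in that
  map. For u and e the braiding with the unit object is then removed by \<open>lun_braid\<close> and
  \<open>run_braid\<close>; for m and d the braiding with \<open>B \<otimes> B\<close> is expanded
  by the hexagons.\<close>

lemma braided_bialgebra_braid: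
  assumes "bialgebra M B m u d e"
  shows "braided_bialgebra M B m u d e (braid M B B)"
proof -
  have alg: "algebra M B m u" and coalg: "coalgebra M B d e"
    and comp: "d \<cdot> m = (m \<otimes>\<^sub>a m) \<cdot> middle M B (braid M B B) \<cdot> (d \<otimes>\<^sub>a d)"
      "d \<cdot> u = (u \<otimes>\<^sub>a u) \<cdot> inv_arr M (lun M \<I>)"
      "e \<cdot> m = lun M \<I> \<cdot> (e \<otimes>\<^sub>a e)" "e \<cdot> u = ident M \<I>"
    using assms
    by (auto simp: bialgebra_def alg_mor_def tensor_square_algebra_def unit_algebra_def
        algebra_def coalgebra_def middle_def)
  have [simp]: "B \<in> Obj M" "m \<in> Arr M" "Dom M m = B \<otimes>\<^sub>o B" "Cod M m = B"
      "u \<in> Arr M" "Dom M u = \<I>" "Cod M u = B"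
      "d \<in> Arr M" "Dom M d = B" "Cod M d = B \<otimes>\<^sub>o B" "e \<in> Arr M" "Dom M e = B" "Cod M e = \<I>"
    using alg coalg by (auto simp: algebra_def coalgebra_def)
  have unit: "braid M \<I> B \<cdot> inv_arr M (lun M B) = inv_arr M (run M B)"
  proof (rule iso_cancel_left)
    show "run M B \<cdot> braid M \<I> B \<cdot> inv_arr M (lun M B) = run M B \<cdot> inv_arr M (run M B)"
      using run_braid[of B] by (simp flip: comp_assoc_simp)
  qed simp_all
  have unit': "braid M B \<I> \<cdot> inv_arr M (run M B) = inv_arr M (lun M B)"
  proof (rule iso_cancel_left)
    show "lun M B \<cdot> braid M B \<I> \<cdot> inv_arr M (run M B) = lun M B \<cdot> inv_arr M (lun M B)"
      using lun_braid[of B] by (simp flip: comp_assoc_simp)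
  qed simp_all
  let ?c = "braid M B B"
  have "?c \<cdot> (u \<lhd> B) \<cdot> inv_arr M (lun M B) = (B \<rhd> u) \<cdot> inv_arr M (run M B)"
    using braid_natural_arr[of u "ident M B"] by (simp add: unit flip: comp_assoc_simp) (simp add: unit)
  moreover have "?c \<cdot> (B \<rhd> u) \<cdot> inv_arr M (run M B) = (u \<lhd> B) \<cdot> inv_arr M (lun M B)"
    using braid_natural_arr[of "ident M B" u] by (simp flip: comp_assoc_simp) (simp add: unit')
  moreover have "lun M B \<cdot> (e \<lhd> B) \<cdot> ?c = run M B \<cdot> (B \<rhd> e)"
    using braid_natural_arr[of "ident M B" e] by (simp flip: lun_braid)
  moreover have "run M B \<cdot> (B \<rhd> e) \<cdot> ?c = lun M B \<cdot> (e \<lhd> B)"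
    using braid_natural_arr[of e "ident M B"] by (simp flip: run_braid)
  moreover have "?c \<cdot> (m \<lhd> B) = (B \<rhd> m) \<cdot> braid M (B \<otimes>\<^sub>o B) B"
    "?c \<cdot> (B \<rhd> m) = (m \<lhd> B) \<cdot> braid M B (B \<otimes>\<^sub>o B)"
    "(d \<lhd> B) \<cdot> ?c = braid M B (B \<otimes>\<^sub>o B) \<cdot> (B \<rhd> d)"
    "(B \<rhd> d) \<cdot> ?c = braid M (B \<otimes>\<^sub>o B) B \<cdot> (d \<lhd> B)"
    using braid_natural_arr[of m "ident M B"] braid_natural_arr[of "ident M B" m]
      braid_natural_arr[of "ident M B" d] braid_natural_arr[of d "ident M B"] by simp_all
  ultimately show ?thesis
    using alg coalg comp
    by (simp add: braided_bialgebra_def Let_def braided_object_braid braid_tensor_left braid_tensor_right)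
qed

end

section \<open>Coverings along a monoidal functor\<close>

definition faithful_functor ::
    "('o, 'a, 'y) cat_scheme \<Rightarrow> ('o, 'a, 'p, 'b) fctr \<Rightarrow> bool" where
  "faithful_functor C F \<longleftrightarrow> (\<forall>f \<in> Arr C. \<forall>g \<in> Arr C.
     Dom C f = Dom C g \<and> Cod C f = Cod C g \<and> amap F f = amap F g \<longrightarrow> f = g)"

definition full_functor :: "('o, 'a, 'y) cat_scheme \<Rightarrow> ('p, 'b, 'z) cat_scheme \<Rightarrow>
    ('o, 'a, 'p, 'b) fctr \<Rightarrow> bool" where
  "full_functor C D F \<longleftrightarrow> (\<forall>X \<in> Obj C. \<forall>Y \<in> Obj C.
     Hom D (omap F X) (omap F Y) \<subseteq> amap F ` Hom C X Y)"

text \<open>The isomorphism points from Y to F X, so that together with X it forms a frame over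
  Y.\<close>

definition essentially_surjective :: "('o, 'a, 'y) cat_scheme \<Rightarrow> ('p, 'b, 'z) cat_scheme \<Rightarrow>
    ('o, 'a, 'p, 'b) fctr \<Rightarrow> bool" where
  "essentially_surjective C D F \<longleftrightarrow> (\<forall>Y \<in> Obj D. \<exists>X \<in> Obj C. \<exists>a \<in> Hom D Y (omap F X). is_iso D a)"

context cfunctor
begin

lemma omap_Obj_simp [simp]: "X \<in> Obj C \<Longrightarrow> omap F X \<in> Obj D"
  by (fact omap_Obj)

lemma amap_typing [simp]:
  assumes "f \<in> Arr C"
  shows "amap F f \<in> Arr D" "Dom D (amap F f) = omap F (Dom C f)"
    "Cod D (amap F f) = omap F (Cod C f)"
  using amap_Hom[of f "Dom C f" "Cod C f"] assms by simp_all

lemma amap_ident_simp [simp]: "X \<in> Obj C \<Longrightarrow> amap F (ident C X) = ident D (omap F X)"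
  by (fact amap_ident)

lemma amap_comp_simp [simp]:
  "\<lbrakk>f \<in> Arr C; g \<in> Arr C; Cod C f = Dom C g\<rbrakk> \<Longrightarrow> amap F (g \<cdot>\<^bsub>C\<^esub> f) = amap F g \<cdot>\<^bsub>D\<^esub> amap F f"
  by (rule amap_comp) simp_all

lemma amap_inverse_arrows:
  "inverse_arrows C f g \<Longrightarrow> inverse_arrows D (amap F f) (amap F g)"
  by (simp add: inverse_arrows_def flip: amap_comp_simp)

lemma is_iso_amap [simp]: "is_iso C f \<Longrightarrow> is_iso D (amap F f)"
  using amap_inverse_arrows unfolding is_iso_def by blast

lemma amap_inv_arr: "is_iso C f \<Longrightarrow> amap F (inv_arr C f) = inv_arr D (amap F f)"
  using D.inv_arr_eqI[OF amap_inverse_arrows[OF C.inverse_arrows_inv_arr]] by simp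

end

section \<open>The calculus of frames and coverings\<close>

context monoidal_functor
begin

lemma phi0_typing [simp]:
  "\<phi>0 \<in> Arr M'" "Dom M' \<phi>0 = \<I>\<^bsub>M'\<^esub>" "Cod M' \<phi>0 = omap F \<I>\<^bsub>M\<^esub>" "is_iso M' \<phi>0"
  using phi0_Hom phi0_iso by simp_all

lemma phi2_typing [simp]:
  assumes "U \<in> Obj M" "V \<in> Obj M"
  shows "\<phi>2 U V \<in> Arr M'" "Dom M' (\<phi>2 U V) = omap F U \<otimes>\<^sub>o\<^bsub>M'\<^esub> omap F V"
    "Cod M' (\<phi>2 U V) = omap F (U \<otimes>\<^sub>o\<^bsub>M\<^esub> V)" "is_iso M' (\<phi>2 U V)"
  using phi2_Hom[OF assms] phi2_iso[OF assms] by simp_all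

lemma phi2_natural_assoc:
  assumes "f \<in> Arr M" "g \<in> Arr M" "h \<in> Arr M'"
    "Cod M' h = omap F (Dom M f) \<otimes>\<^sub>o\<^bsub>M'\<^esub> omap F (Dom M g)"
  shows "\<phi>2 (Cod M f) (Cod M g) \<cdot>\<^bsub>M'\<^esub> ((amap F f \<otimes>\<^sub>a\<^bsub>M'\<^esub> amap F g) \<cdot>\<^bsub>M'\<^esub> h)
    = amap F (f \<otimes>\<^sub>a\<^bsub>M\<^esub> g) \<cdot>\<^bsub>M'\<^esub> (\<phi>2 (Dom M f) (Dom M g) \<cdot>\<^bsub>M'\<^esub> h)"
  using assms phi2_natural[of f "Dom M f" "Cod M f" g "Dom M g" "Cod M g"]
  by (simp flip: M'.comp_assoc_simp)

text \<open>
  A frame \<open>(X, a)\<close> over \<open>X'\<close> has \<open>a : X' \<rightarrow> F X\<close>; it records \<open>X\<close> because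
  \<open>F\<close> need not be injective on objects.
\<close>

definition over :: "'o \<times> 'b \<Rightarrow> 'p \<Rightarrow> 'o \<Rightarrow> bool" where
  "over p X' X \<longleftrightarrow> fst p = X \<and> X \<in> Obj M \<and> snd p \<in> Hom M' X' (omap F X) \<and> is_iso M' (snd p)"

definition covers :: "'o \<times> 'b \<Rightarrow> 'b \<Rightarrow> 'o \<times> 'b \<Rightarrow> 'a \<Rightarrow> bool" where
  "covers p f' q f \<longleftrightarrow> f' \<in> Arr M' \<and> f \<in> Arr M \<and>
     over p (Dom M' f') (Dom M f) \<and> over q (Cod M' f') (Cod M f) \<and>
     snd q \<cdot>\<^bsub>M'\<^esub> f' = amap F f \<cdot>\<^bsub>M'\<^esub> snd p"

definition fuse :: "'o \<times> 'b \<Rightarrow> 'o \<times> 'b \<Rightarrow> 'o \<times> 'b"  (infixr "\<boxtimes>" 70) where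
  "p \<boxtimes> q = (fst p \<otimes>\<^sub>o\<^bsub>M\<^esub> fst q, \<phi>2 (fst p) (fst q) \<cdot>\<^bsub>M'\<^esub> (snd p \<otimes>\<^sub>a\<^bsub>M'\<^esub> snd q))"

definition unit_frame :: "'o \<times> 'b" where
  "unit_frame = (\<I>\<^bsub>M\<^esub>, \<phi>0)"

definition image_frame :: "'o \<Rightarrow> 'o \<times> 'b" where
  "image_frame X = (X, ident M' (omap F X))"

lemma snd_image_frame_fuse:
  "\<lbrakk>X \<in> Obj M; Y \<in> Obj M\<rbrakk> \<Longrightarrow> snd (image_frame X \<boxtimes> image_frame Y) = \<phi>2 X Y"
  by (simp add: image_frame_def fuse_def)

lemma over_fuse: "\<lbrakk>over p X' X; over q Y' Y\<rbrakk> \<Longrightarrow> over (p \<boxtimes> q) (X' \<otimes>\<^sub>o\<^bsub>M'\<^esub> Y') (X \<otimes>\<^sub>o\<^bsub>M\<^esub> Y)"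
  by (auto simp: over_def fuse_def)

lemma over_unit: "over unit_frame \<I>\<^bsub>M'\<^esub> \<I>\<^bsub>M\<^esub>"
  by (simp add: over_def unit_frame_def)

lemma over_image: "X \<in> Obj M \<Longrightarrow> over (image_frame X) (omap F X) X"
  by (simp add: over_def image_frame_def)

lemma over_Obj: "over p X' X \<Longrightarrow> X \<in> Obj M" "over p X' X \<Longrightarrow> X' \<in> Obj M'"
  by (auto simp: over_def)

lemma covers_typing:
  assumes "covers p f' q f" "over p X' X" "over q Y' Y"
  shows "f' \<in> Hom M' X' Y'" "f \<in> Hom M X Y"
  using assms by (auto simp: covers_def over_def)

lemma coversI:
  assumes "over p X' X" "over q Y' Y" "f' \<in> Hom M' X' Y'" "f \<in> Hom M X Y"
    "snd q \<cdot>\<^bsub>M'\<^esub> f' = amap F f \<cdot>\<^bsub>M'\<^esub> snd p"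
  shows "covers p f' q f"
  using assms by (auto simp: covers_def)

lemma covers_ident: "over p X' X \<Longrightarrow> covers p (ident M' X') p (ident M X)"
  by (rule coversI) (auto simp: over_def)

lemma covers_comp:
  assumes f: "covers p f' q f" and g: "covers q g' r g"
  shows "covers p (g' \<cdot>\<^bsub>M'\<^esub> f') r (g \<cdot>\<^bsub>M\<^esub> f)"
proof -
  have [simp]: "f' \<in> Arr M'" "f \<in> Arr M" "g' \<in> Arr M'" "g \<in> Arr M"
      "Cod M f = Dom M g" "Cod M' f' = Dom M' g'"
    and o: "over p (Dom M' f') (Dom M f)" "over q (Cod M' f') (Cod M f)"
      "over r (Cod M' g') (Cod M g)"
    and eq: "snd q \<cdot>\<^bsub>M'\<^esub> f' = amap F f \<cdot>\<^bsub>M'\<^esub> snd p" "snd r \<cdot>\<^bsub>M'\<^esub> g' = amap F g \<cdot>\<^bsub>M'\<^esub> snd q"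
    using f g by (auto simp: covers_def over_def)
  have [simp]: "snd p \<in> Arr M'" "Cod M' (snd p) = omap F (Dom M f)" "snd q \<in> Arr M'"
    "Dom M' (snd q) = Dom M' g'" "Cod M' (snd q) = omap F (Dom M g)"
    "snd r \<in> Arr M'" "Dom M' (snd r) = Cod M' g'"
    using o by (auto simp: over_def)
  have "snd r \<cdot>\<^bsub>M'\<^esub> (g' \<cdot>\<^bsub>M'\<^esub> f') = (snd r \<cdot>\<^bsub>M'\<^esub> g') \<cdot>\<^bsub>M'\<^esub> f'"
    by simp
  also have "\<dots> = amap F g \<cdot>\<^bsub>M'\<^esub> (snd q \<cdot>\<^bsub>M'\<^esub> f')"
    by (simp only: eq(2)) simp
  also have "\<dots> = amap F (g \<cdot>\<^bsub>M\<^esub> f) \<cdot>\<^bsub>M'\<^esub> snd p"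
    by (simp add: eq(1))
  finally show ?thesis using o by (simp add: covers_def)
qed

text \<open>Extends the calculus to inverse constraints, which occur in \<open>middle\<close>, in
  the unit of the tensor square and in the pair that defines the primitives.\<close>

lemma covers_inv_arr:
  assumes f: "covers p f' q f" and iso: "is_iso M f" "is_iso M' f'"
  shows "covers q (inv_arr M' f') p (inv_arr M f)"
proof -
  have [simp]: "f' \<in> Arr M'" "f \<in> Arr M" "is_iso M f" "is_iso M' f'"
    and o: "over p (Dom M' f') (Dom M f)" "over q (Cod M' f') (Cod M f)"
    and eq: "snd q \<cdot>\<^bsub>M'\<^esub> f' = amap F f \<cdot>\<^bsub>M'\<^esub> snd p"
    using f iso by (auto simp: covers_def over_def)
  have [simp]: "snd p \<in> Arr M'" "Dom M' (snd p) = Dom M' f'" "Cod M' (snd p) = omap F (Dom M f)"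
    "snd q \<in> Arr M'" "Dom M' (snd q) = Cod M' f'" "Cod M' (snd q) = omap F (Cod M f)"
    using o by (auto simp: over_def)
  have "snd p \<cdot>\<^bsub>M'\<^esub> inv_arr M' f'
      = inv_arr M' (amap F f) \<cdot>\<^bsub>M'\<^esub> (amap F f \<cdot>\<^bsub>M'\<^esub> snd p) \<cdot>\<^bsub>M'\<^esub> inv_arr M' f'"
    by simp
  also have "\<dots> = inv_arr M' (amap F f) \<cdot>\<^bsub>M'\<^esub> (snd q \<cdot>\<^bsub>M'\<^esub> f') \<cdot>\<^bsub>M'\<^esub> inv_arr M' f'"
    by (simp only: eq)
  also have "\<dots> = amap F (inv_arr M f) \<cdot>\<^bsub>M'\<^esub> snd q"
    by (simp add: amap_inv_arr)
  finally show ?thesis using o by (simp add: covers_def)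
qed

lemma covers_tensor:
  assumes f: "covers p f' q f" and g: "covers r g' s g"
  shows "covers (p \<boxtimes> r) (f' \<otimes>\<^sub>a\<^bsub>M'\<^esub> g') (q \<boxtimes> s) (f \<otimes>\<^sub>a\<^bsub>M\<^esub> g)"
proof -
  have [simp]: "f' \<in> Arr M'" "f \<in> Arr M" "g' \<in> Arr M'" "g \<in> Arr M"
    and o: "over p (Dom M' f') (Dom M f)" "over q (Cod M' f') (Cod M f)"
      "over r (Dom M' g') (Dom M g)" "over s (Cod M' g') (Cod M g)"
    and eq: "snd q \<cdot>\<^bsub>M'\<^esub> f' = amap F f \<cdot>\<^bsub>M'\<^esub> snd p" "snd s \<cdot>\<^bsub>M'\<^esub> g' = amap F g \<cdot>\<^bsub>M'\<^esub> snd r"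
    using f g by (auto simp: covers_def)
  have [simp]: "fst p = Dom M f" "snd p \<in> Arr M'" "Cod M' (snd p) = omap F (Dom M f)"
    "Dom M' (snd p) = Dom M' f'" "Dom M' (snd r) = Dom M' g'"
    "fst q = Cod M f" "snd q \<in> Arr M'" "Dom M' (snd q) = Cod M' f'" "Cod M' (snd q) = omap F (Cod M f)"
    "fst r = Dom M g" "snd r \<in> Arr M'" "Cod M' (snd r) = omap F (Dom M g)"
    "fst s = Cod M g" "snd s \<in> Arr M'" "Dom M' (snd s) = Cod M' g'" "Cod M' (snd s) = omap F (Cod M g)"
    using o by (auto simp: over_def)
  have "snd (q \<boxtimes> s) \<cdot>\<^bsub>M'\<^esub> (f' \<otimes>\<^sub>a\<^bsub>M'\<^esub> g')
      = \<phi>2 (Cod M f) (Cod M g) \<cdot>\<^bsub>M'\<^esub> ((amap F f \<otimes>\<^sub>a\<^bsub>M'\<^esub> amap F g) \<cdot>\<^bsub>M'\<^esub> (snd p \<otimes>\<^sub>a\<^bsub>M'\<^esub> snd r))"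
    by (simp add: fuse_def M'.interchange eq)
  also have "\<dots> = amap F (f \<otimes>\<^sub>a\<^bsub>M\<^esub> g) \<cdot>\<^bsub>M'\<^esub> snd (p \<boxtimes> r)"
    by (subst phi2_natural_assoc) (simp_all add: fuse_def)
  finally show ?thesis using o by (simp add: covers_def over_fuse)
qed

text \<open>Naturality of the associator of M' moves the isomorphisms of the three frames to the
  outside. What remains is the case of identity frames, which is \<open>phi2_ass\<close>. The
  coverings of the unit constraints and of the braiding are reduced to their axioms in the same
  way.\<close>

lemma covers_ass:
  assumes o: "over p X' X" "over q Y' Y" "over r Z' Z"
  shows "covers ((p \<boxtimes> q) \<boxtimes> r) (ass M' X' Y' Z') (p \<boxtimes> (q \<boxtimes> r)) (ass M X Y Z)"
proof (rule coversI)
  have [simp]: "X \<in> Obj M" "Y \<in> Obj M" "Z \<in> Obj M" "X' \<in> Obj M'" "Y' \<in> Obj M'" "Z' \<in> Obj M'"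
    using o by (auto dest: over_Obj)
  have [simp]: "fst p = X" "fst q = Y" "fst r = Z" "snd p \<in> Arr M'" "snd q \<in> Arr M'" "snd r \<in> Arr M'"
    "Dom M' (snd p) = X'" "Dom M' (snd q) = Y'" "Dom M' (snd r) = Z'"
    "Cod M' (snd p) = omap F X" "Cod M' (snd q) = omap F Y" "Cod M' (snd r) = omap F Z"
    using o by (auto simp: over_def)
  let ?t = "snd p \<otimes>\<^sub>a\<^bsub>M'\<^esub> (snd q \<otimes>\<^sub>a\<^bsub>M'\<^esub> snd r)" and ?t' = "(snd p \<otimes>\<^sub>a\<^bsub>M'\<^esub> snd q) \<otimes>\<^sub>a\<^bsub>M'\<^esub> snd r"
  have "snd (p \<boxtimes> (q \<boxtimes> r)) \<cdot>\<^bsub>M'\<^esub> ass M' X' Y' Z'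
      = \<phi>2 X (Y \<otimes>\<^sub>o\<^bsub>M\<^esub> Z) \<cdot>\<^bsub>M'\<^esub> (omap F X \<rhd>\<^bsub>M'\<^esub> \<phi>2 Y Z) \<cdot>\<^bsub>M'\<^esub> (?t \<cdot>\<^bsub>M'\<^esub> ass M' X' Y' Z')"
    by (simp add: fuse_def M'.interchange_assoc)
  also have "\<dots> = (\<phi>2 X (Y \<otimes>\<^sub>o\<^bsub>M\<^esub> Z) \<cdot>\<^bsub>M'\<^esub> (omap F X \<rhd>\<^bsub>M'\<^esub> \<phi>2 Y Z)
      \<cdot>\<^bsub>M'\<^esub> ass M' (omap F X) (omap F Y) (omap F Z)) \<cdot>\<^bsub>M'\<^esub> ?t'"
    using M'.ass_natural_arr[of "snd p" "snd q" "snd r"] by simp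
  also have "\<dots> = (amap F (ass M X Y Z) \<cdot>\<^bsub>M'\<^esub> \<phi>2 (X \<otimes>\<^sub>o\<^bsub>M\<^esub> Y) Z
      \<cdot>\<^bsub>M'\<^esub> (\<phi>2 X Y \<lhd>\<^bsub>M'\<^esub> omap F Z)) \<cdot>\<^bsub>M'\<^esub> ?t'"
    by (simp only: phi2_ass \<open>X \<in> Obj M\<close> \<open>Y \<in> Obj M\<close> \<open>Z \<in> Obj M\<close>)
  also have "\<dots> = amap F (ass M X Y Z) \<cdot>\<^bsub>M'\<^esub> snd ((p \<boxtimes> q) \<boxtimes> r)"
    by (simp add: fuse_def M'.interchange)
  finally show "snd (p \<boxtimes> (q \<boxtimes> r)) \<cdot>\<^bsub>M'\<^esub> ass M' X' Y' Z'
    = amap F (ass M X Y Z) \<cdot>\<^bsub>M'\<^esub> snd ((p \<boxtimes> q) \<boxtimes> r)" .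
qed (use o o[THEN over_Obj(1)] o[THEN over_Obj(2)] in \<open>auto intro: over_fuse\<close>)

lemma covers_lun:
  assumes o: "over p X' X"
  shows "covers (unit_frame \<boxtimes> p) (lun M' X') p (lun M X)"
proof (rule coversI)
  have [simp]: "X \<in> Obj M" "X' \<in> Obj M'" using o by (auto dest: over_Obj)
  have [simp]: "fst p = X" "snd p \<in> Arr M'" "Dom M' (snd p) = X'" "Cod M' (snd p) = omap F X"
    using o by (auto simp: over_def)
  have "snd p \<cdot>\<^bsub>M'\<^esub> lun M' X' = lun M' (omap F X) \<cdot>\<^bsub>M'\<^esub> (\<I>\<^bsub>M'\<^esub> \<rhd>\<^bsub>M'\<^esub> snd p)"
    using M'.lun_natural_arr[of "snd p"] by simp
  also have "\<dots> = (amap F (lun M X) \<cdot>\<^bsub>M'\<^esub> \<phi>2 \<I>\<^bsub>M\<^esub> X \<cdot>\<^bsub>M'\<^esub> (\<phi>0 \<lhd>\<^bsub>M'\<^esub> omap F X))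
      \<cdot>\<^bsub>M'\<^esub> (\<I>\<^bsub>M'\<^esub> \<rhd>\<^bsub>M'\<^esub> snd p)"
    by (simp only: phi_lun \<open>X \<in> Obj M\<close>)
  also have "\<dots> = amap F (lun M X) \<cdot>\<^bsub>M'\<^esub> snd (unit_frame \<boxtimes> p)"
    by (simp add: fuse_def unit_frame_def M'.interchange)
  finally show "snd p \<cdot>\<^bsub>M'\<^esub> lun M' X' = amap F (lun M X) \<cdot>\<^bsub>M'\<^esub> snd (unit_frame \<boxtimes> p)" .
qed (use o in \<open>auto intro: over_fuse over_unit dest: over_Obj\<close>)

lemma covers_run:
  assumes o: "over p X' X"
  shows "covers (p \<boxtimes> unit_frame) (run M' X') p (run M X)"
proof (rule coversI)
  have [simp]: "X \<in> Obj M" "X' \<in> Obj M'" using o by (auto dest: over_Obj)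
  have [simp]: "fst p = X" "snd p \<in> Arr M'" "Dom M' (snd p) = X'" "Cod M' (snd p) = omap F X"
    using o by (auto simp: over_def)
  have "snd p \<cdot>\<^bsub>M'\<^esub> run M' X' = run M' (omap F X) \<cdot>\<^bsub>M'\<^esub> (snd p \<lhd>\<^bsub>M'\<^esub> \<I>\<^bsub>M'\<^esub>)"
    using M'.run_natural_arr[of "snd p"] by simp
  also have "\<dots> = (amap F (run M X) \<cdot>\<^bsub>M'\<^esub> \<phi>2 X \<I>\<^bsub>M\<^esub> \<cdot>\<^bsub>M'\<^esub> (omap F X \<rhd>\<^bsub>M'\<^esub> \<phi>0))
      \<cdot>\<^bsub>M'\<^esub> (snd p \<lhd>\<^bsub>M'\<^esub> \<I>\<^bsub>M'\<^esub>)"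
    by (simp only: phi_run \<open>X \<in> Obj M\<close>)
  also have "\<dots> = amap F (run M X) \<cdot>\<^bsub>M'\<^esub> snd (p \<boxtimes> unit_frame)"
    by (simp add: fuse_def unit_frame_def M'.interchange)
  finally show "snd p \<cdot>\<^bsub>M'\<^esub> run M' X' = amap F (run M X) \<cdot>\<^bsub>M'\<^esub> snd (p \<boxtimes> unit_frame)" .
qed (use o in \<open>auto intro: over_fuse over_unit dest: over_Obj\<close>)

lemma covers_inv_ass:
  assumes o: "over p X' X" "over q Y' Y" "over r Z' Z"
  shows "covers (p \<boxtimes> (q \<boxtimes> r)) (inv_arr M' (ass M' X' Y' Z')) ((p \<boxtimes> q) \<boxtimes> r)
    (inv_arr M (ass M X Y Z))"
  by (rule covers_inv_arr[OF covers_ass[OF o]])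
    (use o[THEN over_Obj(1)] o[THEN over_Obj(2)] in simp_all)

lemma covers_inv_lun:
  "over p X' X \<Longrightarrow> covers p (inv_arr M' (lun M' X')) (unit_frame \<boxtimes> p) (inv_arr M (lun M X))"
  by (rule covers_inv_arr[OF covers_lun]) (auto dest: over_Obj)

lemma covers_inv_run:
  "over p X' X \<Longrightarrow> covers p (inv_arr M' (run M' X')) (p \<boxtimes> unit_frame) (inv_arr M (run M X))"
  by (rule covers_inv_arr[OF covers_run]) (auto dest: over_Obj)

lemma covers_image: "f \<in> Hom M X Y \<Longrightarrow> covers (image_frame X) (amap F f) (image_frame Y) f"
  by (rule coversI[OF over_image over_image]) (auto simp: image_frame_def)

text \<open>The rules follow the syntax of an arrow: composition, tensor product, identity or
  constraint. Resolution with them derives the covering of a compound expression, and the frames at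
  intermediate objects are found by unification.\<close>

lemmas covers_rules = covers_comp covers_tensor covers_ident covers_ass covers_inv_ass
  covers_lun covers_run covers_inv_lun covers_inv_run over_fuse over_unit

text \<open>A frame is an isomorphism, hence cancellable: the one at the codomain gives the forward
  direction, the one at the domain gives F f = F g in the backward direction. Both are kept in one
  conjunction so that a single derivation of the coverings serves both.\<close>

lemma covers_eq_transfer:
  assumes f: "covers p f' q f" and g: "covers p g' q g"
  shows "(f = g \<longrightarrow> f' = g') \<and> (faithful_functor M F \<longrightarrow> f' = g' \<longrightarrow> f = g)"
proof (intro conjI impI)
  assume "f = g"
  then show "f' = g'"
    using f g by (intro M'.iso_cancel_left[of "snd q" f' g']) (auto simp: covers_def over_def)
next
  assume "f' = g'"
  then have "amap F f = amap F g"
    using f g by (intro M'.iso_cancel_right[of "amap F f" "snd p" "amap F g"])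
      (auto simp: covers_def over_def)
  moreover assume "faithful_functor M F"
  ultimately show "f = g"
    using f g by (auto simp: covers_def over_def faithful_functor_def)
qed

lemma covers_lift:
  assumes full: "full_functor M M' F" and o: "over p X' X" "over q Y' Y" and f': "f' \<in> Hom M' X' Y'"
  obtains f where "covers p f' q f"
proof -
  \<comment> \<open>The covering equation, solved for the arrow F f.\<close>
  let ?h = "snd q \<cdot>\<^bsub>M'\<^esub> f' \<cdot>\<^bsub>M'\<^esub> inv_arr M' (snd p)"
  have "?h \<in> Hom M' (omap F X) (omap F Y)" "X \<in> Obj M" "Y \<in> Obj M"
    using o f' by (auto simp: over_def)
  then have "?h \<in> amap F ` Hom M X Y"
    using full unfolding full_functor_def by (simp only: subset_iff)
  then obtain f where f: "f \<in> Hom M X Y" "amap F f = ?h"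
    by (rule imageE) simp
  have "covers p f' q f"
    using o f f' by (intro coversI[OF o]) (auto simp: over_def)
  then show thesis by (rule that)
qed

end

lemma (in braided_monoidal_functor) covers_braid:
  assumes o: "over p X' X" "over q Y' Y"
  shows "covers (p \<boxtimes> q) (braid M' X' Y') (q \<boxtimes> p) (braid M X Y)"
proof (rule coversI)
  have [simp]: "X \<in> Obj M" "Y \<in> Obj M" "X' \<in> Obj M'" "Y' \<in> Obj M'"
    using o by (auto dest: over_Obj)
  have [simp]: "fst p = X" "fst q = Y" "snd p \<in> Arr M'" "snd q \<in> Arr M'"
    "Dom M' (snd p) = X'" "Dom M' (snd q) = Y'"
    "Cod M' (snd p) = omap F X" "Cod M' (snd q) = omap F Y"
    using o by (auto simp: over_def)
  have "snd (q \<boxtimes> p) \<cdot>\<^bsub>M'\<^esub> braid M' X' Y'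
      = (\<phi>2 Y X \<cdot>\<^bsub>M'\<^esub> braid M' (omap F X) (omap F Y)) \<cdot>\<^bsub>M'\<^esub> (snd p \<otimes>\<^sub>a\<^bsub>M'\<^esub> snd q)"
    using M'.braid_natural_arr[of "snd p" "snd q"] by (simp add: fuse_def)
  also have "\<dots> = (amap F (braid M X Y) \<cdot>\<^bsub>M'\<^esub> \<phi>2 X Y) \<cdot>\<^bsub>M'\<^esub> (snd p \<otimes>\<^sub>a\<^bsub>M'\<^esub> snd q)"
    by (simp only: phi2_braid \<open>X \<in> Obj M\<close> \<open>Y \<in> Obj M\<close>)
  also have "\<dots> = amap F (braid M X Y) \<cdot>\<^bsub>M'\<^esub> snd (p \<boxtimes> q)"
    by (simp add: fuse_def)
  finally show "snd (q \<boxtimes> p) \<cdot>\<^bsub>M'\<^esub> braid M' X' Y' = amap F (braid M X Y) \<cdot>\<^bsub>M'\<^esub> snd (p \<boxtimes> q)" .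
qed (use o o[THEN over_Obj(1)] o[THEN over_Obj(2)] in \<open>auto intro: over_fuse\<close>)

section \<open>Equivalences and isomorphisms of categories\<close>

text \<open>\<open>functor_eq\<close> asks for functoriality of both sides, and agreement transports
  it from one side to the other. Composites such as Br F after J thus become functors through the
  equality itself.\<close>

lemma functor_eqI:
  assumes F: "cfunctor C D F" and o: "\<And>X. X \<in> Obj C \<Longrightarrow> omap F X = omap G X"
    and a: "\<And>f. f \<in> Arr C \<Longrightarrow> amap F f = amap G f"
  shows "functor_eq C D F G"
proof -
  interpret F: cfunctor C D F by fact
  have "cfunctor C D G"
    by unfold_locales (use F.omap_Obj F.amap_Hom F.amap_ident F.amap_comp in \<open>auto simp flip: o a\<close>)
  then show ?thesis using assms by (simp add: functor_eq_def)
qed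

lemma cfunctor_comp_fctr:
  assumes "cfunctor C D F" "cfunctor D E G"
  shows "cfunctor C E (G \<circ>\<^sub>F F)"
proof -
  interpret F: cfunctor C D F by fact
  interpret G: cfunctor D E G by fact
  show ?thesis by unfold_locales (auto simp: comp_fctr_def)
qed

lemma cfunctor_id_fctr:
  assumes "category C"
  shows "cfunctor C C id_fctr"
proof -
  interpret category C by fact
  show ?thesis by unfold_locales (auto simp: id_fctr_def)
qed

section \<open>Equivalences and isomorphisms from full and faithful functors\<close>

context cfunctor
begin

lemma reflects_iso:
  assumes full: "full_functor C D F" and faithful: "faithful_functor C F"
    and f: "f \<in> Hom C X Y" and iso: "is_iso D (amap F f)"
  shows "is_iso C f"
proof -
  have [simp]: "f \<in> Arr C" "Dom C f = X" "Cod C f = Y" "X \<in> Obj C" "Y \<in> Obj C" using f by auto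
  have "inv_arr D (amap F f) \<in> Hom D (omap F Y) (omap F X)" using iso by simp
  then have "inv_arr D (amap F f) \<in> amap F ` Hom C Y X"
    using full \<open>X \<in> Obj C\<close> \<open>Y \<in> Obj C\<close> unfolding full_functor_def by (simp only: subset_iff)
  then obtain g where g: "g \<in> Hom C Y X" "inv_arr D (amap F f) = amap F g" by (rule imageE)
  have "amap F (g \<cdot>\<^bsub>C\<^esub> f) = amap F (ident C X)" "amap F (f \<cdot>\<^bsub>C\<^esub> g) = amap F (ident C Y)"
    using g iso by (simp_all flip: g(2))
  then have "g \<cdot>\<^bsub>C\<^esub> f = ident C X" "f \<cdot>\<^bsub>C\<^esub> g = ident C Y"
    using faithful g unfolding faithful_functor_def
    by (metis C.comp_typing C.ident_typing \<open>X \<in> Obj C\<close> \<open>Y \<in> Obj C\<close> f mem_Hom_iff)+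
  then show ?thesis using f g by (intro C.is_isoI)
qed

text \<open>
  Chosen isomorphisms \<open>a\<close> yield the quasi-inverse of an equivalence; identities as \<open>a\<close>
  yield the inverse of an isomorphism.
\<close>

lemma lifting_functor:
  assumes full: "full_functor C D F" and faithful: "faithful_functor C F"
    and R: "\<And>Y. Y \<in> Obj D \<Longrightarrow> R Y \<in> Obj C"
    and a: "\<And>Y. Y \<in> Obj D \<Longrightarrow> a Y \<in> Hom D Y (omap F (R Y)) \<and> is_iso D (a Y)"
  obtains G where "cfunctor D C G" "\<And>Y. omap G Y = R Y"
    "\<And>g. g \<in> Arr D \<Longrightarrow> amap F (amap G g) \<cdot>\<^bsub>D\<^esub> a (Dom D g) = a (Cod D g) \<cdot>\<^bsub>D\<^esub> g"
proof -
  have a_simps [simp]: "a Y \<in> Arr D" "Dom D (a Y) = Y" "Cod D (a Y) = omap F (R Y)" "is_iso D (a Y)"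
    "R Y \<in> Obj C" if "Y \<in> Obj D" for Y
    using a[OF that] R[OF that] by auto
  \<comment> \<open>The square that the value of G at g has to fill. Fullness gives a filler,
    faithfulness its uniqueness, and uniqueness makes G preserve identities and composites.\<close>
  define L where "L g f \<longleftrightarrow> f \<in> Hom C (R (Dom D g)) (R (Cod D g)) \<and>
    amap F f \<cdot>\<^bsub>D\<^esub> a (Dom D g) = a (Cod D g) \<cdot>\<^bsub>D\<^esub> g" for g f
  have L_unique: "f = f'" if "L g f" "L g f'" "g \<in> Arr D" for f f' g
  proof -
    have "amap F f = amap F f'"
      using that unfolding L_def by (intro D.iso_cancel_right[of "amap F f" "a (Dom D g)"]) auto
    then show ?thesis using that faithful unfolding L_def faithful_functor_def by simp
  qed
  have L_ex: "\<exists>f. L g f" if g: "g \<in> Arr D" for g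
  proof -
    let ?h = "a (Cod D g) \<cdot>\<^bsub>D\<^esub> g \<cdot>\<^bsub>D\<^esub> inv_arr D (a (Dom D g))"
    have "?h \<in> Hom D (omap F (R (Dom D g))) (omap F (R (Cod D g)))" using g by simp
    moreover have "R (Dom D g) \<in> Obj C" "R (Cod D g) \<in> Obj C" using g by simp_all
    ultimately have "?h \<in> amap F ` Hom C (R (Dom D g)) (R (Cod D g))"
      using full unfolding full_functor_def by (simp only: subset_iff)
    then obtain f where "?h = amap F f" "f \<in> Hom C (R (Dom D g)) (R (Cod D g))"
      by (rule imageE)
    then have "L g f" using g by (simp add: L_def flip: \<open>?h = amap F f\<close>)
    then show ?thesis ..
  qed
  define G where "G = \<lparr>omap = R, amap = (\<lambda>g. SOME f. L g f)\<rparr>"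
  have G: "L g (amap G g)" if "g \<in> Arr D" for g
    using someI_ex[OF L_ex[OF that]] by (simp add: G_def)
  have G_eq: "amap G g = f" if "L g f" "g \<in> Arr D" for g f
    using L_unique G that by blast
  have oG: "omap G Y = R Y" for Y by (simp add: G_def)
  have "cfunctor D C G"
  proof unfold_locales
    fix X Y Z f g assume "f \<in> Hom D X Y" "g \<in> Hom D Y Z"
    then have [simp]: "f \<in> Arr D" "g \<in> Arr D" "Dom D f = X" "Cod D f = Y" "Dom D g = Y" "Cod D g = Z"
      "X \<in> Obj D" "Y \<in> Obj D" "Z \<in> Obj D"
      by auto
    have Gf: "amap G f \<in> Hom C (R X) (R Y)" "amap F (amap G f) \<cdot>\<^bsub>D\<^esub> a X = a Y \<cdot>\<^bsub>D\<^esub> f"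
      and Gg: "amap G g \<in> Hom C (R Y) (R Z)" "amap F (amap G g) \<cdot>\<^bsub>D\<^esub> a Y = a Z \<cdot>\<^bsub>D\<^esub> g"
      using G[of f] G[of g] by (auto simp: L_def)
    have "amap F (amap G g \<cdot>\<^bsub>C\<^esub> amap G f) \<cdot>\<^bsub>D\<^esub> a X = (amap F (amap G g) \<cdot>\<^bsub>D\<^esub> a Y) \<cdot>\<^bsub>D\<^esub> f"
      using Gf Gg(1) by simp
    also have "\<dots> = a Z \<cdot>\<^bsub>D\<^esub> (g \<cdot>\<^bsub>D\<^esub> f)"
      by (simp only: Gg(2)) simp
    finally show "amap G (g \<cdot>\<^bsub>D\<^esub> f) = amap G g \<cdot>\<^bsub>C\<^esub> amap G f"
      using Gf Gg by (intro G_eq) (auto simp: L_def)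
  next
    fix X assume "X \<in> Obj D"
    then show "amap G (ident D X) = ident C (omap G X)"
      by (intro G_eq) (auto simp: L_def oG)
  qed (use G in \<open>auto simp: L_def oG\<close>)
  moreover have "amap F (amap G g) \<cdot>\<^bsub>D\<^esub> a (Dom D g) = a (Cod D g) \<cdot>\<^bsub>D\<^esub> g" if "g \<in> Arr D" for g
    using G[OF that] by (simp add: L_def)
  ultimately show thesis using oG that by blast
qed

lemma equivalence_functorI:
  assumes full: "full_functor C D F" and faithful: "faithful_functor C F"
    and "essentially_surjective C D F"
  shows "equivalence_functor C D F"
proof -
  obtain R a where Ra: "\<And>Y. Y \<in> Obj D \<Longrightarrow> R Y \<in> Obj C \<and> a Y \<in> Hom D Y (omap F (R Y)) \<and> is_iso D (a Y)"
    using assms(3) unfolding essentially_surjective_def by metis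
  then have a_simps [simp]: "a Y \<in> Arr D" "Dom D (a Y) = Y" "Cod D (a Y) = omap F (R Y)" "is_iso D (a Y)"
    "R Y \<in> Obj C" if "Y \<in> Obj D" for Y
    using that by auto
  obtain G where G: "cfunctor D C G" and oG [simp]: "\<And>Y. omap G Y = R Y"
    and FG: "\<And>g. g \<in> Arr D \<Longrightarrow> amap F (amap G g) \<cdot>\<^bsub>D\<^esub> a (Dom D g) = a (Cod D g) \<cdot>\<^bsub>D\<^esub> g"
    using lifting_functor[OF full faithful, of R a] Ra by blast
  interpret G: cfunctor D C G by fact
  \<comment> \<open>The unit at X is a lift through F of the chosen isomorphism out of F X. Its
    naturality is checked after applying F, where it is the square characterising G.\<close>
  have "\<exists>h. h \<in> Hom C X (R (omap F X)) \<and> amap F h = a (omap F X)" if [simp]: "X \<in> Obj C" for X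
  proof -
    have "a (omap F X) \<in> Hom D (omap F X) (omap F (R (omap F X)))" "R (omap F X) \<in> Obj C" by simp_all
    then have "a (omap F X) \<in> amap F ` Hom C X (R (omap F X))"
      using full that unfolding full_functor_def by (simp only: subset_iff)
    then show ?thesis by (metis imageE)
  qed
  then obtain \<eta> where \<eta>: "\<And>X. X \<in> Obj C \<Longrightarrow> \<eta> X \<in> Hom C X (R (omap F X)) \<and> amap F (\<eta> X) = a (omap F X)"
    by metis
  then have \<eta>_simps [simp]: "\<eta> X \<in> Arr C" "Dom C (\<eta> X) = X" "Cod C (\<eta> X) = R (omap F X)"
    "amap F (\<eta> X) = a (omap F X)" if "X \<in> Obj C" for X
    using that by auto
  have "natural_iso C C id_fctr (G \<circ>\<^sub>F F) \<eta>"
    unfolding natural_iso_def natural_transformation_def natural_transformation_axioms_def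
  proof (intro conjI allI impI ballI cfunctor_id_fctr C.category_axioms
      cfunctor_comp_fctr[OF cfunctor_axioms G])
    fix X assume X: "X \<in> Obj C"
    show "\<eta> X \<in> Hom C (omap id_fctr X) (omap (G \<circ>\<^sub>F F) X)"
      using X by (simp add: id_fctr_def comp_fctr_def)
    show "is_iso C (\<eta> X)"
      by (rule reflects_iso[OF full faithful, of _ X "R (omap F X)"]) (use X in simp_all)
  next
    fix f X Y assume "f \<in> Hom C X Y"
    then have [simp]: "f \<in> Arr C" "Dom C f = X" "Cod C f = Y" "X \<in> Obj C" "Y \<in> Obj C" by auto
    have "amap F (\<eta> Y \<cdot>\<^bsub>C\<^esub> f) = amap F (amap G (amap F f) \<cdot>\<^bsub>C\<^esub> \<eta> X)"
      using FG[of "amap F f"] by simp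
    then have "\<eta> Y \<cdot>\<^bsub>C\<^esub> f = amap G (amap F f) \<cdot>\<^bsub>C\<^esub> \<eta> X"
      using faithful unfolding faithful_functor_def by simp
    then show "\<eta> Y \<cdot>\<^bsub>C\<^esub> amap id_fctr f = amap (G \<circ>\<^sub>F F) f \<cdot>\<^bsub>C\<^esub> \<eta> X"
      by (simp add: id_fctr_def comp_fctr_def)
  qed
  \<comment> \<open>The counit is the inverse of the chosen isomorphism; its naturality is the same
    square, read backwards.\<close>
  moreover have "natural_iso D D (F \<circ>\<^sub>F G) id_fctr (\<lambda>Y. inv_arr D (a Y))"
    unfolding natural_iso_def natural_transformation_def natural_transformation_axioms_def
  proof (intro conjI allI impI ballI cfunctor_id_fctr D.category_axioms
      cfunctor_comp_fctr[OF G cfunctor_axioms])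
    fix f X Y assume "f \<in> Hom D X Y"
    then have [simp]: "f \<in> Arr D" "Dom D f = X" "Cod D f = Y" "X \<in> Obj D" "Y \<in> Obj D" by auto
    have "inv_arr D (a Y) \<cdot>\<^bsub>D\<^esub> amap F (amap G f)
        = inv_arr D (a Y) \<cdot>\<^bsub>D\<^esub> (amap F (amap G f) \<cdot>\<^bsub>D\<^esub> a X) \<cdot>\<^bsub>D\<^esub> inv_arr D (a X)"
      by simp
    also have "\<dots> = f \<cdot>\<^bsub>D\<^esub> inv_arr D (a X)"
      using FG[of f] by simp
    finally show "inv_arr D (a Y) \<cdot>\<^bsub>D\<^esub> amap (F \<circ>\<^sub>F G) f = amap id_fctr f \<cdot>\<^bsub>D\<^esub> inv_arr D (a X)"
      by (simp add: id_fctr_def comp_fctr_def)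
  qed (simp_all add: id_fctr_def comp_fctr_def)
  ultimately show ?thesis
    unfolding equivalence_functor_def using G cfunctor_axioms by blast
qed

lemma isomorphism_functorI:
  assumes full: "full_functor C D F" and faithful: "faithful_functor C F"
    and bij: "bij_betw (omap F) (Obj C) (Obj D)"
  shows "isomorphism_functor C D F"
proof -
  let ?R = "inv_into (Obj C) (omap F)"
  have [simp]: "?R Y \<in> Obj C" "omap F (?R Y) = Y" if "Y \<in> Obj D" for Y
    using that bij by (auto simp: bij_betw_def f_inv_into_f inv_into_into)
  obtain G where G: "cfunctor D C G" and oG [simp]: "\<And>Y. omap G Y = ?R Y"
    and FG: "\<And>g. g \<in> Arr D \<Longrightarrow> amap F (amap G g) \<cdot>\<^bsub>D\<^esub> ident D (Dom D g) = ident D (Cod D g) \<cdot>\<^bsub>D\<^esub> g"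
    using lifting_functor[OF full faithful, of ?R "ident D"] by auto
  interpret G: cfunctor D C G by fact
  have FG' [simp]: "amap F (amap G g) = g" if "g \<in> Arr D" for g
    using FG[OF that] that by simp
  have RF [simp]: "?R (omap F X) = X" if "X \<in> Obj C" for X
    using that bij by (simp add: bij_betw_def)
  have "functor_eq C C (G \<circ>\<^sub>F F) id_fctr"
  proof (rule functor_eqI[OF cfunctor_comp_fctr[OF cfunctor_axioms G]])
    fix f assume f: "f \<in> Arr C"
    have "amap G (amap F f) = f"
      using faithful f unfolding faithful_functor_def by simp
    then show "amap (G \<circ>\<^sub>F F) f = amap id_fctr f" by (simp add: comp_fctr_def id_fctr_def)
  qed (simp add: comp_fctr_def id_fctr_def)
  moreover have "functor_eq D D (F \<circ>\<^sub>F G) id_fctr"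
    by (rule functor_eqI[OF cfunctor_comp_fctr[OF G cfunctor_axioms]])
      (simp_all add: comp_fctr_def id_fctr_def)
  ultimately show ?thesis
    unfolding isomorphism_functor_def using G cfunctor_axioms by blast
qed

end

text \<open>The unit being a natural isomorphism makes F faithful, the counit makes G faithful.
  Fullness of F uses the latter: F f and h are compared after applying G. Essential surjectivity is
  witnessed by inverse components of the counit.\<close>

lemma equivalence_functorD:
  assumes "equivalence_functor C D F"
  shows "full_functor C D F" "faithful_functor C F" "essentially_surjective C D F"
proof -
  obtain G \<eta> \<epsilon> where F: "cfunctor C D F" and G: "cfunctor D C G"
    and \<eta>: "natural_iso C C id_fctr (G \<circ>\<^sub>F F) \<eta>" and \<epsilon>: "natural_iso D D (F \<circ>\<^sub>F G) id_fctr \<epsilon>"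
    using assms unfolding equivalence_functor_def by blast
  interpret F: cfunctor C D F by fact
  interpret G: cfunctor D C G by fact
  have \<eta>_simps [simp]: "\<eta> X \<in> Arr C" "Dom C (\<eta> X) = X" "Cod C (\<eta> X) = omap G (omap F X)"
    "is_iso C (\<eta> X)" if "X \<in> Obj C" for X
    using \<eta> that natural_transformation.component_Hom[of C C id_fctr "G \<circ>\<^sub>F F" \<eta> X]
    by (auto simp: natural_iso_def id_fctr_def comp_fctr_def)
  have \<epsilon>_simps [simp]: "\<epsilon> Y \<in> Arr D" "Dom D (\<epsilon> Y) = omap F (omap G Y)" "Cod D (\<epsilon> Y) = Y"
    "is_iso D (\<epsilon> Y)" if "Y \<in> Obj D" for Y
    using \<epsilon> that natural_transformation.component_Hom[of D D "F \<circ>\<^sub>F G" id_fctr \<epsilon> Y]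
    by (auto simp: natural_iso_def id_fctr_def comp_fctr_def)
  have \<eta>_nat: "\<eta> (Cod C f) \<cdot>\<^bsub>C\<^esub> f = amap G (amap F f) \<cdot>\<^bsub>C\<^esub> \<eta> (Dom C f)" if "f \<in> Arr C" for f
    using \<eta> that natural_transformation.naturality[of C C id_fctr "G \<circ>\<^sub>F F" \<eta> f "Dom C f" "Cod C f"]
    by (auto simp: natural_iso_def id_fctr_def comp_fctr_def)
  have \<epsilon>_nat: "\<epsilon> (Cod D g) \<cdot>\<^bsub>D\<^esub> amap F (amap G g) = g \<cdot>\<^bsub>D\<^esub> \<epsilon> (Dom D g)" if "g \<in> Arr D" for g
    using \<epsilon> that natural_transformation.naturality[of D D "F \<circ>\<^sub>F G" id_fctr \<epsilon> g "Dom D g" "Cod D g"]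
    by (auto simp: natural_iso_def id_fctr_def comp_fctr_def)
  show "faithful_functor C F"
    unfolding faithful_functor_def
  proof (intro ballI impI)
    fix f g assume fg: "f \<in> Arr C" "g \<in> Arr C"
      "Dom C f = Dom C g \<and> Cod C f = Cod C g \<and> amap F f = amap F g"
    then show "f = g"
      using \<eta>_nat[of f] \<eta>_nat[of g] by (intro F.C.iso_cancel_left[of "\<eta> (Cod C f)" f g]) auto
  qed
  have G_faithful: "faithful_functor D G"
    unfolding faithful_functor_def
  proof (intro ballI impI)
    fix f g assume fg: "f \<in> Arr D" "g \<in> Arr D"
      "Dom D f = Dom D g \<and> Cod D f = Cod D g \<and> amap G f = amap G g"
    then show "f = g"
      using \<epsilon>_nat[of f] \<epsilon>_nat[of g] by (intro F.D.iso_cancel_right[of f "\<epsilon> (Dom D f)" g]) auto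
  qed
  show "full_functor C D F"
    unfolding full_functor_def
  proof (intro ballI subsetI)
    fix X Y h assume X [simp]: "X \<in> Obj C" and Y [simp]: "Y \<in> Obj C"
      and h: "h \<in> Hom D (omap F X) (omap F Y)"
    \<comment> \<open>Naturality of \<open>\<eta>\<close> at f, with G h in place of G (F f), forces
      this formula.\<close>
    define f where "f = inv_arr C (\<eta> Y) \<cdot>\<^bsub>C\<^esub> amap G h \<cdot>\<^bsub>C\<^esub> \<eta> X"
    have f: "f \<in> Hom C X Y" using h by (simp add: f_def)
    have "amap G (amap F f) \<cdot>\<^bsub>C\<^esub> \<eta> X = amap G h \<cdot>\<^bsub>C\<^esub> \<eta> X"
      using \<eta>_nat[of f, symmetric] f h by (simp add: f_def del: F.amap_comp_simp)
    then have "amap G (amap F f) = amap G h"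
      using f h by (intro F.C.iso_cancel_right[of "amap G (amap F f)" "\<eta> X"]) auto
    then have "amap F f = h" using G_faithful f h unfolding faithful_functor_def by simp
    then show "h \<in> amap F ` Hom C X Y" using f by blast
  qed
  show "essentially_surjective C D F"
    unfolding essentially_surjective_def
  proof
    fix Y assume [simp]: "Y \<in> Obj D"
    show "\<exists>X \<in> Obj C. \<exists>a \<in> Hom D Y (omap F X). is_iso D a"
      by (intro bexI[of _ "omap G Y"] bexI[of _ "inv_arr D (\<epsilon> Y)"]) simp_all
  qed
qed

lemma isomorphism_functorD:
  assumes "isomorphism_functor C D F"
  shows "full_functor C D F" "faithful_functor C F" "bij_betw (omap F) (Obj C) (Obj D)"
proof -
  obtain G where F: "cfunctor C D F" and G: "cfunctor D C G"
    and GF: "functor_eq C C (G \<circ>\<^sub>F F) id_fctr" and FG: "functor_eq D D (F \<circ>\<^sub>F G) id_fctr"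
    using assms unfolding isomorphism_functor_def by blast
  interpret F: cfunctor C D F by fact
  interpret G: cfunctor D C G by fact
  have GF: "X \<in> Obj C \<Longrightarrow> omap G (omap F X) = X" "f \<in> Arr C \<Longrightarrow> amap G (amap F f) = f" for X f
    using GF by (simp_all add: functor_eq_def comp_fctr_def id_fctr_def)
  have FG: "Y \<in> Obj D \<Longrightarrow> omap F (omap G Y) = Y" "g \<in> Arr D \<Longrightarrow> amap F (amap G g) = g" for Y g
    using FG by (simp_all add: functor_eq_def comp_fctr_def id_fctr_def)
  show "faithful_functor C F"
    unfolding faithful_functor_def using GF(2) by metis
  show "full_functor C D F"
    unfolding full_functor_def
  proof (intro ballI subsetI)
    fix X Y h assume "X \<in> Obj C" "Y \<in> Obj C" "h \<in> Hom D (omap F X) (omap F Y)"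
    then show "h \<in> amap F ` Hom C X Y"
      by (intro image_eqI[of _ _ "amap G h"]) (simp_all add: GF FG)
  qed
  show "bij_betw (omap F) (Obj C) (Obj D)"
    by (rule bij_betw_byWitness[of _ "omap G"]) (auto simp: GF FG)
qed

section \<open>Categories of structured objects\<close>

text \<open>\<open>H_ident\<close> and \<open>H_comp\<close> make the structured objects a category;
  \<open>H_inv_arr\<close> makes its forgetful functor to C reflect isomorphisms.\<close>

locale structure_on = category C
  for C :: "('o, 'a, 'z) cat_scheme" (structure) +
  fixes S :: "('o \<times> 's) set" and H :: "'o \<times> 's \<Rightarrow> 'a \<Rightarrow> 'o \<times> 's \<Rightarrow> bool"
  assumes underlying_Obj [simp]: "X \<in> S \<Longrightarrow> fst X \<in> Obj C"
    and H_ident: "X \<in> S \<Longrightarrow> H X (ident C (fst X)) X"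
    and H_comp: "\<lbrakk>X \<in> S; Y \<in> S; Z \<in> S; f \<in> Hom C (fst X) (fst Y); g \<in> Hom C (fst Y) (fst Z);
      H X f Y; H Y g Z\<rbrakk> \<Longrightarrow> H X (g \<cdot> f) Z"
    and H_inv_arr: "\<lbrakk>X \<in> S; Y \<in> S; f \<in> Hom C (fst X) (fst Y); is_iso C f; H X f Y\<rbrakk>
      \<Longrightarrow> H Y (inv_arr C f) X"
begin

lemma structured_simps [simp]:
  "Obj (structured_cat C S H) = S"
  "(X, f, Y) \<in> Arr (structured_cat C S H) \<longleftrightarrow>
     X \<in> S \<and> Y \<in> S \<and> f \<in> Hom C (fst X) (fst Y) \<and> H X f Y"
  "Dom (structured_cat C S H) (X, f, Y) = X"
  "Cod (structured_cat C S H) (X, f, Y) = Y"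
  "ident (structured_cat C S H) X = (X, ident C (fst X), X)"
  "(Y', g, Z) \<cdot>\<^bsub>structured_cat C S H\<^esub> (X, f, Y) = (X, g \<cdot> f, Z)"
  by (auto simp: structured_cat_def)

lemma category_structured: "category (structured_cat C S H)"
proof unfold_locales
  fix f g X Y Z
  assume fg: "f \<in> Hom (structured_cat C S H) X Y" "g \<in> Hom (structured_cat C S H) Y Z"
  then obtain f\<^sub>0 g\<^sub>0 where "f = (X, f\<^sub>0, Y)" "g = (Y, g\<^sub>0, Z)"
    by (cases f; cases g; simp)
  then show "g \<cdot>\<^bsub>structured_cat C S H\<^esub> f \<in> Hom (structured_cat C S H) X Z"
    using fg H_comp[of X Y Z f\<^sub>0 g\<^sub>0] by auto
qed (auto simp: H_ident)

text \<open>Reduces conservativity of Bialg F to that of F, and upgrades an isomorphism of M' that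
  is a bialgebra morphism to an isomorphism of bialgebras.\<close>

lemma is_iso_structured:
  "is_iso (structured_cat C S H) (X, f, Y) \<longleftrightarrow>
    (X, f, Y) \<in> Arr (structured_cat C S H) \<and> is_iso C f"
proof
  assume "is_iso (structured_cat C S H) (X, f, Y)"
  then show "(X, f, Y) \<in> Arr (structured_cat C S H) \<and> is_iso C f"
    by (auto simp: is_iso_def inverse_arrows_def)
next
  assume "(X, f, Y) \<in> Arr (structured_cat C S H) \<and> is_iso C f"
  then have "inverse_arrows (structured_cat C S H) (X, f, Y) (Y, inv_arr C f, X)"
    by (auto simp: inverse_arrows_def H_inv_arr)
  then show "is_iso (structured_cat C S H) (X, f, Y)" unfolding is_iso_def by blast
qed

end

text \<open>Identities and composites in a structured category are computed on underlying arrows, so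
  functoriality is inherited from F. Only the action on objects and the preservation of the
  structure remain to be checked.\<close>

lemma cfunctor_acting:
  assumes "structure_on C S H" "structure_on D S' H'" "cfunctor C D F"
    and T: "\<And>X. X \<in> S \<Longrightarrow> T X \<in> S' \<and> fst (T X) = omap F (fst X)"
    and H: "\<And>X f Y. \<lbrakk>X \<in> S; Y \<in> S; f \<in> Hom C (fst X) (fst Y); H X f Y\<rbrakk> \<Longrightarrow> H' (T X) (amap F f) (T Y)"
  shows "cfunctor (structured_cat C S H) (structured_cat D S' H') (acting T (amap F))"
proof -
  interpret X: structure_on C S H by fact
  interpret Y: structure_on D S' H' by fact
  interpret F: cfunctor C D F by fact
  interpret SX: category "structured_cat C S H" by (rule X.category_structured)
  interpret SY: category "structured_cat D S' H'" by (rule Y.category_structured)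
  show ?thesis
    by unfold_locales (use T H in \<open>auto simp: acting_def\<close>)
qed

text \<open>Names the predicate that the definition of \<open>Bialg\<close> contains as an anonymous
  function, so that facts about it can be stated.\<close>

definition bialg_mor ::
    "('o, 'a, 'z) moncat_scheme \<Rightarrow> ('o, 'a) bialg \<Rightarrow> 'a \<Rightarrow> ('o, 'a) bialg \<Rightarrow> bool" where
  "bialg_mor M = (\<lambda>(B, m, u, d, e) f (B', m', u', d', e').
     alg_mor M (B, m, u) f (B', m', u') \<and> coalg_mor M (B, d, e) f (B', d', e'))"

lemma Bialg_altdef:
  "Bialg M = structured_cat M {(B, m, u, d, e). bialgebra M B m u d e} (bialg_mor M)"
  by (simp add: Bialg_def bialg_mor_def)

section \<open>Algebra, coalgebra and bialgebra morphisms\<close>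

context monoidal_category
begin

lemma algebra_typing:
  "algebra M A m u \<Longrightarrow> A \<in> Obj M \<and> m \<in> Hom M (A \<otimes>\<^sub>o A) A \<and> u \<in> Hom M \<I> A"
  by (simp add: algebra_def)

lemma coalgebra_typing:
  "coalgebra M A d e \<Longrightarrow> A \<in> Obj M \<and> d \<in> Hom M A (A \<otimes>\<^sub>o A) \<and> e \<in> Hom M A \<I>"
  by (simp add: coalgebra_def)

lemma alg_mor_ident: "algebra M A m u \<Longrightarrow> alg_mor M (A, m, u) (ident M A) (A, m, u)"
  by (auto simp: alg_mor_def dest: algebra_typing)

lemma coalg_mor_ident: "coalgebra M A d e \<Longrightarrow> coalg_mor M (A, d, e) (ident M A) (A, d, e)"
  by (auto simp: coalg_mor_def dest: coalgebra_typing)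

lemma alg_mor_comp:
  assumes "algebra M A m u" "algebra M A' m' u'" "algebra M A'' m'' u''"
    and f: "alg_mor M (A, m, u) f (A', m', u')" and g: "alg_mor M (A', m', u') g (A'', m'', u'')"
  shows "alg_mor M (A, m, u) (g \<cdot> f) (A'', m'', u'')"
proof -
  note t = assms(1-3)[THEN algebra_typing]
  have fg [simp]: "f \<in> Hom M A A'" "g \<in> Hom M A' A''"
    and eq: "f \<cdot> m = m' \<cdot> (f \<otimes>\<^sub>a f)" "g \<cdot> m' = m'' \<cdot> (g \<otimes>\<^sub>a g)" "f \<cdot> u = u'" "g \<cdot> u' = u''"
    using f g by (simp_all add: alg_mor_def)
  have "(g \<cdot> f) \<cdot> m = g \<cdot> (f \<cdot> m)" using t fg by simp
  also have "\<dots> = (g \<cdot> m') \<cdot> (f \<otimes>\<^sub>a f)" using t fg by (simp add: eq(1))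
  also have "\<dots> = m'' \<cdot> ((g \<cdot> f) \<otimes>\<^sub>a (g \<cdot> f))" using t fg by (simp add: eq(2) interchange)
  finally show ?thesis using t fg eq by (auto simp: alg_mor_def)
qed

lemma coalg_mor_comp:
  assumes "coalgebra M A d e" "coalgebra M A' d' e'" "coalgebra M A'' d'' e''"
    and f: "coalg_mor M (A, d, e) f (A', d', e')" and g: "coalg_mor M (A', d', e') g (A'', d'', e'')"
  shows "coalg_mor M (A, d, e) (g \<cdot> f) (A'', d'', e'')"
proof -
  note t = assms(1-3)[THEN coalgebra_typing]
  have fg [simp]: "f \<in> Hom M A A'" "g \<in> Hom M A' A''"
    and eq: "d' \<cdot> f = (f \<otimes>\<^sub>a f) \<cdot> d" "d'' \<cdot> g = (g \<otimes>\<^sub>a g) \<cdot> d'" "e' \<cdot> f = e" "e'' \<cdot> g = e'"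
    using f g by (simp_all add: coalg_mor_def)
  have "d'' \<cdot> (g \<cdot> f) = (d'' \<cdot> g) \<cdot> f" using t fg by simp
  also have "\<dots> = (g \<otimes>\<^sub>a g) \<cdot> (d' \<cdot> f)" using t fg by (simp add: eq(2))
  also have "\<dots> = ((g \<cdot> f) \<otimes>\<^sub>a (g \<cdot> f)) \<cdot> d" using t fg by (simp add: eq(1) interchange_assoc)
  finally have "d'' \<cdot> (g \<cdot> f) = ((g \<cdot> f) \<otimes>\<^sub>a (g \<cdot> f)) \<cdot> d" .
  moreover have "e'' \<cdot> (g \<cdot> f) = (e'' \<cdot> g) \<cdot> f" using t fg by simp
  ultimately show ?thesis using t fg eq by (simp add: coalg_mor_def)
qed

lemma alg_mor_inv_arr:
  assumes "algebra M A m u" "algebra M A' m' u'"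
    and f: "alg_mor M (A, m, u) f (A', m', u')" and iso: "is_iso M f"
  shows "alg_mor M (A', m', u') (inv_arr M f) (A, m, u)"
proof -
  note t = assms(1-2)[THEN algebra_typing]
  have f_simps [simp]: "f \<in> Arr M" "Dom M f = A" "Cod M f = A'" "is_iso M f"
    and eq: "f \<cdot> m = m' \<cdot> (f \<otimes>\<^sub>a f)" "f \<cdot> u = u'"
    using f iso by (auto simp: alg_mor_def)
  have "inv_arr M f \<cdot> m' = inv_arr M f \<cdot> (m' \<cdot> (f \<otimes>\<^sub>a f)) \<cdot> (inv_arr M f \<otimes>\<^sub>a inv_arr M f)"
    using t by (simp add: interchange)
  also have "\<dots> = m \<cdot> (inv_arr M f \<otimes>\<^sub>a inv_arr M f)"
    using t by (simp flip: eq)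
  finally show ?thesis using t by (auto simp: alg_mor_def simp flip: eq(2))
qed

lemma coalg_mor_inv_arr:
  assumes "coalgebra M A d e" "coalgebra M A' d' e'"
    and f: "coalg_mor M (A, d, e) f (A', d', e')" and iso: "is_iso M f"
  shows "coalg_mor M (A', d', e') (inv_arr M f) (A, d, e)"
proof -
  note t = assms(1-2)[THEN coalgebra_typing]
  have f_simps [simp]: "f \<in> Arr M" "Dom M f = A" "Cod M f = A'" "is_iso M f"
    and eq: "d' \<cdot> f = (f \<otimes>\<^sub>a f) \<cdot> d" "e' \<cdot> f = e"
    using f iso by (auto simp: coalg_mor_def)
  have "(inv_arr M f \<otimes>\<^sub>a inv_arr M f) \<cdot> d' = (inv_arr M f \<otimes>\<^sub>a inv_arr M f) \<cdot> (d' \<cdot> f) \<cdot> inv_arr M f"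
    using t by simp
  also have "\<dots> = d \<cdot> inv_arr M f"
    using t by (simp add: eq(1) interchange_assoc)
  finally show ?thesis using t by (auto simp: coalg_mor_def simp flip: eq(2))
qed

lemma structure_on_Alg: "structure_on M {(A, m, u). algebra M A m u} (alg_mor M)"
proof unfold_locales
  fix X Y f
  assume "X \<in> {(A, m, u). algebra M A m u}" "Y \<in> {(A, m, u). algebra M A m u}"
    "is_iso M f" "alg_mor M X f Y"
  then show "alg_mor M Y (inv_arr M f) X"
    by (auto intro: alg_mor_inv_arr)
qed (auto simp: alg_mor_ident dest: algebra_typing intro: alg_mor_comp)

end

context braided_monoidal_category
begin

lemma bialgebra_typing:
  assumes "bialgebra M B m u d e"
  shows "B \<in> Obj M" "m \<in> Hom M (B \<otimes>\<^sub>o B) B" "u \<in> Hom M \<I> B"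
    "d \<in> Hom M B (B \<otimes>\<^sub>o B)" "e \<in> Hom M B \<I>"
  using assms algebra_typing coalgebra_typing unfolding bialgebra_def by blast+

lemma structure_on_Bialg:
  "structure_on M {(B, m, u, d, e). bialgebra M B m u d e} (bialg_mor M)"
proof unfold_locales
  fix X assume "X \<in> {(B, m, u, d, e). bialgebra M B m u d e}"
  then show "fst X \<in> Obj M" "bialg_mor M X (ident M (fst X)) X"
    by (auto simp: bialgebra_def bialg_mor_def alg_mor_ident coalg_mor_ident dest: algebra_typing)
next
  fix X Y Z f g
  assume "X \<in> {(B, m, u, d, e). bialgebra M B m u d e}" "Y \<in> {(B, m, u, d, e). bialgebra M B m u d e}"
    "Z \<in> {(B, m, u, d, e). bialgebra M B m u d e}" "bialg_mor M X f Y" "bialg_mor M Y g Z"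
  then show "bialg_mor M X (g \<cdot> f) Z"
    by (auto simp: bialgebra_def bialg_mor_def intro: alg_mor_comp coalg_mor_comp)
next
  fix X Y f
  assume "X \<in> {(B, m, u, d, e). bialgebra M B m u d e}" "Y \<in> {(B, m, u, d, e). bialgebra M B m u d e}"
    "is_iso M f" "bialg_mor M X f Y"
  then show "bialg_mor M Y (inv_arr M f) X"
    by (auto simp: bialgebra_def bialg_mor_def intro: alg_mor_inv_arr coalg_mor_inv_arr)
qed

text \<open>The rewrite to \<open>Bialg M\<close> lets the simplification rules for structured
  categories apply to it without unfolding its definition.\<close>

sublocale Bialg: structure_on M "{(B, m, u, d, e). bialgebra M B m u d e}" "bialg_mor M"
  rewrites "structured_cat M {(B, m, u, d, e). bialgebra M B m u d e} (bialg_mor M) = Bialg M"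
  by (rule structure_on_Bialg) (simp add: Bialg_altdef)

end

section \<open>Morphisms of braided objects and of braided bialgebras\<close>

context monoidal_category
begin

lemma br_mor_ident: "braided_object M V c \<Longrightarrow> br_mor M (V, c) (ident M V) (V, c)"
  by (auto simp: br_mor_def braided_object_def)

lemma br_mor_comp:
  assumes "braided_object M V c" "braided_object M V' c'" "braided_object M V'' c''"
    and f: "br_mor M (V, c) f (V', c')" and g: "br_mor M (V', c') g (V'', c'')"
  shows "br_mor M (V, c) (g \<cdot> f) (V'', c'')"
proof -
  have t [simp]: "c \<in> Hom M (V \<otimes>\<^sub>o V) (V \<otimes>\<^sub>o V)" "c' \<in> Hom M (V' \<otimes>\<^sub>o V') (V' \<otimes>\<^sub>o V')"
    "c'' \<in> Hom M (V'' \<otimes>\<^sub>o V'') (V'' \<otimes>\<^sub>o V'')" "f \<in> Hom M V V'" "g \<in> Hom M V' V''"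
    using assms by (auto simp: br_mor_def braided_object_def)
  have "c'' \<cdot> ((g \<cdot> f) \<otimes>\<^sub>a (g \<cdot> f)) = (c'' \<cdot> (g \<otimes>\<^sub>a g)) \<cdot> (f \<otimes>\<^sub>a f)"
    using t by (simp add: interchange)
  also have "\<dots> = (g \<otimes>\<^sub>a g) \<cdot> (c' \<cdot> (f \<otimes>\<^sub>a f))"
    using t g by (simp add: br_mor_def)
  also have "\<dots> = ((g \<cdot> f) \<otimes>\<^sub>a (g \<cdot> f)) \<cdot> c"
    using t f by (simp add: br_mor_def interchange_assoc)
  finally show ?thesis using t by (simp add: br_mor_def)
qed

lemma br_mor_inv_arr:
  assumes "braided_object M V c" "braided_object M V' c'"
    and f: "br_mor M (V, c) f (V', c')" and iso: "is_iso M f"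
  shows "br_mor M (V', c') (inv_arr M f) (V, c)"
proof -
  have t [simp]: "c \<in> Arr M" "Dom M c = V \<otimes>\<^sub>o V" "Cod M c = V \<otimes>\<^sub>o V"
    "c' \<in> Arr M" "Dom M c' = V' \<otimes>\<^sub>o V'" "Cod M c' = V' \<otimes>\<^sub>o V'"
    "f \<in> Arr M" "Dom M f = V" "Cod M f = V'" "V \<in> Obj M" "V' \<in> Obj M" "is_iso M f"
    using assms by (auto simp: br_mor_def braided_object_def)
  let ?g = "inv_arr M f"
  have "c \<cdot> (?g \<otimes>\<^sub>a ?g) = (?g \<otimes>\<^sub>a ?g) \<cdot> ((f \<otimes>\<^sub>a f) \<cdot> c) \<cdot> (?g \<otimes>\<^sub>a ?g)"
    by (simp add: interchange_assoc)
  also have "(f \<otimes>\<^sub>a f) \<cdot> c = c' \<cdot> (f \<otimes>\<^sub>a f)"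
    using f by (simp add: br_mor_def)
  also have "(?g \<otimes>\<^sub>a ?g) \<cdot> (c' \<cdot> (f \<otimes>\<^sub>a f)) \<cdot> (?g \<otimes>\<^sub>a ?g) = (?g \<otimes>\<^sub>a ?g) \<cdot> c'"
    by (simp add: interchange)
  finally show ?thesis by (simp add: br_mor_def)
qed

lemma structure_on_Br: "structure_on M {(V, c). braided_object M V c} (br_mor M)"
  by unfold_locales
    (auto simp: br_mor_ident intro: br_mor_comp br_mor_inv_arr, simp add: braided_object_def)

lemma structure_on_BrBialg:
  "structure_on M {(B, m, u, d, e, c). braided_bialgebra M B m u d e c}
     (\<lambda>(B, m, u, d, e, c) f (B', m', u', d', e', c').
        alg_mor M (B, m, u) f (B', m', u') \<and> coalg_mor M (B, d, e) f (B', d', e') \<and>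
        br_mor M (B, c) f (B', c'))"
  (is "structure_on M ?S ?H")
proof -
  have S: "algebra M B m u \<and> coalgebra M B d e \<and> braided_object M B c"
    if "braided_bialgebra M B m u d e c" for B m u d e c
    using that by (simp add: braided_bialgebra_def)
  show ?thesis
  proof unfold_locales
    fix X assume "X \<in> ?S"
    then show "fst X \<in> Obj M" "?H X (ident M (fst X)) X"
      by (auto dest!: S dest: algebra_typing simp: alg_mor_ident coalg_mor_ident br_mor_ident)
  next
    fix X Y Z f g
    assume "X \<in> ?S" "Y \<in> ?S" "Z \<in> ?S" "?H X f Y" "?H Y g Z"
    then show "?H X (g \<cdot> f) Z"
      by (auto dest!: S intro: alg_mor_comp coalg_mor_comp br_mor_comp)
  next
    fix X Y f
    assume "X \<in> ?S" "Y \<in> ?S" "is_iso M f" "?H X f Y"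
    then show "?H Y (inv_arr M f) X"
      by (auto dest!: S intro: alg_mor_inv_arr coalg_mor_inv_arr br_mor_inv_arr)
  qed
qed

end

section \<open>The functors into braided objects, braided bialgebras and algebras\<close>

context braided_monoidal_category
begin

lemma cfunctor_J: "cfunctor M (Br M) (J M)"
proof -
  interpret Br: structure_on M "{(V, c). braided_object M V c}" "br_mor M"
    rewrites "structured_cat M {(V, c). braided_object M V c} (br_mor M) = Br M"
    by (rule structure_on_Br) (simp add: Br_def)
  interpret BrC: category "Br M" by (rule Br.category_structured)
  show ?thesis
    by unfold_locales (auto simp: J_def braided_object_braid intro!: br_mor_braid)
qed

lemma cfunctor_J_Bialg: "cfunctor (Bialg M) (BrBialg M) (J_Bialg M)"
proof -
  \<comment> \<open>\<open>J_Bialg\<close> fixes underlying objects and arrows, so it is an instance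
    of the criterion for functors lying over the identity functor of M.\<close>
  have "cfunctor (Bialg M) (BrBialg M)
    (acting (\<lambda>(B, m, u, d, e). (B, m, u, d, e, braid M B B)) (amap (id_fctr :: ('o, 'a, 'o, 'a) fctr)))"
    unfolding Bialg_altdef BrBialg_def
    by (rule cfunctor_acting[OF structure_on_Bialg structure_on_BrBialg
          cfunctor_id_fctr[OF category_axioms]])
      (auto simp: id_fctr_def braided_bialgebra_braid bialg_mor_def intro!: br_mor_braid)
  then show ?thesis by (simp add: J_Bialg_def id_fctr_def)
qed

lemma cfunctor_forget_to_Alg: "cfunctor (Bialg M) (Alg M) forget_to_Alg"
proof -
  have "cfunctor (Bialg M) (Alg M) (acting (\<lambda>(B, m, u, d, e). (B, m, u)) (amap (id_fctr :: ('o, 'a, 'o, 'a) fctr)))"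
    unfolding Bialg_altdef Alg_def
    by (rule cfunctor_acting[OF structure_on_Bialg structure_on_Alg
          cfunctor_id_fctr[OF category_axioms]])
      (auto simp: id_fctr_def bialgebra_def bialg_mor_def)
  then show ?thesis by (simp add: forget_to_Alg_def id_fctr_def)
qed

lemma cfunctor_forget_Bialg: "cfunctor (Bialg M) M forget_Bialg"
proof -
  interpret BC: category "Bialg M" by (rule Bialg.category_structured)
  show ?thesis
    by unfold_locales (auto simp: forget_Bialg_def bialgebra_def dest: algebra_typing)
qed

end

section \<open>Transfer of bialgebras and their morphisms along coverings\<close>

context braided_monoidal_functor
begin

definition bialg_covers :: "'o \<times> 'b \<Rightarrow> ('p, 'b) bialg \<Rightarrow> ('o, 'a) bialg \<Rightarrow> bool" where
  "bialg_covers p = (\<lambda>(B', m', u', d', e') (B, m, u, d, e).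
     over p B' B \<and> covers (p \<boxtimes> p) m' p m \<and> covers unit_frame u' p u \<and>
     covers p d' (p \<boxtimes> p) d \<and> covers p e' unit_frame e)"

text \<open>Each axiom equates two arrows built from structure maps, constraints and the braiding.
  Both sides are covered along the same pair of frames, so the axioms are transferred one at a
  time.\<close>

lemma bialgebra_covers:
  assumes "bialg_covers p (B', m', u', d', e') (B, m, u, d, e)"
  shows "(bialgebra M B m u d e \<longrightarrow> bialgebra M' B' m' u' d' e') \<and>
    (faithful_functor M F \<longrightarrow> bialgebra M' B' m' u' d' e' \<longrightarrow> bialgebra M B m u d e)"
proof -
  have o: "over p B' B" and c: "covers (p \<boxtimes> p) m' p m" "covers unit_frame u' p u"
     "covers p d' (p \<boxtimes> p) d" "covers p e' unit_frame e"
    using assms by (auto simp: bialg_covers_def)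
  note o2 = over_fuse[OF o o]
  have t: "B \<in> Obj M" "B' \<in> Obj M'"
    "m \<in> Hom M (B \<otimes>\<^sub>o\<^bsub>M\<^esub> B) B" "m' \<in> Hom M' (B' \<otimes>\<^sub>o\<^bsub>M'\<^esub> B') B'"
    "u \<in> Hom M \<I>\<^bsub>M\<^esub> B" "u' \<in> Hom M' \<I>\<^bsub>M'\<^esub> B'"
    "d \<in> Hom M B (B \<otimes>\<^sub>o\<^bsub>M\<^esub> B)" "d' \<in> Hom M' B' (B' \<otimes>\<^sub>o\<^bsub>M'\<^esub> B')"
    "e \<in> Hom M B \<I>\<^bsub>M\<^esub>" "e' \<in> Hom M' B' \<I>\<^bsub>M'\<^esub>"
    using o over_Obj covers_typing[OF c(1) o2 o] covers_typing[OF c(2) over_unit o]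
      covers_typing[OF c(3) o o2] covers_typing[OF c(4) o over_unit] by blast+
  note rules = covers_rules covers_braid o c
  have "(m \<cdot>\<^bsub>M\<^esub> (m \<lhd>\<^bsub>M\<^esub> B) = m \<cdot>\<^bsub>M\<^esub> (B \<rhd>\<^bsub>M\<^esub> m) \<cdot>\<^bsub>M\<^esub> ass M B B B \<longrightarrow>
      m' \<cdot>\<^bsub>M'\<^esub> (m' \<lhd>\<^bsub>M'\<^esub> B') = m' \<cdot>\<^bsub>M'\<^esub> (B' \<rhd>\<^bsub>M'\<^esub> m') \<cdot>\<^bsub>M'\<^esub> ass M' B' B' B') \<and>
    (faithful_functor M F \<longrightarrow>
      m' \<cdot>\<^bsub>M'\<^esub> (m' \<lhd>\<^bsub>M'\<^esub> B') = m' \<cdot>\<^bsub>M'\<^esub> (B' \<rhd>\<^bsub>M'\<^esub> m') \<cdot>\<^bsub>M'\<^esub> ass M' B' B' B' \<longrightarrow>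
      m \<cdot>\<^bsub>M\<^esub> (m \<lhd>\<^bsub>M\<^esub> B) = m \<cdot>\<^bsub>M\<^esub> (B \<rhd>\<^bsub>M\<^esub> m) \<cdot>\<^bsub>M\<^esub> ass M B B B)"
    by (rule covers_eq_transfer) (rule rules)+
  moreover have "(m \<cdot>\<^bsub>M\<^esub> (u \<lhd>\<^bsub>M\<^esub> B) = lun M B \<longrightarrow> m' \<cdot>\<^bsub>M'\<^esub> (u' \<lhd>\<^bsub>M'\<^esub> B') = lun M' B') \<and>
    (faithful_functor M F \<longrightarrow> m' \<cdot>\<^bsub>M'\<^esub> (u' \<lhd>\<^bsub>M'\<^esub> B') = lun M' B' \<longrightarrow>
      m \<cdot>\<^bsub>M\<^esub> (u \<lhd>\<^bsub>M\<^esub> B) = lun M B)"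
    by (rule covers_eq_transfer) (rule rules)+
  moreover have "(m \<cdot>\<^bsub>M\<^esub> (B \<rhd>\<^bsub>M\<^esub> u) = run M B \<longrightarrow> m' \<cdot>\<^bsub>M'\<^esub> (B' \<rhd>\<^bsub>M'\<^esub> u') = run M' B') \<and>
    (faithful_functor M F \<longrightarrow> m' \<cdot>\<^bsub>M'\<^esub> (B' \<rhd>\<^bsub>M'\<^esub> u') = run M' B' \<longrightarrow>
      m \<cdot>\<^bsub>M\<^esub> (B \<rhd>\<^bsub>M\<^esub> u) = run M B)"
    by (rule covers_eq_transfer) (rule rules)+
  moreover have "(ass M B B B \<cdot>\<^bsub>M\<^esub> (d \<lhd>\<^bsub>M\<^esub> B) \<cdot>\<^bsub>M\<^esub> d = (B \<rhd>\<^bsub>M\<^esub> d) \<cdot>\<^bsub>M\<^esub> d \<longrightarrow>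
      ass M' B' B' B' \<cdot>\<^bsub>M'\<^esub> (d' \<lhd>\<^bsub>M'\<^esub> B') \<cdot>\<^bsub>M'\<^esub> d' = (B' \<rhd>\<^bsub>M'\<^esub> d') \<cdot>\<^bsub>M'\<^esub> d') \<and>
    (faithful_functor M F \<longrightarrow>
      ass M' B' B' B' \<cdot>\<^bsub>M'\<^esub> (d' \<lhd>\<^bsub>M'\<^esub> B') \<cdot>\<^bsub>M'\<^esub> d' = (B' \<rhd>\<^bsub>M'\<^esub> d') \<cdot>\<^bsub>M'\<^esub> d' \<longrightarrow>
      ass M B B B \<cdot>\<^bsub>M\<^esub> (d \<lhd>\<^bsub>M\<^esub> B) \<cdot>\<^bsub>M\<^esub> d = (B \<rhd>\<^bsub>M\<^esub> d) \<cdot>\<^bsub>M\<^esub> d)"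
    by (rule covers_eq_transfer) (rule rules)+
  moreover have "(lun M B \<cdot>\<^bsub>M\<^esub> (e \<lhd>\<^bsub>M\<^esub> B) \<cdot>\<^bsub>M\<^esub> d = ident M B \<longrightarrow>
      lun M' B' \<cdot>\<^bsub>M'\<^esub> (e' \<lhd>\<^bsub>M'\<^esub> B') \<cdot>\<^bsub>M'\<^esub> d' = ident M' B') \<and>
    (faithful_functor M F \<longrightarrow>
      lun M' B' \<cdot>\<^bsub>M'\<^esub> (e' \<lhd>\<^bsub>M'\<^esub> B') \<cdot>\<^bsub>M'\<^esub> d' = ident M' B' \<longrightarrow>
      lun M B \<cdot>\<^bsub>M\<^esub> (e \<lhd>\<^bsub>M\<^esub> B) \<cdot>\<^bsub>M\<^esub> d = ident M B)"
    by (rule covers_eq_transfer) (rule rules)+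
  moreover have "(run M B \<cdot>\<^bsub>M\<^esub> (B \<rhd>\<^bsub>M\<^esub> e) \<cdot>\<^bsub>M\<^esub> d = ident M B \<longrightarrow>
      run M' B' \<cdot>\<^bsub>M'\<^esub> (B' \<rhd>\<^bsub>M'\<^esub> e') \<cdot>\<^bsub>M'\<^esub> d' = ident M' B') \<and>
    (faithful_functor M F \<longrightarrow>
      run M' B' \<cdot>\<^bsub>M'\<^esub> (B' \<rhd>\<^bsub>M'\<^esub> e') \<cdot>\<^bsub>M'\<^esub> d' = ident M' B' \<longrightarrow>
      run M B \<cdot>\<^bsub>M\<^esub> (B \<rhd>\<^bsub>M\<^esub> e) \<cdot>\<^bsub>M\<^esub> d = ident M B)"
    by (rule covers_eq_transfer) (rule rules)+
  \<comment> \<open>The only axiom that contains the braiding, so the one place where F has to be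
    braided. Unfolding \<open>middle\<close> exposes the associators and the braiding to the
    covering rules.\<close>
  moreover have "(d \<cdot>\<^bsub>M\<^esub> m = ((m \<otimes>\<^sub>a\<^bsub>M\<^esub> m) \<cdot>\<^bsub>M\<^esub> middle M B (braid M B B)) \<cdot>\<^bsub>M\<^esub> (d \<otimes>\<^sub>a\<^bsub>M\<^esub> d) \<longrightarrow>
      d' \<cdot>\<^bsub>M'\<^esub> m' = ((m' \<otimes>\<^sub>a\<^bsub>M'\<^esub> m') \<cdot>\<^bsub>M'\<^esub> middle M' B' (braid M' B' B')) \<cdot>\<^bsub>M'\<^esub> (d' \<otimes>\<^sub>a\<^bsub>M'\<^esub> d')) \<and>
    (faithful_functor M F \<longrightarrow>
      d' \<cdot>\<^bsub>M'\<^esub> m' = ((m' \<otimes>\<^sub>a\<^bsub>M'\<^esub> m') \<cdot>\<^bsub>M'\<^esub> middle M' B' (braid M' B' B')) \<cdot>\<^bsub>M'\<^esub> (d' \<otimes>\<^sub>a\<^bsub>M'\<^esub> d') \<longrightarrow>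
      d \<cdot>\<^bsub>M\<^esub> m = ((m \<otimes>\<^sub>a\<^bsub>M\<^esub> m) \<cdot>\<^bsub>M\<^esub> middle M B (braid M B B)) \<cdot>\<^bsub>M\<^esub> (d \<otimes>\<^sub>a\<^bsub>M\<^esub> d))"
    unfolding middle_def by (rule covers_eq_transfer) (rule rules)+
  moreover have "(d \<cdot>\<^bsub>M\<^esub> u = (u \<otimes>\<^sub>a\<^bsub>M\<^esub> u) \<cdot>\<^bsub>M\<^esub> inv_arr M (lun M \<I>\<^bsub>M\<^esub>) \<longrightarrow>
      d' \<cdot>\<^bsub>M'\<^esub> u' = (u' \<otimes>\<^sub>a\<^bsub>M'\<^esub> u') \<cdot>\<^bsub>M'\<^esub> inv_arr M' (lun M' \<I>\<^bsub>M'\<^esub>)) \<and>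
    (faithful_functor M F \<longrightarrow>
      d' \<cdot>\<^bsub>M'\<^esub> u' = (u' \<otimes>\<^sub>a\<^bsub>M'\<^esub> u') \<cdot>\<^bsub>M'\<^esub> inv_arr M' (lun M' \<I>\<^bsub>M'\<^esub>) \<longrightarrow>
      d \<cdot>\<^bsub>M\<^esub> u = (u \<otimes>\<^sub>a\<^bsub>M\<^esub> u) \<cdot>\<^bsub>M\<^esub> inv_arr M (lun M \<I>\<^bsub>M\<^esub>))"
    by (rule covers_eq_transfer) (rule rules)+
  moreover have "(e \<cdot>\<^bsub>M\<^esub> m = lun M \<I>\<^bsub>M\<^esub> \<cdot>\<^bsub>M\<^esub> (e \<otimes>\<^sub>a\<^bsub>M\<^esub> e) \<longrightarrow>
      e' \<cdot>\<^bsub>M'\<^esub> m' = lun M' \<I>\<^bsub>M'\<^esub> \<cdot>\<^bsub>M'\<^esub> (e' \<otimes>\<^sub>a\<^bsub>M'\<^esub> e')) \<and>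
    (faithful_functor M F \<longrightarrow>
      e' \<cdot>\<^bsub>M'\<^esub> m' = lun M' \<I>\<^bsub>M'\<^esub> \<cdot>\<^bsub>M'\<^esub> (e' \<otimes>\<^sub>a\<^bsub>M'\<^esub> e') \<longrightarrow>
      e \<cdot>\<^bsub>M\<^esub> m = lun M \<I>\<^bsub>M\<^esub> \<cdot>\<^bsub>M\<^esub> (e \<otimes>\<^sub>a\<^bsub>M\<^esub> e))"
    by (rule covers_eq_transfer) (rule rules)+
  moreover have "(e \<cdot>\<^bsub>M\<^esub> u = ident M \<I>\<^bsub>M\<^esub> \<longrightarrow> e' \<cdot>\<^bsub>M'\<^esub> u' = ident M' \<I>\<^bsub>M'\<^esub>) \<and>
    (faithful_functor M F \<longrightarrow> e' \<cdot>\<^bsub>M'\<^esub> u' = ident M' \<I>\<^bsub>M'\<^esub> \<longrightarrow> e \<cdot>\<^bsub>M\<^esub> u = ident M \<I>\<^bsub>M\<^esub>)"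
    by (rule covers_eq_transfer) (rule rules)+
  ultimately show ?thesis
    using t unfolding bialgebra_def algebra_def coalgebra_def alg_mor_def unit_algebra_def
      tensor_square_algebra_def prod.case by blast
qed

text \<open>The two bialgebras may sit over different frames: this allows source and target to be
  compared when one lies over an arbitrary frame and the other over an image frame.\<close>

lemma bialg_mor_covers:
  assumes X: "bialg_covers p (B', m\<^sub>B', u\<^sub>B', d\<^sub>B', e\<^sub>B') (B, m\<^sub>B, u\<^sub>B, d\<^sub>B, e\<^sub>B)"
    and Y: "bialg_covers q (C', m\<^sub>C', u\<^sub>C', d\<^sub>C', e\<^sub>C') (C, m\<^sub>C, u\<^sub>C, d\<^sub>C, e\<^sub>C)"
    and f: "covers p f' q f"
  shows "(bialg_mor M (B, m\<^sub>B, u\<^sub>B, d\<^sub>B, e\<^sub>B) f (C, m\<^sub>C, u\<^sub>C, d\<^sub>C, e\<^sub>C) \<longrightarrow>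
      bialg_mor M' (B', m\<^sub>B', u\<^sub>B', d\<^sub>B', e\<^sub>B') f' (C', m\<^sub>C', u\<^sub>C', d\<^sub>C', e\<^sub>C')) \<and>
    (faithful_functor M F \<longrightarrow>
      bialg_mor M' (B', m\<^sub>B', u\<^sub>B', d\<^sub>B', e\<^sub>B') f' (C', m\<^sub>C', u\<^sub>C', d\<^sub>C', e\<^sub>C') \<longrightarrow>
      bialg_mor M (B, m\<^sub>B, u\<^sub>B, d\<^sub>B, e\<^sub>B) f (C, m\<^sub>C, u\<^sub>C, d\<^sub>C, e\<^sub>C))"
proof -
  have o: "over p B' B" "over q C' C"
    and c: "covers (p \<boxtimes> p) m\<^sub>B' p m\<^sub>B" "covers unit_frame u\<^sub>B' p u\<^sub>B"
     "covers p d\<^sub>B' (p \<boxtimes> p) d\<^sub>B" "covers p e\<^sub>B' unit_frame e\<^sub>B"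
     "covers (q \<boxtimes> q) m\<^sub>C' q m\<^sub>C" "covers unit_frame u\<^sub>C' q u\<^sub>C"
     "covers q d\<^sub>C' (q \<boxtimes> q) d\<^sub>C" "covers q e\<^sub>C' unit_frame e\<^sub>C"
    using X Y by (auto simp: bialg_covers_def)
  note t = covers_typing[OF f o] and rules = covers_rules o c f
  have "(f \<cdot>\<^bsub>M\<^esub> m\<^sub>B = m\<^sub>C \<cdot>\<^bsub>M\<^esub> (f \<otimes>\<^sub>a\<^bsub>M\<^esub> f) \<longrightarrow> f' \<cdot>\<^bsub>M'\<^esub> m\<^sub>B' = m\<^sub>C' \<cdot>\<^bsub>M'\<^esub> (f' \<otimes>\<^sub>a\<^bsub>M'\<^esub> f')) \<and>
    (faithful_functor M F \<longrightarrow> f' \<cdot>\<^bsub>M'\<^esub> m\<^sub>B' = m\<^sub>C' \<cdot>\<^bsub>M'\<^esub> (f' \<otimes>\<^sub>a\<^bsub>M'\<^esub> f') \<longrightarrow>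
      f \<cdot>\<^bsub>M\<^esub> m\<^sub>B = m\<^sub>C \<cdot>\<^bsub>M\<^esub> (f \<otimes>\<^sub>a\<^bsub>M\<^esub> f))"
    by (rule covers_eq_transfer) (rule rules)+
  moreover have "(f \<cdot>\<^bsub>M\<^esub> u\<^sub>B = u\<^sub>C \<longrightarrow> f' \<cdot>\<^bsub>M'\<^esub> u\<^sub>B' = u\<^sub>C') \<and>
    (faithful_functor M F \<longrightarrow> f' \<cdot>\<^bsub>M'\<^esub> u\<^sub>B' = u\<^sub>C' \<longrightarrow> f \<cdot>\<^bsub>M\<^esub> u\<^sub>B = u\<^sub>C)"
    by (rule covers_eq_transfer) (rule rules)+
  moreover have "(d\<^sub>C \<cdot>\<^bsub>M\<^esub> f = (f \<otimes>\<^sub>a\<^bsub>M\<^esub> f) \<cdot>\<^bsub>M\<^esub> d\<^sub>B \<longrightarrow> d\<^sub>C' \<cdot>\<^bsub>M'\<^esub> f' = (f' \<otimes>\<^sub>a\<^bsub>M'\<^esub> f') \<cdot>\<^bsub>M'\<^esub> d\<^sub>B') \<and>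
    (faithful_functor M F \<longrightarrow> d\<^sub>C' \<cdot>\<^bsub>M'\<^esub> f' = (f' \<otimes>\<^sub>a\<^bsub>M'\<^esub> f') \<cdot>\<^bsub>M'\<^esub> d\<^sub>B' \<longrightarrow>
      d\<^sub>C \<cdot>\<^bsub>M\<^esub> f = (f \<otimes>\<^sub>a\<^bsub>M\<^esub> f) \<cdot>\<^bsub>M\<^esub> d\<^sub>B)"
    by (rule covers_eq_transfer) (rule rules)+
  moreover have "(e\<^sub>C \<cdot>\<^bsub>M\<^esub> f = e\<^sub>B \<longrightarrow> e\<^sub>C' \<cdot>\<^bsub>M'\<^esub> f' = e\<^sub>B') \<and>
    (faithful_functor M F \<longrightarrow> e\<^sub>C' \<cdot>\<^bsub>M'\<^esub> f' = e\<^sub>B' \<longrightarrow> e\<^sub>C \<cdot>\<^bsub>M\<^esub> f = e\<^sub>B)"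
    by (rule covers_eq_transfer) (rule rules)+
  ultimately show ?thesis
    using t unfolding bialg_mor_def alg_mor_def coalg_mor_def prod.case by blast
qed

end

section \<open>The functor induced on bialgebras\<close>

context braided_monoidal_functor
begin

abbreviation BF ::
    "(('o, 'a) bialg, (('o, 'a) bialg, 'a) smor, ('p, 'b) bialg, (('p, 'b) bialg, 'b) smor) fctr"
  where "BF \<equiv> BialgF M' F \<phi>0 \<phi>2"

lemma omap_BialgF:
  "omap BF (B, m, u, d, e)
    = (omap F B, mult_F M' F \<phi>2 B m, unit_F M' F \<phi>0 u, comult_F M' F \<phi>2 B d, counit_F M' F \<phi>0 e)"
  by (simp add: BialgF_def acting_def)

lemma amap_BialgF: "amap BF (X, f, Y) = (omap BF X, amap F f, omap BF Y)"
  by (simp add: BialgF_def acting_def)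

lemma fst_omap_BialgF: "fst (omap BF X) = omap F (fst X)"
  by (cases X) (simp add: omap_BialgF)

text \<open>The image frame of B is an identity, the induced frame on \<open>B \<otimes> B\<close>
  is \<open>\<phi>2 B B\<close>, and the unit frame is \<open>\<phi>0\<close>. Solving the covering
  equations for these frames gives precisely the formulas for the structure maps of FB.\<close>

lemma bialg_covers_BialgF:
  assumes t: "B \<in> Obj M" "m \<in> Hom M (B \<otimes>\<^sub>o\<^bsub>M\<^esub> B) B" "u \<in> Hom M \<I>\<^bsub>M\<^esub> B"
    "d \<in> Hom M B (B \<otimes>\<^sub>o\<^bsub>M\<^esub> B)" "e \<in> Hom M B \<I>\<^bsub>M\<^esub>"
  shows "bialg_covers (image_frame B) (omap BF (B, m, u, d, e)) (B, m, u, d, e)"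
proof -
  let ?p = "image_frame B"
  note o = over_image[OF t(1)]
  note o2 = over_fuse[OF o o]
  have [simp]: "snd ?p = ident M' (omap F B)" "snd (?p \<boxtimes> ?p) = \<phi>2 B B" "snd unit_frame = \<phi>0"
    using t(1) snd_image_frame_fuse by (simp_all add: image_frame_def unit_frame_def)
  show ?thesis
    unfolding bialg_covers_def omap_BialgF prod.case
    by (intro conjI o coversI[OF o2 o] coversI[OF over_unit o] coversI[OF o o2] coversI[OF o over_unit])
      (use t in \<open>simp_all add: mult_F_def unit_F_def comult_F_def counit_F_def\<close>)
qed

lemma bialg_covers_omap:
  assumes "X \<in> Obj (Bialg M)"
  shows "bialg_covers (image_frame (fst X)) (omap BF X) X"
  using assms bialg_covers_BialgF[OF M.bialgebra_typing] by auto

lemma Obj_Bialg_transfer: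
  assumes "bialg_covers p Y X"
  shows "X \<in> Obj (Bialg M) \<Longrightarrow> Y \<in> Obj (Bialg M')"
    "\<lbrakk>faithful_functor M F; Y \<in> Obj (Bialg M')\<rbrakk> \<Longrightarrow> X \<in> Obj (Bialg M)"
proof -
  obtain B m u d e B' m' u' d' e' where XY: "X = (B, m, u, d, e)" "Y = (B', m', u', d', e')"
    by (cases X, cases Y)
  note * = bialgebra_covers[OF assms[unfolded XY]]
  show "X \<in> Obj (Bialg M) \<Longrightarrow> Y \<in> Obj (Bialg M')"
    "\<lbrakk>faithful_functor M F; Y \<in> Obj (Bialg M')\<rbrakk> \<Longrightarrow> X \<in> Obj (Bialg M)"
    using * by (simp_all add: XY)
qed

lemma bialg_mor_transfer:
  assumes X: "bialg_covers p X' X" and Y: "bialg_covers q Y' Y" and f: "covers p f' q f"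
  shows "bialg_mor M X f Y \<Longrightarrow> bialg_mor M' X' f' Y'"
    "\<lbrakk>faithful_functor M F; bialg_mor M' X' f' Y'\<rbrakk> \<Longrightarrow> bialg_mor M X f Y"
proof -
  obtain B m u d e B' m' u' d' e' where X_eq: "X = (B, m, u, d, e)" "X' = (B', m', u', d', e')"
    by (cases X, cases X')
  obtain C n v c a C' n' v' c' a' where Y_eq: "Y = (C, n, v, c, a)" "Y' = (C', n', v', c', a')"
    by (cases Y, cases Y')
  note * = bialg_mor_covers[OF X[unfolded X_eq] Y[unfolded Y_eq] f]
  show "bialg_mor M X f Y \<Longrightarrow> bialg_mor M' X' f' Y'"
    "\<lbrakk>faithful_functor M F; bialg_mor M' X' f' Y'\<rbrakk> \<Longrightarrow> bialg_mor M X f Y"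
    using * by (simp_all add: X_eq Y_eq)
qed

lemma cfunctor_BialgF: "cfunctor (Bialg M) (Bialg M') BF"
proof -
  have "cfunctor (Bialg M) (Bialg M') (acting (omap BF) (amap F))"
    unfolding Bialg_altdef
  proof (rule cfunctor_acting[OF M.structure_on_Bialg M'.structure_on_Bialg cfunctor_axioms])
    fix X assume "X \<in> {(B, m, u, d, e). bialgebra M B m u d e}"
    then have X: "X \<in> Obj (Bialg M)" by simp
    have "omap BF X \<in> Obj (Bialg M')" by (rule Obj_Bialg_transfer(1)[OF bialg_covers_omap[OF X] X])
    then show "omap BF X \<in> {(B, m, u, d, e). bialgebra M' B m u d e} \<and>
        fst (omap BF X) = omap F (fst X)"
      by (simp add: fst_omap_BialgF)
  next
    fix X f Y
    assume "X \<in> {(B, m, u, d, e). bialgebra M B m u d e}"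
      "Y \<in> {(B, m, u, d, e). bialgebra M B m u d e}"
      and f: "f \<in> Hom M (fst X) (fst Y)" "bialg_mor M X f Y"
    then have X: "X \<in> Obj (Bialg M)" and Y: "Y \<in> Obj (Bialg M)" by simp_all
    show "bialg_mor M' (omap BF X) (amap F f) (omap BF Y)"
      by (rule bialg_mor_transfer(1)[OF bialg_covers_omap[OF X] bialg_covers_omap[OF Y]
            covers_image[OF f(1)] f(2)])
  qed
  moreover have "acting (omap BF) (amap F) = BF" by (simp add: BialgF_def acting_def)
  ultimately show ?thesis by simp
qed

sublocale BF: cfunctor "Bialg M" "Bialg M'" BF
  by (fact cfunctor_BialgF)

section \<open>Equivalence, isomorphism and conservativity of the induced functor\<close>

lemma faithful_BialgF: "faithful_functor M F \<Longrightarrow> faithful_functor (Bialg M) BF"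
  by (auto simp: faithful_functor_def amap_BialgF)

text \<open>Fullness of F lifts the underlying arrow; faithfulness is what reflects the equations
  saying that the lift is a bialgebra morphism.\<close>

lemma full_BialgF:
  assumes full: "full_functor M M' F" and faithful: "faithful_functor M F"
  shows "full_functor (Bialg M) (Bialg M') BF"
  unfolding full_functor_def
proof (intro ballI subsetI)
  fix X Y h assume X: "X \<in> Obj (Bialg M)" and Y: "Y \<in> Obj (Bialg M)"
    and h: "h \<in> Hom (Bialg M') (omap BF X) (omap BF Y)"
  obtain h\<^sub>0 where h0: "h = (omap BF X, h\<^sub>0, omap BF Y)" using h by (cases h) auto
  then have h0_mor: "h\<^sub>0 \<in> Hom M' (omap F (fst X)) (omap F (fst Y))"
      "bialg_mor M' (omap BF X) h\<^sub>0 (omap BF Y)"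
    using h by (auto simp: fst_omap_BialgF)
  have "fst X \<in> Obj M" "fst Y \<in> Obj M" using X Y by auto
  then have "h\<^sub>0 \<in> amap F ` Hom M (fst X) (fst Y)"
    using full h0_mor(1) unfolding full_functor_def by (simp only: subset_iff)
  then obtain f where f: "f \<in> Hom M (fst X) (fst Y)" "h\<^sub>0 = amap F f" by blast
  then have "(X, f, Y) \<in> Hom (Bialg M) X Y"
    using bialg_mor_transfer(2)[OF bialg_covers_omap[OF X] bialg_covers_omap[OF Y]
        covers_image[OF f(1)] faithful] h0_mor X Y by simp
  moreover have "amap BF (X, f, Y) = h" using h0 f by (simp add: amap_BialgF)
  ultimately show "h \<in> amap BF ` Hom (Bialg M) X Y" by (metis image_eqI)
qed

text \<open>Fullness lifts the four structure maps independently along the frame. That the lifts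
  satisfy the bialgebra axioms is then reflected from M' by faithfulness.\<close>

lemma bialgebra_lift:
  assumes full: "full_functor M M' F" and faithful: "faithful_functor M F"
    and Y: "Y \<in> Obj (Bialg M')" and o: "over p (fst Y) B"
  obtains X where "X \<in> Obj (Bialg M)" "fst X = B" "bialg_covers p Y X"
proof -
  obtain B' m' u' d' e' where Y_eq: "Y = (B', m', u', d', e')" by (cases Y)
  have "bialgebra M' B' m' u' d' e'" using Y by (simp add: Y_eq)
  note t = M'.bialgebra_typing(2-5)[OF this]
  have o: "over p B' B" using o by (simp add: Y_eq)
  note o2 = over_fuse[OF o o]
  obtain m where "covers (p \<boxtimes> p) m' p m" by (rule covers_lift[OF full o2 o t(1)])
  moreover obtain u where "covers unit_frame u' p u" by (rule covers_lift[OF full over_unit o t(2)])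
  moreover obtain d where "covers p d' (p \<boxtimes> p) d" by (rule covers_lift[OF full o o2 t(3)])
  moreover obtain e where "covers p e' unit_frame e" by (rule covers_lift[OF full o over_unit t(4)])
  ultimately have c: "bialg_covers p Y (B, m, u, d, e)" using o by (simp add: bialg_covers_def Y_eq)
  show thesis
    by (rule that[OF Obj_Bialg_transfer(2)[OF c faithful Y] _ c]) simp
qed

lemma essentially_surjective_BialgF:
  assumes full: "full_functor M M' F" and faithful: "faithful_functor M F"
    and es: "essentially_surjective M M' F"
  shows "essentially_surjective (Bialg M) (Bialg M') BF"
  unfolding essentially_surjective_def
proof
  fix Y assume Y: "Y \<in> Obj (Bialg M')"
  then have "fst Y \<in> Obj M'" by auto
  then obtain B a where B: "B \<in> Obj M" and a: "a \<in> Hom M' (fst Y) (omap F B)" "is_iso M' a"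
    using es unfolding essentially_surjective_def by blast
  then have o: "over (B, a) (fst Y) B" by (simp add: over_def)
  obtain X where X: "X \<in> Obj (Bialg M)" "fst X = B" and c: "bialg_covers (B, a) Y X"
    using bialgebra_lift[OF full faithful Y o] by blast
  \<comment> \<open>The isomorphism of the frame, viewed as an arrow into F B, covers the identity
    of B. Since this identity is a bialgebra morphism, transfer shows that \<open>a\<close> is a
    bialgebra morphism from Y to the image of X.\<close>
  have "covers (B, a) a (image_frame B) (ident M B)"
    by (rule coversI[OF o over_image[OF B]]) (use a B in \<open>simp_all add: image_frame_def\<close>)
  moreover have "bialg_mor M X (ident M B) X" using M.Bialg.H_ident[of X] X by auto
  ultimately have mor: "bialg_mor M' Y a (omap BF X)"
    using bialg_mor_transfer(1)[OF c bialg_covers_omap[OF X(1)]] X(2) by simp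
  let ?s = "(Y, a, omap BF X)"
  have "?s \<in> Hom (Bialg M') Y (omap BF X)"
    using Y X a mor BF.omap_Obj[OF X(1)] by (simp add: fst_omap_BialgF)
  moreover from this have "is_iso (Bialg M') ?s" using a by (simp add: M'.Bialg.is_iso_structured)
  ultimately show "\<exists>X \<in> Obj (Bialg M). \<exists>s \<in> Hom (Bialg M') Y (omap BF X). is_iso (Bialg M') s"
    using X(1) by blast
qed

text \<open>Over a fixed frame a faithful F determines every covered arrow. Injectivity of Bialg F
  on objects is thereby reduced to injectivity of F on the carriers.\<close>

lemma bialg_covers_unique:
  assumes "faithful_functor M F" "bialg_covers p Y X" "bialg_covers p Y Z"
  shows "X = Z"
proof -
  obtain B m u d e C m' u' d' e' where [simp]: "X = (B, m, u, d, e)" "Z = (C, m', u', d', e')"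
    by (cases X, cases Z)
  show ?thesis
    using assms covers_eq_transfer[of "p \<boxtimes> p" _ p m _ m'] covers_eq_transfer[of unit_frame _ p u _ u']
      covers_eq_transfer[of p _ "p \<boxtimes> p" d _ d'] covers_eq_transfer[of p _ unit_frame e _ e']
    by (cases Y) (auto simp: bialg_covers_def over_def)
qed

text \<open>A covering arrow is determined by the arrow it covers. Lifting along an image frame
  therefore yields a preimage on the nose, not merely up to isomorphism.\<close>

lemma bialg_covers_image_frame:
  assumes "bialg_covers (image_frame B) Y X" "X \<in> Obj (Bialg M)"
  shows "Y = omap BF X"
proof -
  obtain m u d e B' m' u' d' e' where [simp]: "X = (B, m, u, d, e)" "Y = (B', m', u', d', e')"
    using assms by (cases X, cases Y) (auto simp: bialg_covers_def over_def image_frame_def)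
  have "bialg_covers (image_frame B) (omap BF X) X" using bialg_covers_omap[OF assms(2)] by simp
  then show ?thesis
    using assms covers_eq_transfer[of "image_frame B \<boxtimes> image_frame B" m' "image_frame B" m _ m]
      covers_eq_transfer[of unit_frame u' "image_frame B" u _ u]
      covers_eq_transfer[of "image_frame B" d' "image_frame B \<boxtimes> image_frame B" d _ d]
      covers_eq_transfer[of "image_frame B" e' unit_frame e _ e]
    by (auto simp: bialg_covers_def over_def omap_BialgF)
qed

text \<open>Surjectivity uses that every carrier in M' equals some F B, so that a bialgebra on it
  can be lifted along the image frame of B.\<close>

lemma bij_betw_BialgF:
  assumes full: "full_functor M M' F" and faithful: "faithful_functor M F"
    and bij: "bij_betw (omap F) (Obj M) (Obj M')"
  shows "bij_betw (omap BF) (Obj (Bialg M)) (Obj (Bialg M'))"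
  unfolding bij_betw_def
proof
  show "inj_on (omap BF) (Obj (Bialg M))"
  proof (rule inj_onI)
    fix X Z assume X: "X \<in> Obj (Bialg M)" and Z: "Z \<in> Obj (Bialg M)" and eq: "omap BF X = omap BF Z"
    have "omap F (fst X) = omap F (fst Z)" using eq by (metis fst_omap_BialgF)
    moreover have "fst X \<in> Obj M" "fst Z \<in> Obj M" using X Z by auto
    ultimately have "fst X = fst Z" using bij by (auto simp: bij_betw_def dest: inj_onD)
    then show "X = Z"
      using bialg_covers_unique[OF faithful bialg_covers_omap[OF X]] bialg_covers_omap[OF Z] eq by simp
  qed
  show "omap BF ` Obj (Bialg M) = Obj (Bialg M')"
  proof (intro equalityI subsetI)
    fix Y assume Y: "Y \<in> Obj (Bialg M')"
    then have "fst Y \<in> Obj M'" by auto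
    then obtain B where B: "B \<in> Obj M" "fst Y = omap F B" using bij by (auto simp: bij_betw_def)
    then have o: "over (image_frame B) (fst Y) B" using over_image by simp
    obtain X where "X \<in> Obj (Bialg M)" "bialg_covers (image_frame B) Y X"
      using bialgebra_lift[OF full faithful Y o] by blast
    then show "Y \<in> omap BF ` Obj (Bialg M)" using bialg_covers_image_frame by blast
  qed (use BF.omap_Obj in blast)
qed

lemma equivalence_BialgF:
  "equivalence_functor M M' F \<Longrightarrow> equivalence_functor (Bialg M) (Bialg M') BF"
  by (intro BF.equivalence_functorI full_BialgF faithful_BialgF essentially_surjective_BialgF)
    (auto dest: equivalence_functorD)

lemma isomorphism_BialgF:
  "isomorphism_functor M M' F \<Longrightarrow> isomorphism_functor (Bialg M) (Bialg M') BF"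
  by (intro BF.isomorphism_functorI full_BialgF faithful_BialgF bij_betw_BialgF)
    (auto dest: isomorphism_functorD)

lemma conservative_BialgF:
  assumes "conservative_functor M M' F"
  shows "conservative_functor (Bialg M) (Bialg M') BF"
  unfolding conservative_functor_def
proof (intro conjI ballI impI cfunctor_BialgF)
  fix g assume g: "g \<in> Arr (Bialg M)" and iso: "is_iso (Bialg M') (amap BF g)"
  obtain X f Y where [simp]: "g = (X, f, Y)" by (cases g)
  have "is_iso M' (amap F f)" using iso by (simp add: amap_BialgF M'.Bialg.is_iso_structured)
  then have "is_iso M f" using assms g by (simp add: conservative_functor_def)
  then show "is_iso (Bialg M) g" using g by (simp add: M.Bialg.is_iso_structured)
qed

section \<open>The three equalities of functors\<close>

text \<open>This is \<open>phi2_braid\<close> solved for the braiding of M'. It makes the composites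
  with J and \<open>J_Bialg\<close> agree on objects strictly.\<close>

lemma braiding_F_braid:
  "V \<in> Obj M \<Longrightarrow> braiding_F M' F \<phi>2 V (braid M V V) = braid M' (omap F V) (omap F V)"
  by (simp add: braiding_F_def phi2_braid)

lemma functor_eq_J: "functor_eq M (Br M') (J M' \<circ>\<^sub>F F) (BrF M' F \<phi>2 \<circ>\<^sub>F J M)"
  by (rule functor_eqI[OF cfunctor_comp_fctr[OF cfunctor_axioms M'.cfunctor_J]])
    (auto simp: comp_fctr_def J_def BrF_def acting_def braiding_F_braid)

lemma functor_eq_J_Bialg:
  "functor_eq (Bialg M) (BrBialg M') (J_Bialg M' \<circ>\<^sub>F BF) (BrBialgF M' F \<phi>0 \<phi>2 \<circ>\<^sub>F J_Bialg M)"
  by (rule functor_eqI[OF cfunctor_comp_fctr[OF cfunctor_BialgF M'.cfunctor_J_Bialg]])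
    (auto simp: comp_fctr_def J_Bialg_def BrBialgF_def BialgF_def acting_def braiding_F_braid
      dest: M.bialgebra_typing(1))

lemma functor_eq_forget_to_Alg:
  "functor_eq (Bialg M) (Alg M') (forget_to_Alg \<circ>\<^sub>F BF) (AlgF M' F \<phi>0 \<phi>2 \<circ>\<^sub>F forget_to_Alg)"
  by (rule functor_eqI[OF cfunctor_comp_fctr[OF cfunctor_BialgF M'.cfunctor_forget_to_Alg]])
    (auto simp: comp_fctr_def forget_to_Alg_def AlgF_def BialgF_def acting_def)

end

section \<open>Primitive elements\<close>

context category
begin

lemma equalizer_typing:
  assumes "is_equalizer C f g e"
  shows "f \<in> Arr C" "g \<in> Arr C" "e \<in> Arr C" "Dom C g = Dom C f" "Cod C g = Cod C f"
    "Cod C e = Dom C f" "f \<cdot> e = g \<cdot> e"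
  using assms by (auto simp: is_equalizer_def)

lemma equalizer_mono:
  assumes e: "is_equalizer C f g e" and h: "h \<in> Hom C X (Dom C e)" and k: "k \<in> Hom C X (Dom C e)"
    and eq: "e \<cdot> h = e \<cdot> k"
  shows "h = k"
proof -
  note t = equalizer_typing[OF e]
  have "f \<cdot> (e \<cdot> h) = (f \<cdot> e) \<cdot> h" using t(1-6) h by simp
  also have "\<dots> = g \<cdot> (e \<cdot> h)" using t(1-6) h by (simp add: t(7))
  finally have "f \<cdot> (e \<cdot> h) = g \<cdot> (e \<cdot> h)" .
  then have "\<exists>!l. l \<in> Hom C (Dom C (e \<cdot> h)) (Dom C e) \<and> e \<cdot> l = e \<cdot> h"
  proof -
    have "e \<cdot> h \<in> Arr C" "Cod C (e \<cdot> h) = Dom C f" using t(1-6) h by simp_all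
    then show ?thesis using e \<open>f \<cdot> (e \<cdot> h) = g \<cdot> (e \<cdot> h)\<close> unfolding is_equalizer_def by blast
  qed
  moreover have "Dom C (e \<cdot> h) = X" using t(1-6) h by simp
  ultimately show ?thesis using h k eq by metis
qed

lemma equalizer_factor:
  assumes e: "is_equalizer C f g e" and h: "h \<in> Hom C X (Dom C f)" "f \<cdot> h = g \<cdot> h"
  obtains k where "k \<in> Hom C X (Dom C e)" "e \<cdot> k = h"
proof -
  have "h \<in> Arr C" "Cod C h = Dom C f" and X: "Dom C h = X" using h by simp_all
  then have "\<exists>!k. k \<in> Hom C (Dom C h) (Dom C e) \<and> e \<cdot> k = h"
    using e h(2) unfolding is_equalizer_def by blast
  then show thesis using that unfolding X by blast
qed

lemma equalizers_iso:
  assumes e: "is_equalizer C f g e" and e': "is_equalizer C f g e'"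
  obtains \<theta> where "\<theta> \<in> Hom C (Dom C e') (Dom C e)" "is_iso C \<theta>" "e \<cdot> \<theta> = e'"
proof -
  note t = equalizer_typing(1-6)[OF e] and t' = equalizer_typing(1-6)[OF e']
  obtain \<theta> where \<theta>: "\<theta> \<in> Hom C (Dom C e') (Dom C e)" "e \<cdot> \<theta> = e'"
    by (rule equalizer_factor[OF e, of e' "Dom C e'"]) (use t' equalizer_typing(7)[OF e'] in simp_all)
  obtain \<psi> where \<psi>: "\<psi> \<in> Hom C (Dom C e) (Dom C e')" "e' \<cdot> \<psi> = e"
    by (rule equalizer_factor[OF e', of e "Dom C e"]) (use t equalizer_typing(7)[OF e] in simp_all)
  have "\<psi> \<cdot> \<theta> = ident C (Dom C e')"
  proof (rule equalizer_mono[OF e'])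
    have "e' \<cdot> (\<psi> \<cdot> \<theta>) = (e' \<cdot> \<psi>) \<cdot> \<theta>" using \<theta>(1) \<psi>(1) t t' by simp
    then show "e' \<cdot> (\<psi> \<cdot> \<theta>) = e' \<cdot> ident C (Dom C e')" using t' by (simp only: \<theta>(2) \<psi>(2)) simp
  qed (use \<theta>(1) \<psi>(1) t t' in simp_all)
  moreover have "\<theta> \<cdot> \<psi> = ident C (Dom C e)"
  proof (rule equalizer_mono[OF e])
    have "e \<cdot> (\<theta> \<cdot> \<psi>) = (e \<cdot> \<theta>) \<cdot> \<psi>" using \<theta>(1) \<psi>(1) t t' by simp
    then show "e \<cdot> (\<theta> \<cdot> \<psi>) = e \<cdot> ident C (Dom C e)" using t by (simp only: \<theta>(2) \<psi>(2)) simp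
  qed (use \<theta>(1) \<psi>(1) t t' in simp_all)
  ultimately have "is_iso C \<theta>" using is_isoI[OF \<theta>(1) \<psi>(1)] by simp
  then show thesis using that \<theta> by blast
qed

text \<open>The invertible \<open>k\<close> can be cancelled on the left, so the pairs before and
  after composition are equalized by the same arrows.\<close>

lemma is_equalizer_post_iso:
  assumes e: "is_equalizer C f g e" and k: "is_iso C k" "Dom C k = Cod C f"
  shows "is_equalizer C (k \<cdot> f) (k \<cdot> g) e"
proof -
  note t [simp] = equalizer_typing(1-6)[OF e] is_iso_Arr[OF k(1)] k
  have iff: "(k \<cdot> f) \<cdot> h = (k \<cdot> g) \<cdot> h \<longleftrightarrow> f \<cdot> h = g \<cdot> h" if h: "h \<in> Arr C" "Cod C h = Dom C f" for h
  proof
    assume "(k \<cdot> f) \<cdot> h = (k \<cdot> g) \<cdot> h"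
    then have "k \<cdot> (f \<cdot> h) = k \<cdot> (g \<cdot> h)" using h by simp
    then show "f \<cdot> h = g \<cdot> h" by (rule iso_cancel_left) (use h in simp_all)
  next
    assume eq: "f \<cdot> h = g \<cdot> h"
    have "(k \<cdot> f) \<cdot> h = k \<cdot> (f \<cdot> h)" using h by simp
    also have "\<dots> = (k \<cdot> g) \<cdot> h" using h by (simp add: eq)
    finally show "(k \<cdot> f) \<cdot> h = (k \<cdot> g) \<cdot> h" .
  qed
  show ?thesis
    unfolding is_equalizer_def
  proof (intro conjI ballI impI)
    show "(k \<cdot> f) \<cdot> e = (k \<cdot> g) \<cdot> e" using iff[of e] equalizer_typing(7)[OF e] by simp
    fix h assume h: "h \<in> Arr C" and "Cod C h = Dom C (k \<cdot> f) \<and> (k \<cdot> f) \<cdot> h = (k \<cdot> g) \<cdot> h"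
    then have "Cod C h = Dom C f \<and> f \<cdot> h = g \<cdot> h" using iff[of h] by (simp del: comp_assoc_simp)
    then show "\<exists>!l. l \<in> Hom C (Dom C h) (Dom C e) \<and> e \<cdot> l = h"
      using e h unfolding is_equalizer_def by blast
  qed simp_all
qed

end

lemma natural_transformation_whisker:
  assumes "cfunctor C D F" "natural_transformation D E G H \<tau>"
  shows "natural_transformation C E (G \<circ>\<^sub>F F) (H \<circ>\<^sub>F F) (\<tau> \<circ> omap F)"
proof -
  interpret F: cfunctor C D F by fact
  interpret \<tau>: natural_transformation D E G H \<tau> by fact
  interpret GF: cfunctor C E "G \<circ>\<^sub>F F" by (rule cfunctor_comp_fctr) unfold_locales
  interpret HF: cfunctor C E "H \<circ>\<^sub>F F" by (rule cfunctor_comp_fctr) unfold_locales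
  show ?thesis
  proof unfold_locales
    fix f X Y assume f: "f \<in> Hom C X Y"
    show "(\<tau> \<circ> omap F) Y \<cdot>\<^bsub>E\<^esub> amap (G \<circ>\<^sub>F F) f = amap (H \<circ>\<^sub>F F) f \<cdot>\<^bsub>E\<^esub> (\<tau> \<circ> omap F) X"
      using \<tau>.naturality[OF F.amap_Hom[OF f]] by (simp add: comp_fctr_def)
  qed (use \<tau>.component_Hom in \<open>simp add: comp_fctr_def\<close>)
qed

lemma nat_eqI:
  assumes "natural_transformation C D G H \<sigma>" and eq: "\<And>X. X \<in> Obj C \<Longrightarrow> \<sigma> X = \<tau> X"
  shows "nat_eq C D G H \<sigma> \<tau>"
proof -
  interpret \<sigma>: natural_transformation C D G H \<sigma> by fact
  have "natural_transformation C D G H \<tau>"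
    by unfold_locales (use \<sigma>.component_Hom \<sigma>.naturality \<sigma>.F.C.Obj_Dom \<sigma>.F.C.Obj_Cod in
      \<open>auto simp flip: eq\<close>)
  then show ?thesis using assms by (simp add: nat_eq_def)
qed

section \<open>The functor of primitives\<close>

lemma (in preadditive_category) add_Hom:
  assumes "f \<in> Hom C X Y" "g \<in> Hom C X Y"
  shows "add f g \<in> Hom C X Y"
proof -
  have "X \<in> Obj C" "Y \<in> Obj C" using assms by auto
  then obtain z where "comm_group \<lparr>carrier = Hom C X Y, monoid.mult = add, one = z\<rparr>"
    using Hom_comm_group by blast
  then interpret G: comm_group "\<lparr>carrier = Hom C X Y, monoid.mult = add, one = z\<rparr>" .
  show ?thesis using G.m_closed[of f g] assms by simp
qed

text \<open>For modules this is the map b |-> b \<open>\<otimes>\<close> 1 + 1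
  \<open>\<otimes>\<close> b, so its equalizer with the comultiplication consists of the primitive
  elements.\<close>

definition prim_sum ::
    "('o, 'a, 'z) moncat_scheme \<Rightarrow> ('a \<Rightarrow> 'a \<Rightarrow> 'a) \<Rightarrow> 'o \<Rightarrow> 'a \<Rightarrow> 'a" where
  "prim_sum M add B u = add ((B \<rhd>\<^bsub>M\<^esub> u) \<cdot>\<^bsub>M\<^esub> inv_arr M (run M B)) ((u \<lhd>\<^bsub>M\<^esub> B) \<cdot>\<^bsub>M\<^esub> inv_arr M (lun M B))"

lemma is_primitive_equalizer_iff:
  "is_primitive_equalizer M add (B, m, u, d, e) x \<longleftrightarrow> is_equalizer M d (prim_sum M add B u) x"
  by (simp add: is_primitive_equalizer_def prim_sum_def)

context preadditive_with_equalizers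
begin

lemma prim_sum_Hom:
  assumes "B \<in> Obj M" "u \<in> Hom M \<I> B"
  shows "prim_sum M add B u \<in> Hom M B (B \<otimes>\<^sub>o B)"
  unfolding prim_sum_def by (rule add_Hom) (use assms in simp_all)

text \<open>Each summand is natural because the unit constraints are, and composition distributes
  over the sum on both sides. For a bialgebra morphism f, the arrow \<open>f \<cdot> u\<close> is
  the unit of the target.\<close>

lemma prim_sum_natural:
  assumes u: "u \<in> Hom M \<I> B" and f: "f \<in> Hom M B B'"
  shows "prim_sum M add B' (f \<cdot> u) \<cdot> f = (f \<otimes>\<^sub>a f) \<cdot> prim_sum M add B u"
proof -
  have [simp]: "u \<in> Arr M" "Dom M u = \<I>" "Cod M u = B" "f \<in> Arr M" "Dom M f = B" "Cod M f = B'"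
    "B \<in> Obj M" "B' \<in> Obj M"
    using u f by auto
  have run: "inv_arr M (run M B') \<cdot> f = (f \<lhd> \<I>) \<cdot> inv_arr M (run M B)"
  proof (rule iso_cancel_left)
    have "run M B' \<cdot> ((f \<lhd> \<I>) \<cdot> inv_arr M (run M B)) = (run M B' \<cdot> (f \<lhd> \<I>)) \<cdot> inv_arr M (run M B)"
      by simp
    also have "\<dots> = f" using run_natural_arr[of f] by simp
    finally show "run M B' \<cdot> (inv_arr M (run M B') \<cdot> f) = run M B' \<cdot> ((f \<lhd> \<I>) \<cdot> inv_arr M (run M B))"
      by simp
  qed simp_all
  have lun: "inv_arr M (lun M B') \<cdot> f = (\<I> \<rhd> f) \<cdot> inv_arr M (lun M B)"
  proof (rule iso_cancel_left)
    have "lun M B' \<cdot> ((\<I> \<rhd> f) \<cdot> inv_arr M (lun M B)) = (lun M B' \<cdot> (\<I> \<rhd> f)) \<cdot> inv_arr M (lun M B)"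
      by simp
    also have "\<dots> = f" using lun_natural_arr[of f] by simp
    finally show "lun M B' \<cdot> (inv_arr M (lun M B') \<cdot> f) = lun M B' \<cdot> ((\<I> \<rhd> f) \<cdot> inv_arr M (lun M B))"
      by simp
  qed simp_all
  show ?thesis
    unfolding prim_sum_def
    by (subst comp_add_left[of _ B B'], simp_all)
      (subst comp_add_right[of _ B "B \<otimes>\<^sub>o B"], simp_all add: run lun interchange_assoc)
qed

text \<open>Supplies the values of a choice on bialgebras outside the image of Bialg F.\<close>

lemma primitive_equalizer_exists:
  assumes "X \<in> Obj (Bialg M)"
  shows "\<exists>x. is_primitive_equalizer M add X x"
proof -
  obtain B m u d e where X: "X = (B, m, u, d, e)" by (cases X)
  have b: "bialgebra M B m u d e" using assms by (simp add: X)
  note t = bialgebra_typing[OF b]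
  have "B \<otimes>\<^sub>o B \<in> Obj M" using t by simp
  then show ?thesis
    using equalizers t(1,4) prim_sum_Hom[OF t(1,3)]
    unfolding X is_primitive_equalizer_iff has_equalizers_def by blast
qed

text \<open>Compatibility of f with the comultiplications and with \<open>prim_sum\<close> shows
  that \<open>f \<cdot> x\<close> equalizes the pair of the target. This justifies the definite
  description in \<open>prim\<close>.\<close>

lemma bialg_mor_restricts_to_primitives:
  assumes X: "X \<in> Obj (Bialg M)" and Y: "Y \<in> Obj (Bialg M)" and f: "(X, f, Y) \<in> Arr (Bialg M)"
    and x: "is_primitive_equalizer M add X x" and y: "is_primitive_equalizer M add Y y"
  shows "\<exists>!g. g \<in> Hom M (Dom M x) (Dom M y) \<and> y \<cdot> g = f \<cdot> x"
proof -
  obtain B m u d e C n v c a where XY: "X = (B, m, u, d, e)" "Y = (C, n, v, c, a)"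
    by (cases X, cases Y)
  have b: "bialgebra M B m u d e" "bialgebra M C n v c a" using X Y by (simp_all add: XY)
  note t = bialgebra_typing[OF b(1)] bialgebra_typing[OF b(2)]
  have f': "f \<in> Hom M B C" "f \<cdot> u = v" "c \<cdot> f = (f \<otimes>\<^sub>a f) \<cdot> d"
    using f by (auto simp: XY bialg_mor_def alg_mor_def coalg_mor_def)
  have x': "is_equalizer M d (prim_sum M add B u) x" and y': "is_equalizer M c (prim_sum M add C v) y"
    using x y by (simp_all add: XY is_primitive_equalizer_iff)
  note tx = equalizer_typing[OF x'] and ty = equalizer_typing[OF y']
  have s: "prim_sum M add C v \<cdot> f = (f \<otimes>\<^sub>a f) \<cdot> prim_sum M add B u"
    using prim_sum_natural[OF t(3) f'(1)] f'(2) by simp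
  have "c \<cdot> (f \<cdot> x) = (c \<cdot> f) \<cdot> x" using t f'(1) tx by simp
  also have "\<dots> = (f \<otimes>\<^sub>a f) \<cdot> (d \<cdot> x)" using t f'(1) tx(1-6) by (simp add: f'(3))
  also have "\<dots> = (prim_sum M add C v \<cdot> f) \<cdot> x"
    using t f'(1) tx(1-6) prim_sum_Hom[OF t(1,3)] by (simp add: tx(7) s)
  also have "\<dots> = prim_sum M add C v \<cdot> (f \<cdot> x)"
    using t f'(1) tx(1-6) prim_sum_Hom[OF t(6,8)] by simp
  finally have eq: "c \<cdot> (f \<cdot> x) = prim_sum M add C v \<cdot> (f \<cdot> x)" .
  have fx: "f \<cdot> x \<in> Hom M (Dom M x) (Dom M c)" using f'(1) tx t by simp
  obtain g where "g \<in> Hom M (Dom M x) (Dom M y)" "y \<cdot> g = f \<cdot> x"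
    using equalizer_factor[OF y' fx eq] by blast
  then show ?thesis using equalizer_mono[OF y'] by metis
qed

context
  fixes \<xi> assumes \<xi>: "primitive_choice M add \<xi>"
begin

lemma primitive_choiceD: "X \<in> Obj (Bialg M) \<Longrightarrow> is_primitive_equalizer M add X (\<xi> X)"
  using \<xi> unfolding primitive_choice_def by blast

lemma xi_Hom: "X \<in> Obj (Bialg M) \<Longrightarrow> \<xi> X \<in> Hom M (Dom M (\<xi> X)) (fst X)"
  using primitive_choiceD[of X] bialgebra_typing(4) equalizer_typing[of _ _ "\<xi> X"]
  by (cases X) (auto simp: is_primitive_equalizer_iff)

lemma xi_mono:
  "\<lbrakk>X \<in> Obj (Bialg M); g \<in> Hom M Z (Dom M (\<xi> X)); h \<in> Hom M Z (Dom M (\<xi> X)); \<xi> X \<cdot> g = \<xi> X \<cdot> h\<rbrakk>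
    \<Longrightarrow> g = h"
  using primitive_choiceD[of X] equalizer_mono[of _ _ "\<xi> X"]
  by (cases X) (auto simp: is_primitive_equalizer_iff)

lemma prim_amap:
  assumes "(X, f, Y) \<in> Arr (Bialg M)"
  shows "amap (prim M \<xi>) (X, f, Y) \<in> Hom M (Dom M (\<xi> X)) (Dom M (\<xi> Y))"
    "\<xi> Y \<cdot> amap (prim M \<xi>) (X, f, Y) = f \<cdot> \<xi> X"
proof -
  have XY: "X \<in> Obj (Bialg M)" "Y \<in> Obj (Bialg M)" using assms by auto
  show "amap (prim M \<xi>) (X, f, Y) \<in> Hom M (Dom M (\<xi> X)) (Dom M (\<xi> Y))"
    "\<xi> Y \<cdot> amap (prim M \<xi>) (X, f, Y) = f \<cdot> \<xi> X"
    using theI'[OF bialg_mor_restricts_to_primitives[OF XY assms primitive_choiceD[OF XY(1)] primitive_choiceD[OF XY(2)]]]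
    by (simp_all add: prim_def)
qed

text \<open>An equalizer is monic, so the defining square determines the restricted arrow.
  Functoriality of P, and later its comparison with F, are obtained by exhibiting an arrow that fits
  this square.\<close>

lemma prim_amap_eqI:
  assumes f: "(X, f, Y) \<in> Arr (Bialg M)" and g: "g \<in> Hom M (Dom M (\<xi> X)) (Dom M (\<xi> Y))"
    "\<xi> Y \<cdot> g = f \<cdot> \<xi> X"
  shows "amap (prim M \<xi>) (X, f, Y) = g"
  by (rule xi_mono[of Y]) (use f g prim_amap[OF f] in auto)

lemma omap_prim: "omap (prim M \<xi>) X = Dom M (\<xi> X)"
  by (simp add: prim_def)

lemma cfunctor_prim: "cfunctor (Bialg M) M (prim M \<xi>)"
proof -
  interpret BC: category "Bialg M" by (rule Bialg.category_structured)
  show ?thesis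
  proof unfold_locales
    fix X assume "X \<in> Obj (Bialg M)"
    then show "omap (prim M \<xi>) X \<in> Obj M" using xi_Hom[of X] by (auto simp: omap_prim)
  next
    fix f X Y assume "f \<in> Hom (Bialg M) X Y"
    then show "amap (prim M \<xi>) f \<in> Hom M (omap (prim M \<xi>) X) (omap (prim M \<xi>) Y)"
      using prim_amap(1) by (cases f) (auto simp: omap_prim)
  next
    fix X assume X: "X \<in> Obj (Bialg M)"
    then have "(X, ident M (fst X), X) \<in> Arr (Bialg M)" using BC.ident_typing(1)[OF X] by simp
    then show "amap (prim M \<xi>) (ident (Bialg M) X) = ident M (omap (prim M \<xi>) X)"
      using xi_Hom[OF X] by (simp add: omap_prim prim_amap_eqI)
  next
    fix f X Y g Z assume f: "f \<in> Hom (Bialg M) X Y" and g: "g \<in> Hom (Bialg M) Y Z"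
    obtain f\<^sub>0 g\<^sub>0 where f0: "f = (X, f\<^sub>0, Y)" and g0: "g = (Y, g\<^sub>0, Z)"
      using f g by (cases f; cases g; simp)
    have f_Arr: "(X, f\<^sub>0, Y) \<in> Arr (Bialg M)" and g_Arr: "(Y, g\<^sub>0, Z) \<in> Arr (Bialg M)"
      using f g f0 g0 by simp_all
    note P = prim_amap[OF f_Arr] prim_amap[OF g_Arr]
    have XYZ: "X \<in> Obj (Bialg M)" "Y \<in> Obj (Bialg M)" "Z \<in> Obj (Bialg M)"
      and fg: "f\<^sub>0 \<in> Hom M (fst X) (fst Y)" "g\<^sub>0 \<in> Hom M (fst Y) (fst Z)"
      using f_Arr g_Arr by simp_all
    note xi = XYZ[THEN xi_Hom]
    have "\<xi> Z \<cdot> (amap (prim M \<xi>) g \<cdot> amap (prim M \<xi>) f) = (\<xi> Z \<cdot> amap (prim M \<xi>) g) \<cdot> amap (prim M \<xi>) f"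
      using P(1,3) xi by (simp add: f0 g0)
    also have "\<dots> = g\<^sub>0 \<cdot> (\<xi> Y \<cdot> amap (prim M \<xi>) f)"
      using P(1) xi fg by (simp add: f0 g0 P(4))
    also have "\<dots> = (g\<^sub>0 \<cdot> f\<^sub>0) \<cdot> \<xi> X"
      using xi fg by (simp add: f0 P(2))
    finally have eq: "\<xi> Z \<cdot> (amap (prim M \<xi>) g \<cdot> amap (prim M \<xi>) f) = (g\<^sub>0 \<cdot> f\<^sub>0) \<cdot> \<xi> X" .
    have "(X, g\<^sub>0 \<cdot> f\<^sub>0, Z) \<in> Arr (Bialg M)"
      using BC.comp_Hom[OF f g] by (simp add: f0 g0)
    then have "amap (prim M \<xi>) (X, g\<^sub>0 \<cdot> f\<^sub>0, Z) = amap (prim M \<xi>) g \<cdot> amap (prim M \<xi>) f"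
      using P(1,3) eq by (intro prim_amap_eqI) (simp_all add: f0 g0)
    then show "amap (prim M \<xi>) (g \<cdot>\<^bsub>Bialg M\<^esub> f) = amap (prim M \<xi>) g \<cdot> amap (prim M \<xi>) f"
      by (simp add: f0 g0)
  qed
qed

lemma natural_transformation_xi: "natural_transformation (Bialg M) M (prim M \<xi>) forget_Bialg \<xi>"
proof -
  interpret P: cfunctor "Bialg M" M "prim M \<xi>" by (rule cfunctor_prim)
  interpret U: cfunctor "Bialg M" M forget_Bialg by (rule cfunctor_forget_Bialg)
  show ?thesis
  proof unfold_locales
    fix X assume "X \<in> Obj (Bialg M)"
    then show "\<xi> X \<in> Hom M (omap (prim M \<xi>) X) (omap forget_Bialg X)"
      using xi_Hom by (simp add: omap_prim forget_Bialg_def)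
  next
    fix f X Y assume "f \<in> Hom (Bialg M) X Y"
    then show "\<xi> Y \<cdot> amap (prim M \<xi>) f = amap forget_Bialg f \<cdot> \<xi> X"
      using prim_amap(2) by (cases f) (auto simp: forget_Bialg_def)
  qed
qed

end

end

section \<open>Primitives of the image bialgebra\<close>

context braided_monoidal_functor
begin

text \<open>The two summands are covered along the image frame of B, which turns into composition
  with \<open>\<phi>2 B B\<close>. Additivity of composition in M' and of F then reassembles the
  sum.\<close>

lemma prim_sum_amap:
  assumes A: "preadditive_with_equalizers M add" and A': "preadditive_with_equalizers M' add'"
    and additive: "additive_functor M add M' add' F" and B: "B \<in> Obj M" and u: "u \<in> Hom M \<I>\<^bsub>M\<^esub> B"
  shows "\<phi>2 B B \<cdot>\<^bsub>M'\<^esub> prim_sum M' add' (omap F B) (unit_F M' F \<phi>0 u) = amap F (prim_sum M add B u)"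
proof -
  interpret A: preadditive_with_equalizers M add by fact
  interpret A': preadditive_with_equalizers M' add' by fact
  let ?p = "image_frame B" and ?u = "unit_F M' F \<phi>0 u"
  let ?r = "(B \<rhd>\<^bsub>M\<^esub> u) \<cdot>\<^bsub>M\<^esub> inv_arr M (run M B)" and ?l = "(u \<lhd>\<^bsub>M\<^esub> B) \<cdot>\<^bsub>M\<^esub> inv_arr M (lun M B)"
  let ?r' = "(omap F B \<rhd>\<^bsub>M'\<^esub> ?u) \<cdot>\<^bsub>M'\<^esub> inv_arr M' (run M' (omap F B))"
  let ?l' = "(?u \<lhd>\<^bsub>M'\<^esub> omap F B) \<cdot>\<^bsub>M'\<^esub> inv_arr M' (lun M' (omap F B))"
  note o = over_image[OF B]
  have cu: "covers unit_frame ?u ?p u"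
    by (rule coversI[OF over_unit o])
      (use u B in \<open>simp_all add: unit_F_def image_frame_def unit_frame_def\<close>)
  \<comment> \<open>Addition is not part of the covering calculus, so the summands are treated
    separately.\<close>
  have c: "covers ?p ?r' (?p \<boxtimes> ?p) ?r" "covers ?p ?l' (?p \<boxtimes> ?p) ?l"
    by (rule covers_rules o cu)+
  note r = covers_typing[OF c(1) o over_fuse[OF o o]] and l = covers_typing[OF c(2) o over_fuse[OF o o]]
  have "snd (?p \<boxtimes> ?p) \<cdot>\<^bsub>M'\<^esub> ?r' = amap F ?r \<cdot>\<^bsub>M'\<^esub> snd ?p"
    "snd (?p \<boxtimes> ?p) \<cdot>\<^bsub>M'\<^esub> ?l' = amap F ?l \<cdot>\<^bsub>M'\<^esub> snd ?p"
    using c unfolding covers_def by blast+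
  moreover have "amap F ?r \<cdot>\<^bsub>M'\<^esub> snd ?p = amap F ?r" "amap F ?l \<cdot>\<^bsub>M'\<^esub> snd ?p = amap F ?l"
    unfolding image_frame_def snd_conv
    by (rule M'.ident_right[OF amap_Hom[OF r(2)]], rule M'.ident_right[OF amap_Hom[OF l(2)]])
  ultimately have eq: "\<phi>2 B B \<cdot>\<^bsub>M'\<^esub> ?r' = amap F ?r" "\<phi>2 B B \<cdot>\<^bsub>M'\<^esub> ?l' = amap F ?l"
    by (simp_all only: snd_image_frame_fuse[OF B B])
  have "\<phi>2 B B \<cdot>\<^bsub>M'\<^esub> add' ?r' ?l' = add' (amap F ?r) (amap F ?l)"
    using A'.comp_add_right[OF r(1) l(1) phi2_Hom[OF B B]] by (simp only: eq)
  also have "\<dots> = amap F (add ?r ?l)"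
    using additive r(2) l(2) unfolding additive_functor_def by metis
  finally show ?thesis by (simp only: prim_sum_def)
qed

lemma primitive_equalizer_amap:
  assumes A: "preadditive_with_equalizers M add" and A': "preadditive_with_equalizers M' add'"
    and additive: "additive_functor M add M' add' F" and pres: "preserves_equalizers M M' F"
    and X: "X \<in> Obj (Bialg M)" and x: "is_primitive_equalizer M add X x"
  shows "is_primitive_equalizer M' add' (omap BF X) (amap F x)"
proof -
  interpret A: preadditive_with_equalizers M add by fact
  interpret A': preadditive_with_equalizers M' add' by fact
  obtain B m u d e where XB: "X = (B, m, u, d, e)" by (cases X)
  have "bialgebra M B m u d e" using X by (simp add: XB)
  note t = M.bialgebra_typing[OF this]
  let ?s = "prim_sum M add B u" and ?s' = "prim_sum M' add' (omap F B) (unit_F M' F \<phi>0 u)"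
  have "unit_F M' F \<phi>0 u \<in> Hom M' \<I>\<^bsub>M'\<^esub> (omap F B)" using t by (simp add: unit_F_def)
  then have "?s' \<in> Hom M' (omap F B) (omap F B \<otimes>\<^sub>o\<^bsub>M'\<^esub> omap F B)"
    using t by (intro A'.prim_sum_Hom) simp_all
  then have s': "inv_arr M' (\<phi>2 B B) \<cdot>\<^bsub>M'\<^esub> amap F ?s = ?s'"
    using t by (simp flip: prim_sum_amap[OF A A' additive t(1,3)])
  have "is_equalizer M' (amap F d) (amap F ?s) (amap F x)"
    using x pres by (simp add: XB is_primitive_equalizer_iff preserves_equalizers_def)
  then have "is_equalizer M' (inv_arr M' (\<phi>2 B B) \<cdot>\<^bsub>M'\<^esub> amap F d) (inv_arr M' (\<phi>2 B B) \<cdot>\<^bsub>M'\<^esub> amap F ?s)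
      (amap F x)"
    by (rule M'.is_equalizer_post_iso) (use t in simp_all)
  then show ?thesis
    by (simp only: XB omap_BialgF is_primitive_equalizer_iff s' comult_F_def)
qed

text \<open>For each Y the predicate to be witnessed quantifies over all X with image Y. The value
  picked for Y is therefore independent of any representative, and \<open>compat\<close> is what
  makes a witness exist when there are several.\<close>

lemma choose_image_equalizers:
  assumes A: "preadditive_with_equalizers M add" and A': "preadditive_with_equalizers M' add'"
    and additive: "additive_functor M add M' add' F" and pres: "preserves_equalizers M M' F"
    and \<xi>: "primitive_choice M add \<xi>"
    and compat: "\<forall>B \<in> Obj (Bialg M). \<forall>C \<in> Obj (Bialg M).
      omap BF B = omap BF C \<longrightarrow> amap F (\<xi> B) = amap F (\<xi> C)"
  obtains \<xi>' where "primitive_choice M' add' \<xi>'"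
    "\<And>X. X \<in> Obj (Bialg M) \<Longrightarrow> \<xi>' (omap BF X) = amap F (\<xi> X)"
proof -
  interpret A: preadditive_with_equalizers M add by fact
  interpret A': preadditive_with_equalizers M' add' by fact
  have "\<exists>x. is_primitive_equalizer M' add' Y x \<and>
      (\<forall>X \<in> Obj (Bialg M). omap BF X = Y \<longrightarrow> x = amap F (\<xi> X))"
    if Y: "Y \<in> Obj (Bialg M')" for Y
  proof (cases "\<exists>X \<in> Obj (Bialg M). omap BF X = Y")
    case True
    then obtain X where X: "X \<in> Obj (Bialg M)" "omap BF X = Y" by blast
    have "is_primitive_equalizer M' add' Y (amap F (\<xi> X))"
      using primitive_equalizer_amap[OF A A' additive pres X(1) A.primitive_choiceD[OF \<xi> X(1)]] X(2)
      by (simp only:)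
    moreover have "\<forall>Z \<in> Obj (Bialg M). omap BF Z = Y \<longrightarrow> amap F (\<xi> X) = amap F (\<xi> Z)"
      using compat X by blast
    ultimately show ?thesis by blast
  next
    case False
    then show ?thesis using A'.primitive_equalizer_exists[OF Y] by blast
  qed
  then obtain \<xi>' where "\<And>Y. Y \<in> Obj (Bialg M') \<Longrightarrow> is_primitive_equalizer M' add' Y (\<xi>' Y) \<and>
      (\<forall>X \<in> Obj (Bialg M). omap BF X = Y \<longrightarrow> \<xi>' Y = amap F (\<xi> X))"
    by metis
  then show thesis
    using that[of \<xi>'] BF.omap_Obj unfolding primitive_choice_def by blast
qed

text \<open>Applying F to the square that defines P f gives the square that characterises P' at the
  image of f, because \<open>\<xi>'\<close> is F \<open>\<xi>\<close> there; uniqueness yields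
  equality.\<close>

lemma prim_BialgF:
  assumes A: "preadditive_with_equalizers M add" and A': "preadditive_with_equalizers M' add'"
    and \<xi>: "primitive_choice M add \<xi>" and \<xi>': "primitive_choice M' add' \<xi>'"
    and eq: "\<And>X. X \<in> Obj (Bialg M) \<Longrightarrow> \<xi>' (omap BF X) = amap F (\<xi> X)"
  shows "functor_eq (Bialg M) M' (prim M' \<xi>' \<circ>\<^sub>F BF) (F \<circ>\<^sub>F prim M \<xi>)"
    and "nat_eq (Bialg M) M' (prim M' \<xi>' \<circ>\<^sub>F BF) (forget_Bialg \<circ>\<^sub>F BF)
      (\<xi>' \<circ> omap BF) (amap F \<circ> \<xi>)"
proof -
  interpret A: preadditive_with_equalizers M add by fact
  interpret A': preadditive_with_equalizers M' add' by fact
  note xi_t = A.xi_Hom[OF \<xi>]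
  show "functor_eq (Bialg M) M' (prim M' \<xi>' \<circ>\<^sub>F BF) (F \<circ>\<^sub>F prim M \<xi>)"
  proof (rule functor_eqI[OF cfunctor_comp_fctr[OF cfunctor_BialgF A'.cfunctor_prim[OF \<xi>']]])
    fix X assume X: "X \<in> Obj (Bialg M)"
    then show "omap (prim M' \<xi>' \<circ>\<^sub>F BF) X = omap (F \<circ>\<^sub>F prim M \<xi>) X"
      using xi_t[OF X] by (simp add: comp_fctr_def A.omap_prim[OF \<xi>] A'.omap_prim[OF \<xi>'] eq[OF X])
  next
    fix g assume g: "g \<in> Arr (Bialg M)"
    obtain X f Y where XfY: "g = (X, f, Y)" by (cases g)
    have XY: "X \<in> Obj (Bialg M)" "Y \<in> Obj (Bialg M)" and f: "f \<in> Hom M (fst X) (fst Y)"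
      using g by (simp_all add: XfY)
    note P = A.prim_amap[OF \<xi> g[unfolded XfY]]
    note xi = xi_t[OF XY(1)] xi_t[OF XY(2)]
    have "amap F (\<xi> Y) \<cdot>\<^bsub>M'\<^esub> amap F (amap (prim M \<xi>) g) = amap F (\<xi> Y \<cdot>\<^bsub>M\<^esub> amap (prim M \<xi>) g)"
      using P(1) xi by (simp add: XfY)
    also have "\<dots> = amap F f \<cdot>\<^bsub>M'\<^esub> amap F (\<xi> X)"
      using P(2) xi f by (simp add: XfY)
    finally have "amap F (\<xi> Y) \<cdot>\<^bsub>M'\<^esub> amap F (amap (prim M \<xi>) g) = amap F f \<cdot>\<^bsub>M'\<^esub> amap F (\<xi> X)" .
    moreover have "(omap BF X, amap F f, omap BF Y) \<in> Arr (Bialg M')"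
      using BF.amap_typing(1)[OF g] by (simp only: XfY amap_BialgF)
    ultimately have "amap (prim M' \<xi>') (omap BF X, amap F f, omap BF Y) = amap F (amap (prim M \<xi>) g)"
      using P(1) xi by (intro A'.prim_amap_eqI[OF \<xi>']) (simp_all add: eq[OF XY(1)] eq[OF XY(2)] XfY)
    then show "amap (prim M' \<xi>' \<circ>\<^sub>F BF) g = amap (F \<circ>\<^sub>F prim M \<xi>) g"
      by (simp add: comp_fctr_def XfY amap_BialgF)
  qed
  show "nat_eq (Bialg M) M' (prim M' \<xi>' \<circ>\<^sub>F BF) (forget_Bialg \<circ>\<^sub>F BF) (\<xi>' \<circ> omap BF) (amap F \<circ> \<xi>)"
    by (rule nat_eqI[OF natural_transformation_whisker[OF cfunctor_BialgF
            A'.natural_transformation_xi[OF \<xi>']]]) (simp add: eq)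
qed

text \<open>\<open>amap F (\<xi> X)\<close> and \<open>\<xi>'\<close> at the image of X equalize the
  same pair, and \<open>\<theta>\<close> X is the comparison isomorphism. Its naturality is verified
  after composing with F \<open>\<xi>\<close>, which is monic as an equalizer.\<close>

lemma prim_BialgF_natural_iso:
  assumes A: "preadditive_with_equalizers M add" and A': "preadditive_with_equalizers M' add'"
    and additive: "additive_functor M add M' add' F" and pres: "preserves_equalizers M M' F"
    and \<xi>: "primitive_choice M add \<xi>" and \<xi>': "primitive_choice M' add' \<xi>'"
  obtains \<theta> where "natural_iso (Bialg M) M' (prim M' \<xi>' \<circ>\<^sub>F BF) (F \<circ>\<^sub>F prim M \<xi>) \<theta>"
    "\<And>X. X \<in> Obj (Bialg M) \<Longrightarrow> amap F (\<xi> X) \<cdot>\<^bsub>M'\<^esub> \<theta> X = \<xi>' (omap BF X)"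
proof -
  interpret A: preadditive_with_equalizers M add by fact
  interpret A': preadditive_with_equalizers M' add' by fact
  have F\<xi>: "is_primitive_equalizer M' add' (omap BF X) (amap F (\<xi> X))"
    and \<xi>'_BF: "is_primitive_equalizer M' add' (omap BF X) (\<xi>' (omap BF X))"
    if X: "X \<in> Obj (Bialg M)" for X
    using primitive_equalizer_amap[OF A A' additive pres X A.primitive_choiceD[OF \<xi> X]]
      A'.primitive_choiceD[OF \<xi>' BF.omap_Obj[OF X]] by blast+
  have "\<exists>t. t \<in> Hom M' (Dom M' (\<xi>' (omap BF X))) (Dom M' (amap F (\<xi> X))) \<and> is_iso M' t \<and>
      amap F (\<xi> X) \<cdot>\<^bsub>M'\<^esub> t = \<xi>' (omap BF X)"
    if X: "X \<in> Obj (Bialg M)" for X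
  proof -
    obtain B m u d e where XB: "omap BF X = (B, m, u, d, e)" by (cases "omap BF X")
    show ?thesis
      using M'.equalizers_iso F\<xi>[OF X] \<xi>'_BF[OF X] unfolding XB is_primitive_equalizer_iff by metis
  qed
  then obtain \<theta> where \<theta>: "\<And>X. X \<in> Obj (Bialg M) \<Longrightarrow>
      \<theta> X \<in> Hom M' (Dom M' (\<xi>' (omap BF X))) (Dom M' (amap F (\<xi> X))) \<and> is_iso M' (\<theta> X) \<and>
      amap F (\<xi> X) \<cdot>\<^bsub>M'\<^esub> \<theta> X = \<xi>' (omap BF X)"
    by metis
  have P': "cfunctor (Bialg M) M' (prim M' \<xi>' \<circ>\<^sub>F BF)"
    by (rule cfunctor_comp_fctr[OF cfunctor_BialgF A'.cfunctor_prim[OF \<xi>']])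
  have P: "cfunctor (Bialg M) M' (F \<circ>\<^sub>F prim M \<xi>)"
    by (rule cfunctor_comp_fctr[OF A.cfunctor_prim[OF \<xi>] cfunctor_axioms])
  have "natural_iso (Bialg M) M' (prim M' \<xi>' \<circ>\<^sub>F BF) (F \<circ>\<^sub>F prim M \<xi>) \<theta>"
    unfolding natural_iso_def natural_transformation_def natural_transformation_axioms_def
  proof (intro conjI allI impI ballI P P')
    fix X assume X: "X \<in> Obj (Bialg M)"
    then show "\<theta> X \<in> Hom M' (omap (prim M' \<xi>' \<circ>\<^sub>F BF) X) (omap (F \<circ>\<^sub>F prim M \<xi>) X)"
      using \<theta>[OF X] A.xi_Hom[OF \<xi> X]
      by (simp add: comp_fctr_def A.omap_prim[OF \<xi>] A'.omap_prim[OF \<xi>'])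
    show "is_iso M' (\<theta> X)" using \<theta>[OF X] by blast
  next
    fix g X Y assume g': "g \<in> Hom (Bialg M) X Y"
    obtain f where XfY: "g = (X, f, Y)" using g' by (cases g) simp
    have g: "(X, f, Y) \<in> Arr (Bialg M)" using g' by (simp add: XfY)
    have XY: "X \<in> Obj (Bialg M)" "Y \<in> Obj (Bialg M)" and f: "f \<in> Hom M (fst X) (fst Y)"
      using g by simp_all
    have BFg: "(omap BF X, amap F f, omap BF Y) \<in> Arr (Bialg M')"
      using BF.amap_typing(1)[OF g] by (simp only: amap_BialgF)
    let ?Pg = "amap (prim M \<xi>) g" and ?Pg' = "amap (prim M' \<xi>') (amap BF g)"
    have Pg: "?Pg \<in> Hom M (Dom M (\<xi> X)) (Dom M (\<xi> Y))" "\<xi> Y \<cdot>\<^bsub>M\<^esub> ?Pg = f \<cdot>\<^bsub>M\<^esub> \<xi> X"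
      using A.prim_amap[OF \<xi> g] by (simp_all only: XfY)
    have Pg': "?Pg' \<in> Hom M' (Dom M' (\<xi>' (omap BF X))) (Dom M' (\<xi>' (omap BF Y)))"
        "\<xi>' (omap BF Y) \<cdot>\<^bsub>M'\<^esub> ?Pg' = amap F f \<cdot>\<^bsub>M'\<^esub> \<xi>' (omap BF X)"
      using A'.prim_amap[OF \<xi>' BFg] by (simp_all only: XfY amap_BialgF)
    note xi = A.xi_Hom[OF \<xi> XY(1)] A.xi_Hom[OF \<xi> XY(2)]
    have \<theta>X: "\<theta> X \<in> Hom M' (Dom M' (\<xi>' (omap BF X))) (omap F (Dom M (\<xi> X)))"
        "amap F (\<xi> X) \<cdot>\<^bsub>M'\<^esub> \<theta> X = \<xi>' (omap BF X)"
      and \<theta>Y: "\<theta> Y \<in> Hom M' (Dom M' (\<xi>' (omap BF Y))) (omap F (Dom M (\<xi> Y)))"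
        "amap F (\<xi> Y) \<cdot>\<^bsub>M'\<^esub> \<theta> Y = \<xi>' (omap BF Y)"
      using \<theta>[OF XY(1)] \<theta>[OF XY(2)] xi by simp_all
    have "amap F (\<xi> Y) \<cdot>\<^bsub>M'\<^esub> (\<theta> Y \<cdot>\<^bsub>M'\<^esub> ?Pg') = (amap F (\<xi> Y) \<cdot>\<^bsub>M'\<^esub> \<theta> Y) \<cdot>\<^bsub>M'\<^esub> ?Pg'"
      using \<theta>Y(1) Pg'(1) xi by simp
    also have "\<dots> = amap F f \<cdot>\<^bsub>M'\<^esub> (amap F (\<xi> X) \<cdot>\<^bsub>M'\<^esub> \<theta> X)"
      by (simp only: \<theta>X(2) \<theta>Y(2) Pg'(2))
    also have "\<dots> = amap F (f \<cdot>\<^bsub>M\<^esub> \<xi> X) \<cdot>\<^bsub>M'\<^esub> \<theta> X"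
      using \<theta>X(1) xi f by simp
    also have "\<dots> = amap F (\<xi> Y \<cdot>\<^bsub>M\<^esub> ?Pg) \<cdot>\<^bsub>M'\<^esub> \<theta> X"
      by (simp only: Pg(2))
    also have "\<dots> = amap F (\<xi> Y) \<cdot>\<^bsub>M'\<^esub> (amap F ?Pg \<cdot>\<^bsub>M'\<^esub> \<theta> X)"
      using \<theta>X(1) xi Pg(1) by simp
    finally have eq: "amap F (\<xi> Y) \<cdot>\<^bsub>M'\<^esub> (\<theta> Y \<cdot>\<^bsub>M'\<^esub> ?Pg') = amap F (\<xi> Y) \<cdot>\<^bsub>M'\<^esub> (amap F ?Pg \<cdot>\<^bsub>M'\<^esub> \<theta> X)" .
    obtain B m u d e where YB: "omap BF Y = (B, m, u, d, e)" by (cases "omap BF Y")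
    have "is_equalizer M' d (prim_sum M' add' B u) (amap F (\<xi> Y))"
      using F\<xi>[OF XY(2)] unfolding YB is_primitive_equalizer_iff .
    then have "\<theta> Y \<cdot>\<^bsub>M'\<^esub> ?Pg' = amap F ?Pg \<cdot>\<^bsub>M'\<^esub> \<theta> X"
      by (rule M'.equalizer_mono[OF _ _ _ eq]) (use \<theta>X(1) \<theta>Y(1) Pg(1) Pg'(1) xi in simp_all)
    then show "\<theta> Y \<cdot>\<^bsub>M'\<^esub> amap (prim M' \<xi>' \<circ>\<^sub>F BF) g = amap (F \<circ>\<^sub>F prim M \<xi>) g \<cdot>\<^bsub>M'\<^esub> \<theta> X"
      by (simp add: comp_fctr_def)
  qed
  then show thesis using that \<theta> by blast
qed

end

text \<open>The convention that specific equalizers can be chosen appears as an existential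
  quantifier over \<open>\<xi>'\<close> in the equalities for the primitives; the last clause
  records what holds for every \<open>\<xi>'\<close>.\<close>

theorem proposition4p10:
  fixes M :: "('o, 'a) bmcat" and M' :: "('p, 'b) bmcat"
    and F :: "('o, 'a, 'p, 'b) fctr" and \<phi>0 :: "'b" and \<phi>2 :: "'o \<Rightarrow> 'o \<Rightarrow> 'b"
  assumes "braided_monoidal_category M"
    and "braided_monoidal_category M'"
    and "braided_monoidal_functor M M' F \<phi>0 \<phi>2"
  shows "cfunctor (Bialg M) (Bialg M') (BialgF M' F \<phi>0 \<phi>2) \<and>
     functor_eq M (Br M') (J M' \<circ>\<^sub>F F) (BrF M' F \<phi>2 \<circ>\<^sub>F J M) \<and>
     functor_eq (Bialg M) (BrBialg M')
       (J_Bialg M' \<circ>\<^sub>F BialgF M' F \<phi>0 \<phi>2) (BrBialgF M' F \<phi>0 \<phi>2 \<circ>\<^sub>F J_Bialg M) \<and>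
     functor_eq (Bialg M) (Alg M')
       (forget_to_Alg \<circ>\<^sub>F BialgF M' F \<phi>0 \<phi>2) (AlgF M' F \<phi>0 \<phi>2 \<circ>\<^sub>F forget_to_Alg) \<and>
     (equivalence_functor M M' F \<longrightarrow>
        equivalence_functor (Bialg M) (Bialg M') (BialgF M' F \<phi>0 \<phi>2)) \<and>
     (isomorphism_functor M M' F \<longrightarrow>
        isomorphism_functor (Bialg M) (Bialg M') (BialgF M' F \<phi>0 \<phi>2)) \<and>
     (conservative_functor M M' F \<longrightarrow>
        conservative_functor (Bialg M) (Bialg M') (BialgF M' F \<phi>0 \<phi>2)) \<and>
     (\<forall>add add' \<xi>.
        preadditive_with_equalizers M add \<and> preadditive_with_equalizers M' add' \<and>
        additive_functor M add M' add' F \<and> preserves_equalizers M M' F \<and>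
        primitive_choice M add \<xi> \<longrightarrow>
          ((\<forall>B \<in> Obj (Bialg M). \<forall>C \<in> Obj (Bialg M).
              omap (BialgF M' F \<phi>0 \<phi>2) B = omap (BialgF M' F \<phi>0 \<phi>2) C \<longrightarrow>
              amap F (\<xi> B) = amap F (\<xi> C)) \<longrightarrow>
           (\<exists>\<xi>'. primitive_choice M' add' \<xi>' \<and>
              functor_eq (Bialg M) M'
                (prim M' \<xi>' \<circ>\<^sub>F BialgF M' F \<phi>0 \<phi>2) (F \<circ>\<^sub>F prim M \<xi>) \<and>
              nat_eq (Bialg M) M'
                (prim M' \<xi>' \<circ>\<^sub>F BialgF M' F \<phi>0 \<phi>2) (forget_Bialg \<circ>\<^sub>F BialgF M' F \<phi>0 \<phi>2)
                (\<xi>' \<circ> omap (BialgF M' F \<phi>0 \<phi>2)) (amap F \<circ> \<xi>))) \<and>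
          (\<forall>\<xi>'. primitive_choice M' add' \<xi>' \<longrightarrow>
             (\<exists>\<theta>. natural_iso (Bialg M) M'
                (prim M' \<xi>' \<circ>\<^sub>F BialgF M' F \<phi>0 \<phi>2) (F \<circ>\<^sub>F prim M \<xi>) \<theta> \<and>
                (\<forall>B \<in> Obj (Bialg M).
                   amap F (\<xi> B) \<cdot>\<^bsub>M'\<^esub> \<theta> B = \<xi>' (omap (BialgF M' F \<phi>0 \<phi>2) B)))))"
proof -
  interpret F: braided_monoidal_functor M M' F \<phi>0 \<phi>2 by fact
  let ?B = "BialgF M' F \<phi>0 \<phi>2"
  show ?thesis
  proof (intro conjI allI impI F.cfunctor_BialgF F.functor_eq_J F.functor_eq_J_Bialg
      F.functor_eq_forget_to_Alg F.equivalence_BialgF F.isomorphism_BialgF F.conservative_BialgF)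
    fix add add' \<xi>
    assume *: "preadditive_with_equalizers M add \<and> preadditive_with_equalizers M' add' \<and>
      additive_functor M add M' add' F \<and> preserves_equalizers M M' F \<and> primitive_choice M add \<xi>"
    then have A: "preadditive_with_equalizers M add" and A': "preadditive_with_equalizers M' add'"
      and F: "additive_functor M add M' add' F" "preserves_equalizers M M' F"
      and \<xi>: "primitive_choice M add \<xi>"
      by blast+
    show "\<exists>\<xi>'. primitive_choice M' add' \<xi>' \<and>
        functor_eq (Bialg M) M' (prim M' \<xi>' \<circ>\<^sub>F ?B) (F \<circ>\<^sub>F prim M \<xi>) \<and>
        nat_eq (Bialg M) M' (prim M' \<xi>' \<circ>\<^sub>F ?B) (forget_Bialg \<circ>\<^sub>F ?B) (\<xi>' \<circ> omap ?B) (amap F \<circ> \<xi>)"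
      if "\<forall>B \<in> Obj (Bialg M). \<forall>C \<in> Obj (Bialg M). omap ?B B = omap ?B C \<longrightarrow> amap F (\<xi> B) = amap F (\<xi> C)"
      using F.choose_image_equalizers[OF A A' F \<xi> that] F.prim_BialgF[OF A A' \<xi>] by metis
    show "\<exists>\<theta>. natural_iso (Bialg M) M' (prim M' \<xi>' \<circ>\<^sub>F ?B) (F \<circ>\<^sub>F prim M \<xi>) \<theta> \<and>
        (\<forall>B \<in> Obj (Bialg M). amap F (\<xi> B) \<cdot>\<^bsub>M'\<^esub> \<theta> B = \<xi>' (omap ?B B))"
      if "primitive_choice M' add' \<xi>'" for \<xi>'
      using F.prim_BialgF_natural_iso[OF A A' F \<xi> that] by metis
  qed
qed

end
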